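(* Let $\bm{\phi}:U(\mathfrak{g})\to\operatorname{End}(\hat S(\mathfrak{g}^* ))$ be a left Hopf action with $\bm{\phi}(-\hat x_i)(\partial^j)=\phi_i^j$, where $\phi_i^j=\delta_i^j+O(\partial)$ for all $i,j=1,\dots,n$. Then the $(\mathfrak{g},\bm{\phi})$-twisted Weyl algebra $A_{\mathfrak{g},\bm{\phi}}=U(\mathfrak{g})\sharp_{\bm{\phi}}\hat S(\mathfrak{g}^* )$ is isomorphic, as an algebra, to the Heisenberg double of the Hopf algebra $U(\mathfrak{g})$, where the dual topological Hopf algebra is $\hat S(\mathfrak{g}^* )$ with the $\bm{\phi}$-deformed coproduct $\Delta_{\bm{\phi}}$, and the Hopf pairing is $$\langle\hat u,P\rangle_{\bm{\phi}}=\bm{\phi}(S_{U(\mathfrak{g})}\hat u)(P)(1_{S(\mathfrak{g})}),\qquad \hat u\in U(\mathfrak{g}),\ P\in\hat S(\mathfrak{g}^* ).$$ In other words, the left action $\blacktriangleright$ of $\hat S(\mathfrak{g}^* )$ on $U(\mathfrak{g})$ (used for the second smash product structure, that of the Heisenberg double) satisfies, and is determined by, the formula $$P\blacktriangleright\hat u=\sum\langle\hat u_{(2)},P\rangle_{\bm{\phi}}\,\hat u_{(1)}$$ for all $\hat u\in U(\mathfrak{g})$ and $P\in\hat S(\mathfrak{g}^* )$. Consequently, the phase space algebra of $U(\mathfrak{g})$ with the $\phi$-deformed derivatives is isomorphic to this Heisenberg double.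
   Context: $\bm{k}$ is a field of characteristic zero, $\mathfrak{g}$ is a finite-dimensional Lie algebra over $\bm{k}$ with basis $\hat x_1,\dots,\hat x_n$, which also generate the enveloping algebra $U(\mathfrak{g})$ (with its standard Hopf algebra structure, antipode $S_{U(\mathfrak{g})}$, Sweedler notation $\Delta(\hat u)=\sum\hat u_{(1)}\otimes\hat u_{(2)}$). $S(\mathfrak{g})$ is the symmetric algebra, with the corresponding commuting generators $x_1,\dots,x_n$. $\hat S(\mathfrak{g}^* )=\bm{k}[[\partial^1,\dots,\partial^n]]$ is the completed symmetric algebra on the dual, with $\partial^1,\dots,\partial^n$ the dual basis; its elements act on $S(\mathfrak{g})$ as (infinite order) differential operators with constant coefficients, $\partial^i=\partial/\partial x_i$, so $P(1_{S(\mathfrak{g})})$ is the constant term of $P$, viewed as an element of $\bm{k}$. $O(\partial)$ denotes a power series without constant term. A left Hopf action of a Hopf algebra $H$ on an algebra $A$ is a left action with $h\triangleright(ab)=\sum(h_{(1)}\triangleright a)(h_{(2)}\triangleright b)$ and $h\triangleright 1=\epsilon(h)1$ (i.e. $A$ is a left $H$-module algebra). A left Hopf action $\bm{\phi}$ of $U(\mathfrak{g})$ on $\hat S(\mathfrak{g}^* )$ is equivalently the multiplicative extension of a Lie algebra homomorphism $\mathfrak{g}\to\operatorname{Der}(\hat S(\mathfrak{g}^* ))$. Twisted Weyl algebra: $A_{\mathfrak{g},\bm{\phi}}=U(\mathfrak{g})\sharp_{\bm{\phi}}\hat S(\mathfrak{g}^* )$ is the smash product algebra for $\bm{\phi}$: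 the associative algebra with underlying space $U(\mathfrak{g})\otimes\hat S(\mathfrak{g}^* )$, containing $U(\mathfrak{g})$ and $\hat S(\mathfrak{g}^* )$ as subalgebras, with $\hat u\otimes P=\hat u\cdot P$ and $\hat x P-P\hat x=\bm{\phi}(\hat x)(P)$ for $\hat x\in\mathfrak{g}$, $P\in\hat S(\mathfrak{g}^* )$; explicitly $(\hat u\otimes P)(\hat v\otimes Q)=\sum\hat u\hat v_{(1)}\otimes\bm{\phi}(S_{U(\mathfrak{g})}\hat v_{(2)})(P)\,Q$. Black action: for $a\in A_{\mathfrak{g},\bm{\phi}}$ and $\hat u\in U(\mathfrak{g})$, $a\blacktriangleright\hat u\in U(\mathfrak{g})$ is obtained by multiplying $a\cdot\hat u$ in $A_{\mathfrak{g},\bm{\phi}}=U(\mathfrak{g})\otimes\hat S(\mathfrak{g}^* )$ and then applying the second tensor factor to $1_{S(\mathfrak{g})}$ (i.e. taking its constant term). Restricting to $a=P\in\hat S(\mathfrak{g}^* )$ gives the left action $\blacktriangleright$ of $\hat S(\mathfrak{g}^* )$ on $U(\mathfrak{g})$. $\bm{\phi}$-deformed coproduct: $\Delta_{\bm{\phi}}:\hat S(\mathfrak{g}^* )\to\hat S(\mathfrak{g}^* )\hat\otimes\hat S(\mathfrak{g}^* )$ (completed tensor product, i.e. formal power series in $\partial^i\otimes 1$ and $1\otimes\partial^i$), $P\mapsto\sum P_{(1)}\otimes P_{(2)}$, is the unique map satisfying the Leibniz rule $P\blacktriangleright(\hat u\hat v)=\sum(P_{(1)}\blacktriangleright\hat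 u)(P_{(2)}\blacktriangleright\hat v)$ for all $\hat u,\hat v\in U(\mathfrak{g})$. With the usual commutative product of power series and the constant term as counit, this makes $\hat S(\mathfrak{g}^* )$ a topological Hopf algebra. Hopf pairing: a pairing $\langle\,,\rangle:H\otimes H'\to\bm{k}$ with $\langle\Delta_H(a),b\otimes c\rangle=\langle a,bc\rangle$, $\langle a\otimes a',\Delta_{H'}(b)\rangle=\langle aa',b\rangle$, $\langle a,1\rangle=\epsilon_H(a)$, $\langle 1,b\rangle=\epsilon_{H'}(b)$. Heisenberg double: given Hopf algebras $H,H'$ ($H'$ possibly topological) with a Hopf pairing $\langle\,,\rangle:H\otimes H'\to\bm{k}$, the coregular action of $H'$ on $H$ is $h'\triangleright h=\sum h_{(1)}\langle h_{(2)},h'\rangle$; it is a Hopf action, and the Heisenberg double of $(H,H',\langle\,,\rangle)$ is the smash product algebra $H\sharp H'$, with underlying space (a completion, if needed, of) $H\otimes H'$ and multiplication $(a\otimes h')(b\otimes g')=\sum a\,(h'_{(1)}\triangleright b)\otimes h'_{(2)}g'$. Phase space algebra with the $\phi$-deformed derivatives: the quotient of the free product of the associative algebras $U(\mathfrak{g})$ and $\hat S(\mathfrak{g}^* )$ by the commutation relations $[\partial^j,\hat x_i]=\phi_i^j$, $i,j=1,\dots,n$, understood as extended to formal power series, i.e. $[P,\hat x_i]=\sum_j\frac{\partial P}{\partial(\partial^j)}\,\phi_i^j=\bm{\phi}(-\hat x_i)(P)$ for all $P\in\hat S(\mathfrak{g}^* )$. *)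

theory Defs
  imports
    HOL.Vector_Spaces
    "HOL-Library.Poly_Mapping"
    "HOL-Algebra.QuotRing"
    "HOL-Algebra.Module"
begin

section \<open>Formal power series in finitely many variables\<close>

text \<open>
  Exponents are functions \<open>'v \<Rightarrow> nat\<close>.  The completed tensor product of the power series
  ring in variables \<open>'v\<close> with the one in variables \<open>'w\<close> is the power series ring in variables
  \<open>'v + 'w\<close>; the exponent of \<open>\<partial>\<^sup>a \<otimes> \<partial>\<^sup>b\<close> is \<open>case_sum a b\<close>.
\<close>

typedef ('v, 'k) mvps = "UNIV :: (('v \<Rightarrow> nat) \<Rightarrow> 'k) set"
  morphisms coeff Mvps by simp

setup_lifting type_definition_mvps

lemma mvps_eqI: "(\<And>m. coeff P m = coeff Q m) \<Longrightarrow> P = Q"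
  by (metis coeff_inverse ext)

lemma coeff_Mvps [simp]: "coeff (Mvps f) = f"
  by (simp add: Mvps_inverse)

definition splits :: "('v \<Rightarrow> nat) \<Rightarrow> (('v \<Rightarrow> nat) \<times> ('v \<Rightarrow> nat)) set" where
  "splits m = {(a, b). (\<lambda>v. a v + b v) = m}"

lemma finite_splits [simp]: "finite (splits (m :: 'v::finite \<Rightarrow> nat))"
proof -
  have "finite (PiE UNIV (\<lambda>v. {..m v}))"
    by (rule finite_PiE) auto
  moreover have "splits m \<subseteq> PiE UNIV (\<lambda>v. {..m v}) \<times> PiE UNIV (\<lambda>v. {..m v})"
    by (auto simp: splits_def)
  ultimately show ?thesis
    by (meson finite_SigmaI finite_subset)
qed

instantiation mvps :: (type, ab_group_add) ab_group_add
begin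
lift_definition zero_mvps :: "('a, 'b) mvps" is "\<lambda>_. 0" .
lift_definition plus_mvps :: "('a, 'b) mvps \<Rightarrow> ('a, 'b) mvps \<Rightarrow> ('a, 'b) mvps"
  is "\<lambda>P Q m. P m + Q m" .
lift_definition uminus_mvps :: "('a, 'b) mvps \<Rightarrow> ('a, 'b) mvps" is "\<lambda>P m. - P m" .
lift_definition minus_mvps :: "('a, 'b) mvps \<Rightarrow> ('a, 'b) mvps \<Rightarrow> ('a, 'b) mvps"
  is "\<lambda>P Q m. P m - Q m" .
instance
  by standard (transfer, simp add: algebra_simps fun_eq_iff)+
end

instantiation mvps :: (finite, comm_ring_1) comm_ring_1
begin
lift_definition one_mvps :: "('a, 'b) mvps" is "\<lambda>m. if m = (\<lambda>_. 0) then 1 else 0" .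
lift_definition times_mvps :: "('a, 'b) mvps \<Rightarrow> ('a, 'b) mvps \<Rightarrow> ('a, 'b) mvps"
  is "\<lambda>P Q m. \<Sum>(a, b)\<in>splits m. P a * Q b" .
instance
proof
  fix P Q R :: "('a, 'b) mvps"
  show "P * Q * R = P * (Q * R)"
  proof transfer
    fix P Q R :: "('a \<Rightarrow> nat) \<Rightarrow> 'b"
    show "(\<lambda>m. \<Sum>(a, b)\<in>splits m. (\<Sum>(a, b)\<in>splits a. P a * Q b) * R b) =
          (\<lambda>m. \<Sum>(a, b)\<in>splits m. P a * (\<Sum>(a, b)\<in>splits b. Q a * R b))"
    proof
      fix m
      have "(\<Sum>(a, b)\<in>splits m. (\<Sum>(c, d)\<in>splits a. P c * Q d) * R b)
          = (\<Sum>x\<in>splits m. \<Sum>y\<in>splits (fst x). P (fst y) * Q (snd y) * R (snd x))"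
        by (simp add: sum_distrib_right case_prod_unfold)
      also have "\<dots> = (\<Sum>(x, y)\<in>Sigma (splits m) (\<lambda>x. splits (fst x)).
                        P (fst y) * Q (snd y) * R (snd x))"
        by (simp add: sum.Sigma)
      also have "\<dots> = (\<Sum>(x, y)\<in>Sigma (splits m) (\<lambda>x. splits (snd x)).
                        P (fst x) * (Q (fst y) * R (snd y)))"
        by (rule sum.reindex_bij_witness[where
              i = "\<lambda>(x, y). ((\<lambda>v. fst x v + fst y v, snd y), (fst x, fst y))" and
              j = "\<lambda>(x, y). ((fst y, \<lambda>v. snd y v + snd x v), (snd y, snd x))"])
           (auto simp: splits_def fun_eq_iff mult.assoc, (metis add.assoc)+)
      also have "\<dots> = (\<Sum>x\<in>splits m. \<Sum>y\<in>splits (snd x). P (fst x) * (Q (fst y) * R (snd y)))"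
        by (simp add: sum.Sigma)
      also have "\<dots> = (\<Sum>(a, b)\<in>splits m. P a * (\<Sum>(c, d)\<in>splits b. Q c * R d))"
        by (simp add: sum_distrib_left case_prod_unfold)
      finally show "(\<Sum>(a, b)\<in>splits m. (\<Sum>(a, b)\<in>splits a. P a * Q b) * R b) =
          (\<Sum>(a, b)\<in>splits m. P a * (\<Sum>(a, b)\<in>splits b. Q a * R b))" .
    qed
  qed
  show "P * Q = Q * P"
  proof transfer
    fix P Q :: "('a \<Rightarrow> nat) \<Rightarrow> 'b"
    show "(\<lambda>m. \<Sum>(a, b)\<in>splits m. P a * Q b) = (\<lambda>m. \<Sum>(a, b)\<in>splits m. Q a * P b)"
    proof
      fix m
      show "(\<Sum>(a, b)\<in>splits m. P a * Q b) = (\<Sum>(a, b)\<in>splits m. Q a * P b)"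
        by (rule sum.reindex_bij_witness[where i = prod.swap and j = prod.swap])
           (auto simp: splits_def fun_eq_iff add.commute mult.commute)
    qed
  qed
  show "1 * P = P"
  proof transfer
    fix P :: "('a \<Rightarrow> nat) \<Rightarrow> 'b"
    show "(\<lambda>m. \<Sum>(a, b)\<in>splits m. (if a = (\<lambda>_. 0) then 1 else 0) * P b) = P"
    proof
      fix m
      have "sum (\<lambda>(a, b). (if a = (\<lambda>_. 0) then 1 else 0) * P b) (splits m)
          = sum (\<lambda>(a, b). (if a = (\<lambda>_. 0) then 1 else 0) * P b) {(\<lambda>_::'a. 0::nat, m)}"
        by (rule sum.mono_neutral_right, simp) (auto simp: splits_def split: if_splits)
      then show "(\<Sum>(a, b)\<in>splits m. (if a = (\<lambda>_. 0) then 1 else 0) * P b) = P m"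
        by simp
    qed
  qed
  show "(P + Q) * R = P * R + Q * R"
    by transfer (simp add: fun_eq_iff distrib_right sum.distrib case_prod_unfold)
  show "(0 :: ('a, 'b) mvps) \<noteq> 1"
    by transfer (metis zero_neq_one)
qed
end

definition mvps_scale :: "'k::comm_ring_1 \<Rightarrow> ('v, 'k) mvps \<Rightarrow> ('v, 'k) mvps" where
  "mvps_scale c P = Mvps (\<lambda>m. c * coeff P m)"

definition mvps_monom :: "('v \<Rightarrow> nat) \<Rightarrow> ('v, 'k::comm_ring_1) mvps" where
  "mvps_monom a = Mvps (\<lambda>m. if m = a then 1 else 0)"

definition mvps_var :: "'v \<Rightarrow> ('v, 'k::comm_ring_1) mvps" where
  "mvps_var j = mvps_monom (\<lambda>v. if v = j then 1 else 0)"

text \<open>The constant term, that is, \<open>P(1)\<close> for \<open>P\<close> acting as a differential operator.\<close>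

definition const_term :: "('v, 'k) mvps \<Rightarrow> 'k" where
  "const_term P = coeff P (\<lambda>_. 0)"

definition mvps_pderiv :: "'v \<Rightarrow> ('v, 'k::comm_ring_1) mvps \<Rightarrow> ('v, 'k) mvps" where
  "mvps_pderiv j P = Mvps (\<lambda>m. of_nat (Suc (m j)) * coeff P (m(j := Suc (m j))))"

text \<open>\<open>F = \<Sum>\<^sub>a \<partial>\<^sup>a \<otimes> mvps_slice F a\<close>.\<close>

definition mvps_slice :: "('v + 'w, 'k) mvps \<Rightarrow> ('v \<Rightarrow> nat) \<Rightarrow> ('w, 'k) mvps" where
  "mvps_slice F a = Mvps (\<lambda>b. coeff F (case_sum a b))"

text \<open>
  Continuity refers to the topology of coefficientwise convergence with discrete scalars:
  a linear functional is continuous iff it vanishes on a basic neighbourhood of \<open>0\<close>.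
\<close>

definition continuous_functional :: "(('v, 'k::comm_ring_1) mvps \<Rightarrow> 'k) \<Rightarrow> bool" where
  "continuous_functional l \<longleftrightarrow>
     (\<forall>P Q. l (P + Q) = l P + l Q) \<and> (\<forall>c P. l (mvps_scale c P) = c * l P) \<and>
     (\<exists>A. finite A \<and> (\<forall>P. (\<forall>a\<in>A. coeff P a = 0) \<longrightarrow> l P = 0))"

definition continuous_linear ::
    "(('v, 'k::comm_ring_1) mvps \<Rightarrow> ('w, 'k) mvps) \<Rightarrow> bool" where
  "continuous_linear f \<longleftrightarrow> (\<forall>m. continuous_functional (\<lambda>P. coeff (f P) m))"

text \<open>
  \<open>f \<otimes> g\<close> extended to the completed tensor product.  For continuous linear \<open>f\<close> and \<open>g\<close>
  only finitely many summands of each coefficient are nonzero.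
\<close>

definition tensor_map ::
    "(('v, 'k::comm_ring_1) mvps \<Rightarrow> ('v1, 'k) mvps) \<Rightarrow> (('w, 'k) mvps \<Rightarrow> ('w1, 'k) mvps)
     \<Rightarrow> ('v + 'w, 'k) mvps \<Rightarrow> ('v1 + 'w1, 'k) mvps" where
  "tensor_map f g F = Mvps (\<lambda>m. Sum_any (\<lambda>(a, b).
     coeff F (case_sum a b) * coeff (f (mvps_monom a)) (m \<circ> Inl) * coeff (g (mvps_monom b)) (m \<circ> Inr)))"

definition reassoc :: "(('u + 'v) + 'w, 'k) mvps \<Rightarrow> ('u + ('v + 'w), 'k) mvps" where
  "reassoc F = Mvps (\<lambda>m. coeff F (case_sum (case_sum (m \<circ> Inl) (m \<circ> Inr \<circ> Inl)) (m \<circ> Inr \<circ> Inr)))"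

text \<open>The continuous extension of the multiplication \<open>P \<otimes> Q \<mapsto> P * Q\<close>.\<close>

definition mvps_fold :: "('v + 'v, 'k::comm_ring_1) mvps \<Rightarrow> ('v, 'k) mvps" where
  "mvps_fold F = Mvps (\<lambda>m. \<Sum>(a, b)\<in>splits m. coeff F (case_sum a b))"


section \<open>Associative algebras over a field\<close>

text \<open>
  Algebras are records of type \<^type>\<open>module\<close>; the fields of the scalars are
  those of a type \<open>'k\<close> of class \<^class>\<open>field\<close>.  (The locale \<open>algebra\<close> of the library is
  restricted to commutative algebras.)
\<close>

definition scalars :: "('k::field, 'k) module" where
  "scalars = \<lparr>carrier = UNIV, mult = (*), one = 1, zero = 0, add = (+), smult = (*)\<rparr>"

definition assoc_algebra :: "('k::field, 'a, 'x) module_scheme \<Rightarrow> bool" where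
  "assoc_algebra A \<longleftrightarrow> module (scalars :: ('k, 'k) module) A \<and> ring A \<and>
     (\<forall>c. \<forall>a\<in>carrier A. \<forall>b\<in>carrier A.
        (c \<odot>\<^bsub>A\<^esub> a) \<otimes>\<^bsub>A\<^esub> b = c \<odot>\<^bsub>A\<^esub> (a \<otimes>\<^bsub>A\<^esub> b) \<and> a \<otimes>\<^bsub>A\<^esub> (c \<odot>\<^bsub>A\<^esub> b) = c \<odot>\<^bsub>A\<^esub> (a \<otimes>\<^bsub>A\<^esub> b))"

definition linear_hom ::
    "('k, 'a, 'x) module_scheme \<Rightarrow> ('k, 'b, 'y) module_scheme \<Rightarrow> ('a \<Rightarrow> 'b) set" where
  "linear_hom V W = {f. f \<in> carrier V \<rightarrow> carrier W \<and>
     (\<forall>a\<in>carrier V. \<forall>b\<in>carrier V. f (a \<oplus>\<^bsub>V\<^esub> b) = f a \<oplus>\<^bsub>W\<^esub> f b) \<and>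
     (\<forall>c. \<forall>a\<in>carrier V. f (c \<odot>\<^bsub>V\<^esub> a) = c \<odot>\<^bsub>W\<^esub> f a)}"

definition algebra_hom ::
    "('k, 'a, 'x) module_scheme \<Rightarrow> ('k, 'b, 'y) module_scheme \<Rightarrow> ('a \<Rightarrow> 'b) set" where
  "algebra_hom A B = linear_hom A B \<inter> ring_hom A B"

definition isomorphic_algebras ::
    "('k::field, 'a, 'x) module_scheme \<Rightarrow> ('k, 'b, 'y) module_scheme \<Rightarrow> bool" where
  "isomorphic_algebras A B \<longleftrightarrow> assoc_algebra A \<and> assoc_algebra B \<and>
     (\<exists>f \<in> algebra_hom A B. bij_betw f (carrier A) (carrier B))"

definition mvps_algebra :: "('k::field, ('n::finite, 'k) mvps) module" where
  "mvps_algebra = \<lparr>carrier = UNIV, mult = (*), one = 1, zero = 0, add = (+), smult = mvps_scale\<rparr>"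

definition opposite :: "('k, 'a, 'x) module_scheme \<Rightarrow> ('k, 'a, 'x) module_scheme" where
  "opposite A = A\<lparr>mult := \<lambda>a b. b \<otimes>\<^bsub>A\<^esub> a\<rparr>"

text \<open>Quotient by a two-sided ideal, or (disregarding multiplication) by a subspace.\<close>

definition quotient :: "('k, 'a, 'x) module_scheme \<Rightarrow> 'a set \<Rightarrow> ('k, 'a set) module" where
  "quotient A I =
     \<lparr>carrier = carrier (A Quot I), mult = mult (A Quot I), one = one (A Quot I),
      zero = zero (A Quot I), add = add (A Quot I),
      smult = \<lambda>c X. \<Union>a\<in>X. I +>\<^bsub>A\<^esub> (c \<odot>\<^bsub>A\<^esub> a)\<rparr>"


section \<open>Tensor products\<close>

definition scale_pm :: "'k::semiring_0 \<Rightarrow> ('b \<Rightarrow>\<^sub>0 'k) \<Rightarrow> ('b \<Rightarrow>\<^sub>0 'k)" where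
  "scale_pm c f = Poly_Mapping.map ((*) c) f"

text \<open>The vector space with basis \<open>B\<close>; its multiplication and unit are irrelevant.\<close>

definition free_space :: "'b set \<Rightarrow> ('k::field, 'b \<Rightarrow>\<^sub>0 'k) module" where
  "free_space B = \<lparr>carrier = {f. Poly_Mapping.keys f \<subseteq> B}, mult = (\<lambda>_ _. 0), one = 0,
     zero = 0, add = (+), smult = scale_pm\<rparr>"

inductive_set bilinear_relations ::
    "('k::field, 'a, 'x) module_scheme \<Rightarrow> ('k, 'b, 'y) module_scheme \<Rightarrow> ('a \<times> 'b \<Rightarrow>\<^sub>0 'k) set"
  for V :: "('k::field, 'a, 'x) module_scheme" and W :: "('k, 'b, 'y) module_scheme" where
  zero: "0 \<in> bilinear_relations V W"
| add: "f \<in> bilinear_relations V W \<Longrightarrow> g \<in> bilinear_relations V W \<Longrightarrow> f + g \<in> bilinear_relations V W"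
| scale: "f \<in> bilinear_relations V W \<Longrightarrow> scale_pm c f \<in> bilinear_relations V W"
| add_left: "v \<in> carrier V \<Longrightarrow> v' \<in> carrier V \<Longrightarrow> w \<in> carrier W \<Longrightarrow>
    Poly_Mapping.single (v \<oplus>\<^bsub>V\<^esub> v', w) 1 - (Poly_Mapping.single (v, w) 1 + Poly_Mapping.single (v', w) 1)
      \<in> bilinear_relations V W"
| add_right: "v \<in> carrier V \<Longrightarrow> w \<in> carrier W \<Longrightarrow> w' \<in> carrier W \<Longrightarrow>
    Poly_Mapping.single (v, w \<oplus>\<^bsub>W\<^esub> w') 1 - (Poly_Mapping.single (v, w) 1 + Poly_Mapping.single (v, w') 1)
      \<in> bilinear_relations V W"
| scale_left: "v \<in> carrier V \<Longrightarrow> w \<in> carrier W \<Longrightarrow>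
    Poly_Mapping.single (c \<odot>\<^bsub>V\<^esub> v, w) 1 - Poly_Mapping.single (v, w) c \<in> bilinear_relations V W"
| scale_right: "v \<in> carrier V \<Longrightarrow> w \<in> carrier W \<Longrightarrow>
    Poly_Mapping.single (v, c \<odot>\<^bsub>W\<^esub> w) 1 - Poly_Mapping.single (v, w) c \<in> bilinear_relations V W"

definition tensor_space ::
    "('k::field, 'a, 'x) module_scheme \<Rightarrow> ('k, 'b, 'y) module_scheme
     \<Rightarrow> ('k, ('a \<times> 'b \<Rightarrow>\<^sub>0 'k) set) module" where
  "tensor_space V W = quotient (free_space (carrier V \<times> carrier W)) (bilinear_relations V W)"

definition tensor ::
    "('k::field, 'a, 'x) module_scheme \<Rightarrow> ('k, 'b, 'y) module_scheme
     \<Rightarrow> 'a \<Rightarrow> 'b \<Rightarrow> ('a \<times> 'b \<Rightarrow>\<^sub>0 'k) set" where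
  "tensor V W v w =
     bilinear_relations V W +>\<^bsub>free_space (carrier V \<times> carrier W)\<^esub> Poly_Mapping.single (v, w) 1"

text \<open>
  The linear map into \<open>Z\<close> on a tensor product induced by a bilinear map \<open>f\<close>, that is,
  \<open>\<Sum> v \<otimes> w \<mapsto> \<Sum> f v w\<close>; in particular \<open>tensor_lift Z f (comult H h)\<close> is what is written
  \<open>\<Sum> f h\<^sub>(\<^sub>1\<^sub>) h\<^sub>(\<^sub>2\<^sub>)\<close> in Sweedler notation.
\<close>

definition tensor_lift ::
    "('k::field, 'c, 'z) module_scheme \<Rightarrow> ('a \<Rightarrow> 'b \<Rightarrow> 'c) \<Rightarrow> ('a \<times> 'b \<Rightarrow>\<^sub>0 'k) set \<Rightarrow> 'c" where
  "tensor_lift Z f X = the_elem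
     ((\<lambda>r. \<Oplus>\<^bsub>Z\<^esub>p\<in>Poly_Mapping.keys r. Poly_Mapping.lookup r p \<odot>\<^bsub>Z\<^esub> f (fst p) (snd p)) ` X)"

definition tensor_algebra ::
    "('k::field, 'a, 'x) module_scheme \<Rightarrow> ('k, 'b, 'y) module_scheme
     \<Rightarrow> ('k, ('a \<times> 'b \<Rightarrow>\<^sub>0 'k) set) module" where
  "tensor_algebra A B = (tensor_space A B)
     \<lparr>mult := \<lambda>X Y. tensor_lift (tensor_space A B) (\<lambda>a b. tensor_lift (tensor_space A B)
                (\<lambda>c d. tensor A B (a \<otimes>\<^bsub>A\<^esub> c) (b \<otimes>\<^bsub>B\<^esub> d)) Y) X,
      one := tensor A B \<one>\<^bsub>A\<^esub> \<one>\<^bsub>B\<^esub>\<rparr>"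


section \<open>Free algebras, presentations and free products\<close>

datatype 'x free_monoid = Word (letters: "'x list")

instantiation free_monoid :: (type) monoid_add
begin
definition zero_free_monoid :: "'a free_monoid" where "0 = Word []"
definition plus_free_monoid :: "'a free_monoid \<Rightarrow> 'a free_monoid \<Rightarrow> 'a free_monoid" where
  "v + w = Word (letters v @ letters w)"
instance
  by standard (simp_all add: zero_free_monoid_def plus_free_monoid_def)
end

text \<open>
  With concatenation of words as the addition of exponents, the multiplication of
  \<open>'x free_monoid \<Rightarrow>\<^sub>0 'k\<close> is the one of noncommutative polynomials.
\<close>

definition free_algebra :: "'x set \<Rightarrow> ('k::field, 'x free_monoid \<Rightarrow>\<^sub>0 'k) module" where
  "free_algebra X = \<lparr>carrier = {f. \<forall>w\<in>Poly_Mapping.keys f. set (letters w) \<subseteq> X},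
     mult = (*), one = 1, zero = 0, add = (+), smult = scale_pm\<rparr>"

definition gen :: "'x \<Rightarrow> ('x free_monoid \<Rightarrow>\<^sub>0 'k::field)" where
  "gen x = Poly_Mapping.single (Word [x]) 1"

definition presented_algebra ::
    "'x set \<Rightarrow> ('x free_monoid \<Rightarrow>\<^sub>0 'k::field) set \<Rightarrow> ('k, ('x free_monoid \<Rightarrow>\<^sub>0 'k) set) module" where
  "presented_algebra X R = quotient (free_algebra X) (Idl\<^bsub>free_algebra X\<^esub> R)"

definition pres_gen ::
    "'x set \<Rightarrow> ('x free_monoid \<Rightarrow>\<^sub>0 'k::field) set \<Rightarrow> 'x \<Rightarrow> ('x free_monoid \<Rightarrow>\<^sub>0 'k) set" where
  "pres_gen X R x = (Idl\<^bsub>free_algebra X\<^esub> R) +>\<^bsub>free_algebra X\<^esub> gen x"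

text \<open>The algebra homomorphism on a presented algebra determined by its values on generators.\<close>

definition pres_lift ::
    "('k::field, 'b, 'y) module_scheme \<Rightarrow> ('x \<Rightarrow> 'b) \<Rightarrow> ('x free_monoid \<Rightarrow>\<^sub>0 'k) set \<Rightarrow> 'b" where
  "pres_lift B f X = the_elem ((\<lambda>r. \<Oplus>\<^bsub>B\<^esub>w\<in>Poly_Mapping.keys r. Poly_Mapping.lookup r w \<odot>\<^bsub>B\<^esub>
     foldr (\<lambda>x b. f x \<otimes>\<^bsub>B\<^esub> b) (letters w) \<one>\<^bsub>B\<^esub>) ` X)"

text \<open>The relations making \<open>\<lambda>a. gen (j a)\<close> a unital algebra homomorphism on \<open>A\<close>.\<close>

definition hom_relations ::
    "('k::field, 'a, 'x) module_scheme \<Rightarrow> ('a \<Rightarrow> 's) \<Rightarrow> ('s free_monoid \<Rightarrow>\<^sub>0 'k) set" where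
  "hom_relations A j =
     {gen (j (a \<oplus>\<^bsub>A\<^esub> b)) - (gen (j a) + gen (j b)) | a b. a \<in> carrier A \<and> b \<in> carrier A} \<union>
     {gen (j (c \<odot>\<^bsub>A\<^esub> a)) - scale_pm c (gen (j a)) | c a. a \<in> carrier A} \<union>
     {gen (j (a \<otimes>\<^bsub>A\<^esub> b)) - gen (j a) * gen (j b) | a b. a \<in> carrier A \<and> b \<in> carrier A} \<union>
     {gen (j \<one>\<^bsub>A\<^esub>) - 1}"

definition free_product ::
    "('k::field, 'a, 'x) module_scheme \<Rightarrow> ('k, 'b, 'y) module_scheme
     \<Rightarrow> ('k, (('a + 'b) free_monoid \<Rightarrow>\<^sub>0 'k) set) module" where
  "free_product A B = presented_algebra (carrier A <+> carrier B)
     (hom_relations A Inl \<union> hom_relations B Inr)"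

definition free_product_gen ::
    "('k::field, 'a, 'x) module_scheme \<Rightarrow> ('k, 'b, 'y) module_scheme
     \<Rightarrow> 'a + 'b \<Rightarrow> (('a + 'b) free_monoid \<Rightarrow>\<^sub>0 'k) set" where
  "free_product_gen A B = pres_gen (carrier A <+> carrier B)
     (hom_relations A Inl \<union> hom_relations B Inr)"


section \<open>Hopf algebras, Hopf actions and smash products\<close>

record (overloaded) ('k::zero, 'h) hopf = "('k, 'h) module" +
  comult :: "'h \<Rightarrow> ('h \<times> 'h \<Rightarrow>\<^sub>0 'k) set"
  counit :: "'h \<Rightarrow> 'k"
  antipode :: "'h \<Rightarrow> 'h"

definition hopf_algebra :: "('k::field, 'h) hopf \<Rightarrow> bool" where
  "hopf_algebra H \<longleftrightarrow> assoc_algebra H \<and>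
     comult H \<in> algebra_hom H (tensor_algebra H H) \<and>
     counit H \<in> algebra_hom H scalars \<and>
     antipode H \<in> linear_hom H H \<and>
     (\<forall>h\<in>carrier H.
        (let HH = tensor_space H H; HHH = tensor_space H HH in
         tensor_lift HHH (\<lambda>a b. tensor_lift HHH (\<lambda>a1 a2. tensor H HH a1 (tensor H H a2 b)) (comult H a))
           (comult H h)
         = tensor_lift HHH (\<lambda>a b. tensor H HH a (comult H b)) (comult H h)) \<and>
        tensor_lift H (\<lambda>a b. counit H a \<odot>\<^bsub>H\<^esub> b) (comult H h) = h \<and>
        tensor_lift H (\<lambda>a b. counit H b \<odot>\<^bsub>H\<^esub> a) (comult H h) = h \<and>
        tensor_lift H (\<lambda>a b. antipode H a \<otimes>\<^bsub>H\<^esub> b) (comult H h) = counit H h \<odot>\<^bsub>H\<^esub> \<one>\<^bsub>H\<^esub> \<and>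
        tensor_lift H (\<lambda>a b. a \<otimes>\<^bsub>H\<^esub> antipode H b) (comult H h) = counit H h \<odot>\<^bsub>H\<^esub> \<one>\<^bsub>H\<^esub>)"

definition left_hopf_action ::
    "('k::field, 'h) hopf \<Rightarrow> ('k, 'a, 'x) module_scheme \<Rightarrow> ('h \<Rightarrow> 'a \<Rightarrow> 'a) \<Rightarrow> bool" where
  "left_hopf_action H A act \<longleftrightarrow>
     (\<forall>h\<in>carrier H. act h \<in> linear_hom A A) \<and>
     (\<forall>a\<in>carrier A. (\<lambda>h. act h a) \<in> linear_hom H A) \<and>
     (\<forall>h\<in>carrier H. \<forall>h'\<in>carrier H. \<forall>a\<in>carrier A. act (h \<otimes>\<^bsub>H\<^esub> h') a = act h (act h' a)) \<and>
     (\<forall>a\<in>carrier A. act \<one>\<^bsub>H\<^esub> a = a) \<and>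
     (\<forall>h\<in>carrier H. \<forall>a\<in>carrier A. \<forall>b\<in>carrier A.
        act h (a \<otimes>\<^bsub>A\<^esub> b) = tensor_lift A (\<lambda>h1 h2. act h1 a \<otimes>\<^bsub>A\<^esub> act h2 b) (comult H h)) \<and>
     (\<forall>h\<in>carrier H. act h \<one>\<^bsub>A\<^esub> = counit H h \<odot>\<^bsub>A\<^esub> \<one>\<^bsub>A\<^esub>)"

text \<open>
  The smash product \<open>H \<sharp> A\<close> on \<open>H \<otimes> A\<close> with
  \<open>(u \<otimes> P) (v \<otimes> Q) = \<Sum> u v\<^sub>(\<^sub>1\<^sub>) \<otimes> act (S v\<^sub>(\<^sub>2\<^sub>)) P Q\<close>.
\<close>

definition smash_product ::
    "('k::field, 'h) hopf \<Rightarrow> ('k, 'a, 'x) module_scheme \<Rightarrow> ('h \<Rightarrow> 'a \<Rightarrow> 'a)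
     \<Rightarrow> ('k, ('h \<times> 'a \<Rightarrow>\<^sub>0 'k) set) module" where
  "smash_product H A act = (let T = tensor_space H A in T
     \<lparr>mult := \<lambda>X Y. tensor_lift T (\<lambda>u P. tensor_lift T (\<lambda>v Q. tensor_lift T
                (\<lambda>v1 v2. tensor H A (u \<otimes>\<^bsub>H\<^esub> v1) (act (antipode H v2) P \<otimes>\<^bsub>A\<^esub> Q)) (comult H v)) Y) X,
      one := tensor H A \<one>\<^bsub>H\<^esub> \<one>\<^bsub>A\<^esub>\<rparr>)"


section \<open>Power series as a topological Hopf algebra, and the Heisenberg double\<close>

text \<open>
  \<open>D\<close> is a coproduct for the usual algebra of power series; the counit is \<^const>\<open>const_term\<close>.
\<close>

definition topological_hopf_algebra ::
    "(('n::finite, 'k::field) mvps \<Rightarrow> ('n + 'n, 'k) mvps) \<Rightarrow> bool" where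
  "topological_hopf_algebra D \<longleftrightarrow> continuous_linear D \<and>
     D 1 = 1 \<and> (\<forall>P Q. D (P * Q) = D P * D Q) \<and>
     (\<forall>P. reassoc (tensor_map D id (D P)) = tensor_map id D (D P)) \<and>
     (\<forall>P m. coeff (D P) (case_sum (\<lambda>_. 0) m) = coeff P m) \<and>
     (\<forall>P m. coeff (D P) (case_sum m (\<lambda>_. 0)) = coeff P m) \<and>
     (\<exists>S. continuous_linear S \<and>
        (\<forall>P. mvps_fold (tensor_map S id (D P)) = mvps_scale (const_term P) 1) \<and>
        (\<forall>P. mvps_fold (tensor_map id S (D P)) = mvps_scale (const_term P) 1))"

text \<open>
  Continuity of the pairing in the second variable makes \<open>\<langle>h \<otimes> h', D P\<rangle>\<close> a finite sum.
\<close>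

definition hopf_pairing ::
    "('k::field, 'h) hopf \<Rightarrow> (('n::finite, 'k) mvps \<Rightarrow> ('n + 'n, 'k) mvps)
     \<Rightarrow> ('h \<Rightarrow> ('n, 'k) mvps \<Rightarrow> 'k) \<Rightarrow> bool" where
  "hopf_pairing H D pair \<longleftrightarrow>
     (\<forall>P. (\<lambda>h. pair h P) \<in> linear_hom H scalars) \<and>
     (\<forall>h\<in>carrier H. continuous_functional (pair h)) \<and>
     (\<forall>h\<in>carrier H. \<forall>P Q.
        tensor_lift scalars (\<lambda>h1 h2. pair h1 P * pair h2 Q) (comult H h) = pair h (P * Q)) \<and>
     (\<forall>h\<in>carrier H. \<forall>h'\<in>carrier H. \<forall>P.
        Sum_any (\<lambda>(a, b). coeff (D P) (case_sum a b) * (pair h (mvps_monom a) * pair h' (mvps_monom b)))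
          = pair (h \<otimes>\<^bsub>H\<^esub> h') P) \<and>
     (\<forall>h\<in>carrier H. pair h 1 = counit H h) \<and>
     (\<forall>P. pair \<one>\<^bsub>H\<^esub> P = const_term P)"

definition coregular_action ::
    "('k::field, 'h) hopf \<Rightarrow> ('h \<Rightarrow> 'p \<Rightarrow> 'k) \<Rightarrow> 'p \<Rightarrow> 'h \<Rightarrow> 'h" where
  "coregular_action H pair P h = tensor_lift H (\<lambda>h1 h2. pair h2 P \<odot>\<^bsub>H\<^esub> h1) (comult H h)"

definition heisenberg_data ::
    "('k::field, 'h) hopf \<Rightarrow> (('n::finite, 'k) mvps \<Rightarrow> ('n + 'n, 'k) mvps)
     \<Rightarrow> ('h \<Rightarrow> ('n, 'k) mvps \<Rightarrow> 'k) \<Rightarrow> bool" where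
  "heisenberg_data H D pair \<longleftrightarrow>
     hopf_algebra H \<and> topological_hopf_algebra D \<and> hopf_pairing H D pair"

text \<open>
  The product is \<open>(a \<otimes> P) (b \<otimes> Q) = \<Sum> a (P\<^sub>(\<^sub>1\<^sub>) \<triangleright> b) \<otimes> P\<^sub>(\<^sub>2\<^sub>) Q\<close>, where
  \<open>D P = \<Sum>\<^sub>c \<partial>\<^sup>c \<otimes> mvps_slice (D P) c\<close> and by continuity of the pairing
  \<open>\<partial>\<^sup>c \<triangleright> b = 0\<close> for all but finitely many \<open>c\<close>; so the algebraic tensor product needs no completion.
\<close>

definition heisenberg_double ::
    "('k::field, 'h) hopf \<Rightarrow> (('n::finite, 'k) mvps \<Rightarrow> ('n + 'n, 'k) mvps)
     \<Rightarrow> ('h \<Rightarrow> ('n, 'k) mvps \<Rightarrow> 'k) \<Rightarrow> ('k, ('h \<times> ('n, 'k) mvps \<Rightarrow>\<^sub>0 'k) set) module" where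
  "heisenberg_double H D pair =
     (let S = mvps_algebra; T = tensor_space H S; act = coregular_action H pair in T
     \<lparr>mult := \<lambda>X Y. tensor_lift T (\<lambda>a P. tensor_lift T (\<lambda>b Q.
                \<Oplus>\<^bsub>T\<^esub>c\<in>{c. act (mvps_monom c) b \<noteq> \<zero>\<^bsub>H\<^esub>}.
                  tensor H S (a \<otimes>\<^bsub>H\<^esub> act (mvps_monom c) b) (mvps_slice (D P) c * Q)) Y) X,
      one := tensor H S \<one>\<^bsub>H\<^esub> \<one>\<^bsub>S\<^esub>\<rparr>)"


section \<open>Lie algebras and their enveloping algebras\<close>

definition lie_algebra ::
    "('k::field \<Rightarrow> 'g::ab_group_add \<Rightarrow> 'g) \<Rightarrow> ('g \<Rightarrow> 'g \<Rightarrow> 'g) \<Rightarrow> bool" where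
  "lie_algebra scale br \<longleftrightarrow> vector_space scale \<and>
     (\<forall>x. Vector_Spaces.linear scale scale (br x)) \<and>
     (\<forall>y. Vector_Spaces.linear scale scale (\<lambda>x. br x y)) \<and>
     (\<forall>x. br x x = 0) \<and>
     (\<forall>x y z. br x (br y z) + br y (br z x) + br z (br x y) = 0)"

definition is_basis :: "('k::field \<Rightarrow> 'g::ab_group_add \<Rightarrow> 'g) \<Rightarrow> ('n \<Rightarrow> 'g) \<Rightarrow> bool" where
  "is_basis scale e \<longleftrightarrow> inj e \<and> \<not> module.dependent scale (range e) \<and>
     module.span scale (range e) = UNIV"

definition enveloping_relations ::
    "('k::field \<Rightarrow> 'g::ab_group_add \<Rightarrow> 'g) \<Rightarrow> ('g \<Rightarrow> 'g \<Rightarrow> 'g) \<Rightarrow> ('g free_monoid \<Rightarrow>\<^sub>0 'k) set" where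
  "enveloping_relations scale br =
     {gen (x + y) - (gen x + gen y) | x y. True} \<union>
     {gen (scale c x) - scale_pm c (gen x) | c x. True} \<union>
     {gen x * gen y - gen y * gen x - gen (br x y) | x y. True}"

definition env_gen ::
    "('k::field \<Rightarrow> 'g::ab_group_add \<Rightarrow> 'g) \<Rightarrow> ('g \<Rightarrow> 'g \<Rightarrow> 'g) \<Rightarrow> 'g \<Rightarrow> ('g free_monoid \<Rightarrow>\<^sub>0 'k) set" where
  "env_gen scale br = pres_gen UNIV (enveloping_relations scale br)"

text \<open>
  The Hopf structure is determined by \<open>\<Delta> x = x \<otimes> 1 + 1 \<otimes> x\<close>, \<open>\<epsilon> x = 0\<close> and \<open>S x = - x\<close> for
  \<open>x\<close> in the Lie algebra, \<open>S\<close> being an antihomomorphism.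
\<close>

definition enveloping_algebra ::
    "('k::field \<Rightarrow> 'g::ab_group_add \<Rightarrow> 'g) \<Rightarrow> ('g \<Rightarrow> 'g \<Rightarrow> 'g)
     \<Rightarrow> ('k, ('g free_monoid \<Rightarrow>\<^sub>0 'k) set) hopf" where
  "enveloping_algebra scale br =
     (let U = presented_algebra UNIV (enveloping_relations scale br); \<iota> = env_gen scale br in
     \<lparr>carrier = carrier U, mult = mult U, one = one U, zero = zero U, add = add U, smult = smult U,
      comult = pres_lift (tensor_algebra U U)
        (\<lambda>x. tensor U U (\<iota> x) \<one>\<^bsub>U\<^esub> \<oplus>\<^bsub>tensor_algebra U U\<^esub> tensor U U \<one>\<^bsub>U\<^esub> (\<iota> x)),
      counit = pres_lift scalars (\<lambda>_. 0),
      antipode = pres_lift (opposite U) (\<lambda>x. \<iota> (- x))\<rparr>)"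


section \<open>Twisted Weyl algebra, deformed coproduct and phase space algebra\<close>

text \<open>In this section \<open>U\<close> stands for the enveloping algebra.\<close>

definition twisted_weyl_algebra ::
    "('k::field, 'u) hopf \<Rightarrow> ('u \<Rightarrow> ('n::finite, 'k) mvps \<Rightarrow> ('n, 'k) mvps)
     \<Rightarrow> ('k, ('u \<times> ('n, 'k) mvps \<Rightarrow>\<^sub>0 'k) set) module" where
  "twisted_weyl_algebra U \<phi> = smash_product U mvps_algebra \<phi>"

definition black_action ::
    "('k::field, 'u) hopf \<Rightarrow> ('u \<Rightarrow> ('n::finite, 'k) mvps \<Rightarrow> ('n, 'k) mvps)
     \<Rightarrow> ('u \<times> ('n, 'k) mvps \<Rightarrow>\<^sub>0 'k) set \<Rightarrow> 'u \<Rightarrow> 'u" where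
  "black_action U \<phi> a u = tensor_lift U (\<lambda>v Q. const_term Q \<odot>\<^bsub>U\<^esub> v)
     (a \<otimes>\<^bsub>twisted_weyl_algebra U \<phi>\<^esub> tensor U mvps_algebra u 1)"

definition ps_black_action ::
    "('k::field, 'u) hopf \<Rightarrow> ('u \<Rightarrow> ('n::finite, 'k) mvps \<Rightarrow> ('n, 'k) mvps)
     \<Rightarrow> ('n, 'k) mvps \<Rightarrow> 'u \<Rightarrow> 'u" where
  "ps_black_action U \<phi> P u = black_action U \<phi> (tensor U mvps_algebra \<one>\<^bsub>U\<^esub> P) u"

text \<open>
  The Leibniz rule \<open>P \<triangleright> (u v) = \<Sum> (P\<^sub>(\<^sub>1\<^sub>) \<triangleright> u) (P\<^sub>(\<^sub>2\<^sub>) \<triangleright> v)\<close> for the black action; only finitely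
  many \<open>\<partial>\<^sup>a\<close> do not annihilate a given element of \<open>U\<close>.
\<close>

definition leibniz_rule ::
    "('k::field, 'u) hopf \<Rightarrow> ('u \<Rightarrow> ('n::finite, 'k) mvps \<Rightarrow> ('n, 'k) mvps)
     \<Rightarrow> (('n, 'k) mvps \<Rightarrow> ('n + 'n, 'k) mvps) \<Rightarrow> bool" where
  "leibniz_rule U \<phi> D \<longleftrightarrow> (\<forall>P. \<forall>u\<in>carrier U. \<forall>v\<in>carrier U.
     (let act = ps_black_action U \<phi> in
      act P (u \<otimes>\<^bsub>U\<^esub> v) =
        (\<Oplus>\<^bsub>U\<^esub>p\<in>{a. act (mvps_monom a) u \<noteq> \<zero>\<^bsub>U\<^esub>} \<times> {b. act (mvps_monom b) v \<noteq> \<zero>\<^bsub>U\<^esub>}.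
           coeff (D P) (case_sum (fst p) (snd p)) \<odot>\<^bsub>U\<^esub>
             (act (mvps_monom (fst p)) u \<otimes>\<^bsub>U\<^esub> act (mvps_monom (snd p)) v))))"

definition deformed_coproduct ::
    "('k::field, 'u) hopf \<Rightarrow> ('u \<Rightarrow> ('n::finite, 'k) mvps \<Rightarrow> ('n, 'k) mvps)
     \<Rightarrow> ('n, 'k) mvps \<Rightarrow> ('n + 'n, 'k) mvps" where
  "deformed_coproduct U \<phi> = (THE D. leibniz_rule U \<phi> D)"

definition deformed_pairing ::
    "('k::field, 'u) hopf \<Rightarrow> ('u \<Rightarrow> ('n::finite, 'k) mvps \<Rightarrow> ('n, 'k) mvps)
     \<Rightarrow> 'u \<Rightarrow> ('n, 'k) mvps \<Rightarrow> 'k" where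
  "deformed_pairing U \<phi> u P = const_term (\<phi> (antipode U u) P)"

text \<open>\<open>xh i\<close> are the images in \<open>U\<close> of the basis of the Lie algebra, \<open>\<phi>m i j\<close> is \<open>\<phi>\<^sub>i\<^sup>j\<close>.\<close>

definition phase_space_relations ::
    "('k::field, 'u) hopf \<Rightarrow> ('n::finite \<Rightarrow> 'u) \<Rightarrow> ('n \<Rightarrow> 'n \<Rightarrow> ('n, 'k) mvps)
     \<Rightarrow> (('u + ('n, 'k) mvps) free_monoid \<Rightarrow>\<^sub>0 'k) set set" where
  "phase_space_relations U xh \<phi>m =
     (let S = mvps_algebra; F = free_product U S; j = free_product_gen U S in
      {(j (Inr P) \<otimes>\<^bsub>F\<^esub> j (Inl (xh i)) \<ominus>\<^bsub>F\<^esub> j (Inl (xh i)) \<otimes>\<^bsub>F\<^esub> j (Inr P))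
         \<ominus>\<^bsub>F\<^esub> j (Inr (\<Sum>l\<in>UNIV. mvps_pderiv l P * \<phi>m i l)) | P i. True})"

definition phase_space_algebra ::
    "('k::field, 'u) hopf \<Rightarrow> ('n::finite \<Rightarrow> 'u) \<Rightarrow> ('n \<Rightarrow> 'n \<Rightarrow> ('n, 'k) mvps)
     \<Rightarrow> ('k, (('u + ('n, 'k) mvps) free_monoid \<Rightarrow>\<^sub>0 'k) set set) module" where
  "phase_space_algebra U xh \<phi>m = (let F = free_product U mvps_algebra in
     quotient F (Idl\<^bsub>F\<^esub> (phase_space_relations U xh \<phi>m)))"

end

theory Submission
  imports Defs
begin

text \<open>
  Write \<open>D\<^sub>y = \<phi> (- y)\<close> for \<open>y\<close> in the Lie algebra; these derivations of the power series ring are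
  automatically continuous and \<open>D\<^sub>x\<^sub>i = \<partial>/\<partial>(\<partial>\<^sup>i) + higher order\<close>.  The pairing is
  \<open>\<langle>y\<^sub>1 \<cdots> y\<^sub>k, P\<rangle> = (D\<^sub>y\<^sub>k \<cdots> D\<^sub>y\<^sub>1 P)(1)\<close>, so on words of length \<open>k\<close> in the basis it vanishes on monomials
  of degree \<open>> k\<close> and is the usual one (with diagonal entries \<open>a!\<close>) in degree \<open>k\<close>.  As words may be reordered modulo
  shorter words, this triangularity yields a basis \<open>u\<^sub>a\<close> of the enveloping algebra dual to the monomials
  \<open>\<partial>\<^sup>a\<close> (no PBW theorem is needed).  By the Leibniz rule for the \<open>D\<^sub>y\<close> the coproduct becomes
  \<open>\<Delta> u\<^sub>a = \<Sum>\<^sub>b\<^sub>+\<^sub>c\<^sub>=\<^sub>a u\<^sub>b \<otimes> u\<^sub>c\<close>, and the \<open>\<phi>\<close>-deformed coproduct has the coefficients \<open>\<langle>u\<^sub>a u\<^sub>b, P\<rangle>\<close>, that is,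
  \<open>\<Delta>\<^sub>\<phi> P = \<Sum>\<^sub>c \<partial>\<^sup>c \<otimes> \<phi> (S u\<^sub>c) P\<close>.  With this formula the two smash product multiplications on
  \<open>U \<otimes> S\<close> literally coincide.  The phase space algebra is spanned by the products \<open>u P\<close>, because its
  relations allow one to move power series to the right, and they are independent because they
  are so in the twisted Weyl algebra.
\<close>

section \<open>Linear maps\<close>

text \<open>Once the dual basis is available, U becomes the continuous dual of the power series
  ring, and this duality is used in both directions. The axioms of the topological Hopf algebra are
  transposed from U: coassociativity of the deformed coproduct is associativity of U, its
  multiplicativity is that of the coproduct of U, and its antipode is the transposed antipode.
  Conversely, coassociativity and the counit laws of U are checked on the u_a, where they only
  concern decompositions of exponents. Characteristic zero enters through the division by a!. A
  formal obstacle shapes the statements: maps out of quotients are given by picking the element of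
  the image of a coset, which is meaningful only when that image is a singleton. Sweedler
  expressions therefore come with a bilinearity proof before they are computed, and identities
  between them are extended by linearity from pure tensors or from the u_a.\<close>

definition vspace :: "('k::field, 'a, 'x) module_scheme \<Rightarrow> bool" where
  "vspace V \<longleftrightarrow> module (scalars :: ('k, 'k) module) V"

lemma scalars_simps [simp]:
  "carrier scalars = UNIV" "mult scalars = (*)" "one scalars = 1" "zero scalars = 0"
  "add scalars = (+)" "smult scalars = (*)"
  by (simp_all add: scalars_def)

lemma cring_scalars: "cring (scalars :: ('k::field, 'k) module)"
proof (rule cringI)
  show "abelian_group (scalars :: ('k, 'k) module)"
    by (rule abelian_groupI) (auto simp: algebra_simps intro: exI[of _ "- x" for x])
  show "comm_monoid (scalars :: ('k, 'k) module)"
    by (rule comm_monoidI) (auto simp: algebra_simps)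
qed (auto simp: algebra_simps)

lemma vspaceI:
  fixes V :: "('k::field, 'a, 'x) module_scheme"
  assumes "abelian_group V"
    and "\<And>c v. v \<in> carrier V \<Longrightarrow> c \<odot>\<^bsub>V\<^esub> v \<in> carrier V"
    and "\<And>c d v. v \<in> carrier V \<Longrightarrow> (c + d) \<odot>\<^bsub>V\<^esub> v = c \<odot>\<^bsub>V\<^esub> v \<oplus>\<^bsub>V\<^esub> d \<odot>\<^bsub>V\<^esub> v"
    and "\<And>c v w. v \<in> carrier V \<Longrightarrow> w \<in> carrier V \<Longrightarrow> c \<odot>\<^bsub>V\<^esub> (v \<oplus>\<^bsub>V\<^esub> w) = c \<odot>\<^bsub>V\<^esub> v \<oplus>\<^bsub>V\<^esub> c \<odot>\<^bsub>V\<^esub> w"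
    and "\<And>c d v. v \<in> carrier V \<Longrightarrow> (c * d) \<odot>\<^bsub>V\<^esub> v = c \<odot>\<^bsub>V\<^esub> (d \<odot>\<^bsub>V\<^esub> v)"
    and "\<And>v. v \<in> carrier V \<Longrightarrow> 1 \<odot>\<^bsub>V\<^esub> v = v"
  shows "vspace V"
  unfolding vspace_def by (rule moduleI) (use assms cring_scalars in auto)

lemma vspace_abelian_group: "vspace V \<Longrightarrow> abelian_group V"
  by (simp add: vspace_def module_def)

context
  fixes V :: "('k::field, 'a, 'x) module_scheme"
  assumes V: "vspace V"
begin

interpretation module "scalars :: ('k, 'k) module" V
  using V by (simp add: vspace_def)

lemma vs_add [simp]: "a \<in> carrier V \<Longrightarrow> b \<in> carrier V \<Longrightarrow> a \<oplus>\<^bsub>V\<^esub> b \<in> carrier V"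
  by (rule M.a_closed)

lemma vs_zero [simp]: "\<zero>\<^bsub>V\<^esub> \<in> carrier V"
  by (rule M.zero_closed)

lemma vs_smult [simp]: "a \<in> carrier V \<Longrightarrow> c \<odot>\<^bsub>V\<^esub> a \<in> carrier V"
  by (rule smult_closed) auto

lemma vs_comm: "a \<in> carrier V \<Longrightarrow> b \<in> carrier V \<Longrightarrow> a \<oplus>\<^bsub>V\<^esub> b = b \<oplus>\<^bsub>V\<^esub> a"
  by (rule M.a_comm)

lemma vs_assoc:
  "a \<in> carrier V \<Longrightarrow> b \<in> carrier V \<Longrightarrow> c \<in> carrier V \<Longrightarrow> (a \<oplus>\<^bsub>V\<^esub> b) \<oplus>\<^bsub>V\<^esub> c = a \<oplus>\<^bsub>V\<^esub> (b \<oplus>\<^bsub>V\<^esub> c)"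
  by (rule M.a_assoc)

lemma vs_left_comm:
  "a \<in> carrier V \<Longrightarrow> b \<in> carrier V \<Longrightarrow> c \<in> carrier V \<Longrightarrow> a \<oplus>\<^bsub>V\<^esub> (b \<oplus>\<^bsub>V\<^esub> c) = b \<oplus>\<^bsub>V\<^esub> (a \<oplus>\<^bsub>V\<^esub> c)"
  by (rule M.a_lcomm)

lemma vs_zero_left [simp]: "a \<in> carrier V \<Longrightarrow> \<zero>\<^bsub>V\<^esub> \<oplus>\<^bsub>V\<^esub> a = a"
  by (rule M.l_zero)

lemma vs_zero_right [simp]: "a \<in> carrier V \<Longrightarrow> a \<oplus>\<^bsub>V\<^esub> \<zero>\<^bsub>V\<^esub> = a"
  by (rule M.r_zero)

lemma vs_smult_zero [simp]: "c \<odot>\<^bsub>V\<^esub> \<zero>\<^bsub>V\<^esub> = \<zero>\<^bsub>V\<^esub>"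
  using smult_r_null[of c] by simp

lemma vs_zero_smult [simp]: "a \<in> carrier V \<Longrightarrow> 0 \<odot>\<^bsub>V\<^esub> a = \<zero>\<^bsub>V\<^esub>"
  using smult_l_null[of a] by simp

lemma vs_one_smult [simp]: "a \<in> carrier V \<Longrightarrow> 1 \<odot>\<^bsub>V\<^esub> a = a"
  using smult_one[of a] by simp

lemma vs_smult_smult [simp]: "a \<in> carrier V \<Longrightarrow> c \<odot>\<^bsub>V\<^esub> (d \<odot>\<^bsub>V\<^esub> a) = (c * d) \<odot>\<^bsub>V\<^esub> a"
  using smult_assoc1[of c d a] by simp

lemma vs_smult_add: "a \<in> carrier V \<Longrightarrow> b \<in> carrier V \<Longrightarrow>
    c \<odot>\<^bsub>V\<^esub> (a \<oplus>\<^bsub>V\<^esub> b) = c \<odot>\<^bsub>V\<^esub> a \<oplus>\<^bsub>V\<^esub> c \<odot>\<^bsub>V\<^esub> b"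
  by (rule smult_r_distr) auto

lemma vs_add_smult: "a \<in> carrier V \<Longrightarrow> (c + d) \<odot>\<^bsub>V\<^esub> a = c \<odot>\<^bsub>V\<^esub> a \<oplus>\<^bsub>V\<^esub> d \<odot>\<^bsub>V\<^esub> a"
  using smult_l_distr[of c d a] by simp

text \<open>Negatives are normalized to multiples by -1, so that additivity and homogeneity of a
  linear map also cover subtraction.\<close>

lemma vs_uminus: "a \<in> carrier V \<Longrightarrow> \<ominus>\<^bsub>V\<^esub> a = (-1) \<odot>\<^bsub>V\<^esub> a"
  using vs_add_smult[of a "-1" 1] by (intro M.minus_equality) (auto simp: V)

lemma vs_minus: "a \<in> carrier V \<Longrightarrow> b \<in> carrier V \<Longrightarrow> a \<ominus>\<^bsub>V\<^esub> b = a \<oplus>\<^bsub>V\<^esub> (-1) \<odot>\<^bsub>V\<^esub> b"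
  by (simp add: a_minus_def vs_uminus)

lemma vs_cancel [simp]: "a \<in> carrier V \<Longrightarrow> a \<oplus>\<^bsub>V\<^esub> (-1) \<odot>\<^bsub>V\<^esub> a = \<zero>\<^bsub>V\<^esub>"
  using vs_add_smult[of a 1 "-1"] by simp

lemma vs_cancel_left: "a \<in> carrier V \<Longrightarrow> (-1) \<odot>\<^bsub>V\<^esub> a \<oplus>\<^bsub>V\<^esub> a = \<zero>\<^bsub>V\<^esub>"
  using vs_add_smult[of a "-1" 1] by simp

lemma vs_eqI:
  assumes "a \<in> carrier V" "b \<in> carrier V" "a \<oplus>\<^bsub>V\<^esub> (-1) \<odot>\<^bsub>V\<^esub> b = \<zero>\<^bsub>V\<^esub>"
  shows "a = b"
proof -
  have "a = (a \<oplus>\<^bsub>V\<^esub> (-1) \<odot>\<^bsub>V\<^esub> b) \<oplus>\<^bsub>V\<^esub> b"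
    using assms(1,2) V by (simp only: vs_assoc vs_smult vs_cancel_left vs_zero_right)
  also have "\<dots> = b"
    using assms(2,3) by simp
  finally show ?thesis .
qed

lemma vs_add_right_cancel:
  assumes "a \<in> carrier V" "b \<in> carrier V" "c \<in> carrier V"
  shows "a \<oplus>\<^bsub>V\<^esub> c = b \<oplus>\<^bsub>V\<^esub> c \<longleftrightarrow> a = b"
proof -
  have "(a \<oplus>\<^bsub>V\<^esub> c) \<oplus>\<^bsub>V\<^esub> (-1) \<odot>\<^bsub>V\<^esub> c = a" "(b \<oplus>\<^bsub>V\<^esub> c) \<oplus>\<^bsub>V\<^esub> (-1) \<odot>\<^bsub>V\<^esub> c = b"
    using assms V by (simp_all only: vs_assoc vs_smult vs_cancel vs_zero_right)
  then show ?thesis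
    by metis
qed

lemma vs_finsum [simp]: "(\<And>i. i \<in> I \<Longrightarrow> f i \<in> carrier V) \<Longrightarrow> finsum V f I \<in> carrier V"
  by (rule M.finsum_closed) auto

lemma vs_finsum_empty [simp]: "finsum V f {} = \<zero>\<^bsub>V\<^esub>"
  by (rule M.finsum_empty)

lemma vs_finsum_insert:
  "finite I \<Longrightarrow> i \<notin> I \<Longrightarrow> f i \<in> carrier V \<Longrightarrow> (\<And>j. j \<in> I \<Longrightarrow> f j \<in> carrier V) \<Longrightarrow>
     finsum V f (insert i I) = f i \<oplus>\<^bsub>V\<^esub> finsum V f I"
  by (rule M.finsum_insert) auto

lemma vs_finsum_singleton [simp]: "f i \<in> carrier V \<Longrightarrow> finsum V f {i} = f i"
  using vs_finsum_insert[of "{}" i f] V by simp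

lemma vs_finsum_infinite: "infinite I \<Longrightarrow> finsum V f I = \<zero>\<^bsub>V\<^esub>"
  by (rule M.finsum_infinite)

lemma vs_finsum_cong:
  "I = J \<Longrightarrow> (\<And>i. i \<in> J \<Longrightarrow> g i \<in> carrier V) \<Longrightarrow> (\<And>i. i \<in> J \<Longrightarrow> f i = g i) \<Longrightarrow>
     finsum V f I = finsum V g J"
  by (rule M.finsum_cong') auto

lemma vs_finsum_superset:
  assumes "finite J" "I \<subseteq> J" "\<And>i. i \<in> J \<Longrightarrow> f i \<in> carrier V" "\<And>i. i \<in> J - I \<Longrightarrow> f i = \<zero>\<^bsub>V\<^esub>"
  shows "finsum V f I = finsum V f J"
  using assms by (intro M.add.finprod_mono_neutral_cong_left) auto

lemma vs_finsum_add:
  assumes "\<And>i. i \<in> I \<Longrightarrow> f i \<in> carrier V" "\<And>i. i \<in> I \<Longrightarrow> g i \<in> carrier V"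
  shows "finsum V (\<lambda>i. f i \<oplus>\<^bsub>V\<^esub> g i) I = finsum V f I \<oplus>\<^bsub>V\<^esub> finsum V g I"
  using assms by (intro M.finsum_addf) auto

lemma vs_finsum_reindex:
  assumes "inj_on h I" "\<And>i. i \<in> h ` I \<Longrightarrow> f i \<in> carrier V"
  shows "finsum V f (h ` I) = finsum V (\<lambda>i. f (h i)) I"
  using assms by (intro M.finsum_reindex) auto

lemma vs_finsum_Sigma:
  assumes "finite I" "\<And>i. i \<in> I \<Longrightarrow> finite (J i)" "\<And>i j. i \<in> I \<Longrightarrow> j \<in> J i \<Longrightarrow> f i j \<in> carrier V"
  shows "finsum V (\<lambda>i. finsum V (f i) (J i)) I = finsum V (\<lambda>p. f (fst p) (snd p)) (Sigma I J)"
  using assms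
proof (induction I)
  case (insert i I)
  have "Sigma (insert i I) J = Pair i ` J i \<union> Sigma I J"
    by auto
  moreover have "finsum V (\<lambda>p. f (fst p) (snd p)) (Pair i ` J i \<union> Sigma I J) =
      finsum V (\<lambda>p. f (fst p) (snd p)) (Pair i ` J i) \<oplus>\<^bsub>V\<^esub> finsum V (\<lambda>p. f (fst p) (snd p)) (Sigma I J)"
    using insert by (intro M.finsum_Un_disjoint) auto
  moreover have "finsum V (\<lambda>p. f (fst p) (snd p)) (Pair i ` J i) = finsum V (f i) (J i)"
    using insert V by (subst vs_finsum_reindex) (auto simp: inj_on_def)
  ultimately show ?case
    using insert V by (simp add: vs_finsum_insert)
qed (simp add: V)

lemma vs_finsum_zero: "(\<And>i. i \<in> I \<Longrightarrow> f i = \<zero>\<^bsub>V\<^esub>) \<Longrightarrow> finsum V f I = \<zero>\<^bsub>V\<^esub>"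
  using vs_finsum_cong[of I I "\<lambda>_. \<zero>\<^bsub>V\<^esub>" f] M.finsum_zero by simp

lemma vs_finsum_single:
  assumes "finite I" "i \<in> I" "f i \<in> carrier V" "\<And>j. j \<in> I \<Longrightarrow> j \<noteq> i \<Longrightarrow> f j = \<zero>\<^bsub>V\<^esub>"
  shows "finsum V f I = f i"
proof -
  have "finsum V f {i} = finsum V f I"
    using assms V by (intro vs_finsum_superset) (auto, metis vs_zero)
  then show ?thesis
    using assms V by (simp add: vs_finsum_insert)
qed

end

lemma linear_homI:
  assumes "\<And>a. a \<in> carrier V \<Longrightarrow> f a \<in> carrier W"
    and "\<And>a b. a \<in> carrier V \<Longrightarrow> b \<in> carrier V \<Longrightarrow> f (a \<oplus>\<^bsub>V\<^esub> b) = f a \<oplus>\<^bsub>W\<^esub> f b"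
    and "\<And>c a. a \<in> carrier V \<Longrightarrow> f (c \<odot>\<^bsub>V\<^esub> a) = c \<odot>\<^bsub>W\<^esub> f a"
  shows "f \<in> linear_hom V W"
  using assms by (simp add: linear_hom_def)

lemma lin_closed [intro]: "f \<in> linear_hom V W \<Longrightarrow> a \<in> carrier V \<Longrightarrow> f a \<in> carrier W"
  by (auto simp: linear_hom_def)

lemma lin_add: "f \<in> linear_hom V W \<Longrightarrow> a \<in> carrier V \<Longrightarrow> b \<in> carrier V \<Longrightarrow>
    f (a \<oplus>\<^bsub>V\<^esub> b) = f a \<oplus>\<^bsub>W\<^esub> f b"
  by (auto simp: linear_hom_def)

lemma lin_smult: "f \<in> linear_hom V W \<Longrightarrow> a \<in> carrier V \<Longrightarrow> f (c \<odot>\<^bsub>V\<^esub> a) = c \<odot>\<^bsub>W\<^esub> f a"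
  by (auto simp: linear_hom_def)

lemma lin_zero:
  assumes "vspace V" "vspace W" "f \<in> linear_hom V W"
  shows "f \<zero>\<^bsub>V\<^esub> = \<zero>\<^bsub>W\<^esub>"
  using lin_smult[OF assms(3), of "\<zero>\<^bsub>V\<^esub>" 0] lin_closed[OF assms(3), of "\<zero>\<^bsub>V\<^esub>"] assms by simp

lemma lin_finsum:
  assumes V: "vspace V" and W: "vspace W" and f: "f \<in> linear_hom V W"
    and g: "\<And>i. i \<in> I \<Longrightarrow> g i \<in> carrier V"
  shows "f (finsum V g I) = finsum W (\<lambda>i. f (g i)) I"
proof (cases "finite I")
  case True
  then show ?thesis
    using g
  proof (induction I)
    case (insert i I)
    then show ?case
      using V W f by (simp add: vs_finsum_insert lin_add lin_closed)
  qed (simp add: lin_zero[OF V W f] V W)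
qed (simp add: lin_zero[OF V W f] V W vs_finsum_infinite)

lemma lin_id: "(\<lambda>v. v) \<in> linear_hom V V"
  by (simp add: linear_hom_def)

lemma lin_comp: "f \<in> linear_hom V W \<Longrightarrow> g \<in> linear_hom W Z \<Longrightarrow> (\<lambda>v. g (f v)) \<in> linear_hom V Z"
  by (intro linear_homI) (auto simp: lin_add lin_smult lin_closed)

lemma lin_cong:
  assumes V: "vspace V" and f: "f \<in> linear_hom V W" and g: "\<And>v. v \<in> carrier V \<Longrightarrow> g v = f v"
  shows "g \<in> linear_hom V W"
  by (rule linear_homI) (use V f in \<open>simp_all add: g lin_add lin_smult lin_closed\<close>)

lemma lin_const_zero: "vspace W \<Longrightarrow> (\<lambda>_. \<zero>\<^bsub>W\<^esub>) \<in> linear_hom V W"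
  by (simp add: linear_hom_def)

lemma lin_plus:
  assumes "vspace W" "f \<in> linear_hom V W" "g \<in> linear_hom V W"
  shows "(\<lambda>v. f v \<oplus>\<^bsub>W\<^esub> g v) \<in> linear_hom V W"
  using assms
  by (intro linear_homI)
    (auto simp: lin_add lin_smult lin_closed vs_assoc vs_comm vs_left_comm vs_smult_add)

lemma lin_scale:
  assumes "vspace W" "f \<in> linear_hom V W"
  shows "(\<lambda>v. c \<odot>\<^bsub>W\<^esub> f v) \<in> linear_hom V W"
  using assms
  by (intro linear_homI)
    (auto simp: lin_add lin_smult lin_closed vs_smult_add mult.commute)

section \<open>Bilinear maps, and the field as a vector space over itself\<close>

definition bilin :: "('k::field, 'a, 'x) module_scheme \<Rightarrow> ('k, 'b, 'y) module_scheme \<Rightarrow>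
    ('k, 'c, 'z) module_scheme \<Rightarrow> ('a \<Rightarrow> 'b \<Rightarrow> 'c) \<Rightarrow> bool" where
  "bilin V W Z f \<longleftrightarrow> (\<forall>v\<in>carrier V. f v \<in> linear_hom W Z) \<and>
     (\<forall>w\<in>carrier W. (\<lambda>v. f v w) \<in> linear_hom V Z)"

lemma bilinI:
  assumes "\<And>v. v \<in> carrier V \<Longrightarrow> (\<lambda>w. f v w) \<in> linear_hom W Z"
    and "\<And>w. w \<in> carrier W \<Longrightarrow> (\<lambda>v. f v w) \<in> linear_hom V Z"
  shows "bilin V W Z f"
  using assms by (simp add: bilin_def)

lemma bilin_left: "bilin V W Z f \<Longrightarrow> w \<in> carrier W \<Longrightarrow> (\<lambda>v. f v w) \<in> linear_hom V Z"
  by (simp add: bilin_def)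

lemma bilin_right: "bilin V W Z f \<Longrightarrow> v \<in> carrier V \<Longrightarrow> (\<lambda>w. f v w) \<in> linear_hom W Z"
  by (simp add: bilin_def)

lemma bilin_closed: "bilin V W Z f \<Longrightarrow> v \<in> carrier V \<Longrightarrow> w \<in> carrier W \<Longrightarrow> f v w \<in> carrier Z"
  by (meson bilin_right lin_closed)

lemma vspace_scalars: "vspace (scalars :: ('k::field, 'k) module)"
  by (rule vspaceI) (use cring_scalars in \<open>auto simp: algebra_simps cring_def ring_def\<close>)

lemma finsum_scalars [simp]: "finsum (scalars :: ('k::field, 'k) module) f I = sum f I"
proof (cases "finite I")
  case True
  then show ?thesis
    by (induction I) (simp_all add: vspace_scalars vs_finsum_insert)
qed (simp add: vspace_scalars vs_finsum_infinite)

section \<open>Quotients\<close>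

definition subsp :: "'a set \<Rightarrow> ('k::field, 'a, 'x) module_scheme \<Rightarrow> bool" where
  "subsp I V \<longleftrightarrow> I \<subseteq> carrier V \<and> \<zero>\<^bsub>V\<^esub> \<in> I \<and> (\<forall>a\<in>I. \<forall>b\<in>I. a \<oplus>\<^bsub>V\<^esub> b \<in> I) \<and>
     (\<forall>c. \<forall>a\<in>I. c \<odot>\<^bsub>V\<^esub> a \<in> I)"

lemma subsp_abelian_subgroup:
  assumes V: "vspace V" and I: "subsp I V"
  shows "abelian_subgroup I V"
proof (rule abelian_subgroupI3)
  interpret abelian_group V
    using V by (rule vspace_abelian_group)
  show "additive_subgroup I V"
  proof (intro additive_subgroupI add.subgroupI)
    show "\<ominus>\<^bsub>V\<^esub> a \<in> I" if "a \<in> I" for a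
      using I V that vs_uminus[OF V, of a] by (auto simp: subsp_def)
  qed (use I in \<open>auto simp: subsp_def\<close>)
qed (use V in \<open>rule vspace_abelian_group\<close>)

context
  fixes V :: "('k::field, 'a, 'x) module_scheme" and I :: "'a set"
  assumes V: "vspace V" and I: "subsp I V"
begin

interpretation abelian_subgroup I V
  using V I by (rule subsp_abelian_subgroup)

lemma coset_eq_iff:
  assumes a: "a \<in> carrier V" and b: "b \<in> carrier V"
  shows "I +>\<^bsub>V\<^esub> a = I +>\<^bsub>V\<^esub> b \<longleftrightarrow> a \<oplus>\<^bsub>V\<^esub> (-1) \<odot>\<^bsub>V\<^esub> b \<in> I"
proof
  assume "I +>\<^bsub>V\<^esub> a = I +>\<^bsub>V\<^esub> b"
  then have "a \<in> I +>\<^bsub>V\<^esub> b"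
    using a_rcos_self[OF a] by simp
  then obtain h where "h \<in> I" "a = h \<oplus>\<^bsub>V\<^esub> b"
    by (auto simp: a_r_coset_def')
  then show "a \<oplus>\<^bsub>V\<^esub> (-1) \<odot>\<^bsub>V\<^esub> b \<in> I"
    using V I b by (auto simp: vs_assoc subsp_def subset_iff)
next
  assume d: "a \<oplus>\<^bsub>V\<^esub> (-1) \<odot>\<^bsub>V\<^esub> b \<in> I"
  have "(a \<oplus>\<^bsub>V\<^esub> (-1) \<odot>\<^bsub>V\<^esub> b) \<oplus>\<^bsub>V\<^esub> b = a"
    using vs_add_smult[OF V b, of "-1" 1] V a b by (simp add: vs_assoc)
  then have "a \<in> I +>\<^bsub>V\<^esub> b"
    using d by (auto simp: a_r_coset_def' intro!: bexI[of _ "a \<oplus>\<^bsub>V\<^esub> (-1) \<odot>\<^bsub>V\<^esub> b"])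
  then show "I +>\<^bsub>V\<^esub> a = I +>\<^bsub>V\<^esub> b"
    using a_repr_independence[OF _ b a_subgroup] by simp
qed

lemma carrier_quotient: "carrier (quotient V I) = (\<lambda>a. I +>\<^bsub>V\<^esub> a) ` carrier V"
  by (auto simp: quotient_def FactRing_def A_RCOSETS_def')

lemma quotient_cases:
  assumes "X \<in> carrier (quotient V I)"
  obtains a where "a \<in> carrier V" "X = I +>\<^bsub>V\<^esub> a"
  using assms by (auto simp: carrier_quotient)

lemma coset_in_quotient [simp]: "a \<in> carrier V \<Longrightarrow> I +>\<^bsub>V\<^esub> a \<in> carrier (quotient V I)"
  by (auto simp: quotient_def FactRing_def A_RCOSETS_def')

lemma quotient_add: "a \<in> carrier V \<Longrightarrow> b \<in> carrier V \<Longrightarrow>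
    (I +>\<^bsub>V\<^esub> a) \<oplus>\<^bsub>quotient V I\<^esub> (I +>\<^bsub>V\<^esub> b) = I +>\<^bsub>V\<^esub> (a \<oplus>\<^bsub>V\<^esub> b)"
  by (simp add: quotient_def FactRing_def a_rcos_sum)

text \<open>Scaling in a quotient is defined as a union over all representatives. The union is a
  single coset, since for b = h + a with h in I the multiples c b and c a differ by c h, again in
  I.\<close>

lemma quotient_smult:
  assumes a: "a \<in> carrier V"
  shows "c \<odot>\<^bsub>quotient V I\<^esub> (I +>\<^bsub>V\<^esub> a) = I +>\<^bsub>V\<^esub> (c \<odot>\<^bsub>V\<^esub> a)"
proof -
  have "I +>\<^bsub>V\<^esub> (c \<odot>\<^bsub>V\<^esub> b) = I +>\<^bsub>V\<^esub> (c \<odot>\<^bsub>V\<^esub> a)" if "b \<in> I +>\<^bsub>V\<^esub> a" for b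
  proof -
    from that obtain h where h: "h \<in> I" "b = h \<oplus>\<^bsub>V\<^esub> a"
      by (auto simp: a_r_coset_def')
    then have hV: "h \<in> carrier V"
      using I by (auto simp: subsp_def)
    have "c \<odot>\<^bsub>V\<^esub> b \<oplus>\<^bsub>V\<^esub> (-1) \<odot>\<^bsub>V\<^esub> (c \<odot>\<^bsub>V\<^esub> a) = c \<odot>\<^bsub>V\<^esub> h"
      using vs_cancel[OF V vs_smult[OF V a, of c]] V a hV h(2) by (simp add: vs_smult_add vs_assoc)
    then show ?thesis
      using V I a h hV by (subst coset_eq_iff) (auto simp: subsp_def)
  qed
  moreover have "a \<in> I +>\<^bsub>V\<^esub> a"
    using a by (rule a_rcos_self)
  ultimately have "(\<Union>b\<in>I +>\<^bsub>V\<^esub> a. I +>\<^bsub>V\<^esub> (c \<odot>\<^bsub>V\<^esub> b)) = I +>\<^bsub>V\<^esub> (c \<odot>\<^bsub>V\<^esub> a)"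
    by blast
  then show ?thesis
    by (simp add: quotient_def)
qed

lemma vspace_quotient: "vspace (quotient V I)"
proof (rule vspaceI)
  have zero: "\<zero>\<^bsub>quotient V I\<^esub> = I +>\<^bsub>V\<^esub> \<zero>\<^bsub>V\<^esub>"
    using a_coset_add_zero[OF a_subset] by (simp add: quotient_def FactRing_def)
  show "abelian_group (quotient V I)"
  proof (rule abelian_groupI)
    fix X assume "X \<in> carrier (quotient V I)"
    then obtain a where "a \<in> carrier V" "X = I +>\<^bsub>V\<^esub> a"
      by (rule quotient_cases)
    then show "\<exists>Y\<in>carrier (quotient V I). Y \<oplus>\<^bsub>quotient V I\<^esub> X = \<zero>\<^bsub>quotient V I\<^esub>"
      using V by (intro bexI[of _ "I +>\<^bsub>V\<^esub> (-1) \<odot>\<^bsub>V\<^esub> a"])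
        (simp_all add: zero quotient_add vs_cancel_left)
  qed (use V in \<open>auto simp: carrier_quotient quotient_add zero vs_assoc vs_comm[OF V] cong: conj_cong\<close>)
qed (use V in \<open>auto simp: carrier_quotient quotient_add quotient_smult vs_add_smult vs_smult_add\<close>)

lemma lin_coset: "(\<lambda>a. I +>\<^bsub>V\<^esub> a) \<in> linear_hom V (quotient V I)"
  by (rule linear_homI) (simp_all add: quotient_add quotient_smult)

lemma quotient_zero: "\<zero>\<^bsub>quotient V I\<^esub> = I +>\<^bsub>V\<^esub> \<zero>\<^bsub>V\<^esub>"
  using lin_zero[OF V vspace_quotient lin_coset] by simp

text \<open>A linear map that kills I is constant on each coset, so the image of a coset is a
  singleton and \<open>the_elem\<close> returns its value. Maps out of tensor products and presented
  algebras all obtain their meaning from this.\<close>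

lemma quotient_lift_coset:
  assumes Z: "vspace Z" and f: "f \<in> linear_hom V Z" and ker: "\<And>h. h \<in> I \<Longrightarrow> f h = \<zero>\<^bsub>Z\<^esub>"
    and a: "a \<in> carrier V"
  shows "the_elem (f ` (I +>\<^bsub>V\<^esub> a)) = f a"
proof -
  have "f b = f a" if "b \<in> I +>\<^bsub>V\<^esub> a" for b
  proof -
    from that obtain h where h: "h \<in> I" "b = h \<oplus>\<^bsub>V\<^esub> a"
      by (auto simp: a_r_coset_def')
    moreover have "h \<in> carrier V"
      using I h by (auto simp: subsp_def)
    ultimately show ?thesis
      using f a Z ker by (simp add: lin_add lin_closed)
  qed
  then have "f ` (I +>\<^bsub>V\<^esub> a) = {f a}"
    using a_rcos_self[OF a] by blast
  then show ?thesis
    by simp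
qed

lemma lin_quotient_lift:
  assumes Z: "vspace Z" and f: "f \<in> linear_hom V Z" and ker: "\<And>h. h \<in> I \<Longrightarrow> f h = \<zero>\<^bsub>Z\<^esub>"
  shows "(\<lambda>X. the_elem (f ` X)) \<in> linear_hom (quotient V I) Z"
  by (rule linear_homI)
    (use V f in \<open>auto simp: carrier_quotient quotient_add quotient_smult quotient_lift_coset[OF Z f ker] lin_add lin_smult\<close>)

lemma quotient_hom_eqI:
  assumes "\<And>a. a \<in> carrier V \<Longrightarrow> f (I +>\<^bsub>V\<^esub> a) = g (I +>\<^bsub>V\<^esub> a)" "X \<in> carrier (quotient V I)"
  shows "f X = g X"
  using assms by (auto elim!: quotient_cases)

end

section \<open>Free vector spaces and tensor products\<close>

lemma lookup_scale_pm [simp]: "Poly_Mapping.lookup (scale_pm c f) p = c * Poly_Mapping.lookup f p"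
  by (simp add: scale_pm_def map.rep_eq when_def)

lemma scale_pm_eq_mult: "scale_pm c f = Poly_Mapping.single 0 c * f"
  by (simp add: scale_pm_def mult_map_scale_conv_mult)

lemma scale_pm_single [simp]: "scale_pm c (Poly_Mapping.single p d) = Poly_Mapping.single p (c * d)"
  by (rule poly_mapping_eqI) (simp add: lookup_single when_def)

lemma keys_scale_pm: "Poly_Mapping.keys (scale_pm c f) \<subseteq> Poly_Mapping.keys (f :: _ \<Rightarrow>\<^sub>0 'k::field)"
  by (auto simp: in_keys_iff)

lemma keys_single_subset: "p \<in> A \<Longrightarrow> Poly_Mapping.keys (Poly_Mapping.single p c) \<subseteq> A"
  by simp

lemma free_space_simps [simp]:
  "carrier (free_space B) = {f. Poly_Mapping.keys f \<subseteq> B}"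
  "zero (free_space B) = 0" "add (free_space B) = (+)" "smult (free_space B) = scale_pm"
  by (simp_all add: free_space_def)

lemma scale_pm_minus: "a + scale_pm (-1) b = a - (b :: 'b \<Rightarrow>\<^sub>0 'k::field)"
  by (rule poly_mapping_eqI) (simp add: lookup_add lookup_minus)

text \<open>Stated for any record with these four fields, so that it covers free vector spaces and
  free algebras alike.\<close>

lemma vspace_pmI:
  fixes V :: "('k::field, 'b \<Rightarrow>\<^sub>0 'k, 'x) module_scheme"
  assumes "carrier V = {f. Poly_Mapping.keys f \<subseteq> B}" "zero V = 0" "add V = (+)" "smult V = scale_pm"
  shows "vspace V"
proof (rule vspaceI)
  show "abelian_group V"
  proof (rule abelian_groupI)
    fix f assume "f \<in> carrier V"
    then show "\<exists>g\<in>carrier V. g \<oplus>\<^bsub>V\<^esub> f = \<zero>\<^bsub>V\<^esub>"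
      by (intro bexI[of _ "-f"]) (auto simp: assms in_keys_iff)
  qed (use keys_add in \<open>fastforce simp: assms ac_simps\<close>)+
qed (use keys_scale_pm in \<open>fastforce simp: assms intro!: poly_mapping_eqI simp: lookup_add algebra_simps\<close>)+

lemma vspace_free_space [simp]: "vspace (free_space B)"
  by (rule vspace_pmI) auto

lemma sum_single_keys: "(\<Sum>b\<in>Poly_Mapping.keys r. Poly_Mapping.single b (Poly_Mapping.lookup r b)) = r"
proof (rule poly_mapping_eqI)
  fix b
  have "Poly_Mapping.lookup (\<Sum>b\<in>Poly_Mapping.keys r. Poly_Mapping.single b (Poly_Mapping.lookup r b)) b =
      (\<Sum>c\<in>Poly_Mapping.keys r. if c = b then Poly_Mapping.lookup r b else 0)"
    unfolding lookup_sum by (rule sum.cong) (auto simp: lookup_single)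
  then show "Poly_Mapping.lookup (\<Sum>b\<in>Poly_Mapping.keys r. Poly_Mapping.single b (Poly_Mapping.lookup r b)) b
      = Poly_Mapping.lookup r b"
    by (simp add: in_keys_iff)
qed

lemma pm_hom_eqI:
  fixes V :: "('k::field, 'b \<Rightarrow>\<^sub>0 'k, 'x) module_scheme"
  assumes V: "carrier V = {f. Poly_Mapping.keys f \<subseteq> B}" "zero V = 0" "add V = (+)" "smult V = scale_pm"
    and Z: "vspace Z" and f: "f \<in> linear_hom V Z" and g: "g \<in> linear_hom V Z"
    and eq: "\<And>b. b \<in> B \<Longrightarrow> f (Poly_Mapping.single b 1) = g (Poly_Mapping.single b 1)"
    and r: "r \<in> carrier V"
  shows "f r = g r"
proof -
  have vV: "vspace V"
    using V by (rule vspace_pmI)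
  define s where "s A = (\<Sum>b\<in>A. Poly_Mapping.single b (Poly_Mapping.lookup r b))" for A
  have "f (s A) = g (s A) \<and> s A \<in> carrier V" if "finite A" "A \<subseteq> B" for A
    using that
  proof (induction A)
    case empty
    then show ?case
      using lin_zero[OF vV Z f] lin_zero[OF vV Z g] V by (simp add: s_def)
  next
    case (insert b A)
    have b: "Poly_Mapping.single b 1 \<in> carrier V"
      using insert V by auto
    have "s (insert b A) = (Poly_Mapping.lookup r b \<odot>\<^bsub>V\<^esub> Poly_Mapping.single b 1) \<oplus>\<^bsub>V\<^esub> s A"
      using insert V by (simp add: s_def)
    then show ?case
      using insert vV b f g eq[of b] by (auto simp: lin_add lin_smult)
  qed
  moreover have "s (Poly_Mapping.keys r) = r"
    by (simp add: s_def sum_single_keys)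
  ultimately show ?thesis
    using r V by (metis finite_keys mem_Collect_eq)
qed

text \<open>The index set \<open>keys r\<close> varies with r. The two sides of each linearity law
  are compared over one common finite set of keys, the added terms having coefficient zero.\<close>

lemma lin_pm_extend:
  fixes V :: "('k::field, 'b \<Rightarrow>\<^sub>0 'k, 'x) module_scheme"
  assumes V: "carrier V = {f. Poly_Mapping.keys f \<subseteq> B}" "zero V = 0" "add V = (+)" "smult V = scale_pm"
    and Z: "vspace Z" and f: "\<And>b. b \<in> B \<Longrightarrow> f b \<in> carrier Z"
  shows "(\<lambda>r. \<Oplus>\<^bsub>Z\<^esub>p\<in>Poly_Mapping.keys r. Poly_Mapping.lookup r p \<odot>\<^bsub>Z\<^esub> f p) \<in> linear_hom V Z"
    (is "?F \<in> _")
proof (rule linear_homI)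
  have sup: "?F r = (\<Oplus>\<^bsub>Z\<^esub>p\<in>A. Poly_Mapping.lookup r p \<odot>\<^bsub>Z\<^esub> f p)"
    if "finite A" "Poly_Mapping.keys r \<subseteq> A" "A \<subseteq> B" for r :: "'b \<Rightarrow>\<^sub>0 'k" and A
    using that Z f by (intro vs_finsum_superset) (auto simp: in_keys_iff subset_iff)
  fix r s assume r: "r \<in> carrier V" and s: "s \<in> carrier V"
  show "?F r \<in> carrier Z"
    using r Z f V by (auto intro!: vs_finsum)
  let ?A = "Poly_Mapping.keys r \<union> Poly_Mapping.keys s"
  have "?F (r + s) = (\<Oplus>\<^bsub>Z\<^esub>p\<in>?A. Poly_Mapping.lookup (r + s) p \<odot>\<^bsub>Z\<^esub> f p)"
    using r s V keys_add[of r s] by (intro sup) auto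
  also have "\<dots> = (\<Oplus>\<^bsub>Z\<^esub>p\<in>?A. Poly_Mapping.lookup r p \<odot>\<^bsub>Z\<^esub> f p \<oplus>\<^bsub>Z\<^esub> Poly_Mapping.lookup s p \<odot>\<^bsub>Z\<^esub> f p)"
    using r s V Z f by (intro vs_finsum_cong) (auto simp: lookup_add vs_add_smult subset_iff)
  also have "\<dots> = (\<Oplus>\<^bsub>Z\<^esub>p\<in>?A. Poly_Mapping.lookup r p \<odot>\<^bsub>Z\<^esub> f p) \<oplus>\<^bsub>Z\<^esub>
      (\<Oplus>\<^bsub>Z\<^esub>p\<in>?A. Poly_Mapping.lookup s p \<odot>\<^bsub>Z\<^esub> f p)"
    using r s V Z f by (intro vs_finsum_add) (auto simp: subset_iff)
  also have "\<dots> = ?F r \<oplus>\<^bsub>Z\<^esub> ?F s"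
    using r s V sup[of ?A r] sup[of ?A s] by auto
  finally show "?F (r \<oplus>\<^bsub>V\<^esub> s) = ?F r \<oplus>\<^bsub>Z\<^esub> ?F s"
    using V by simp
next
  have sup: "?F r = (\<Oplus>\<^bsub>Z\<^esub>p\<in>A. Poly_Mapping.lookup r p \<odot>\<^bsub>Z\<^esub> f p)"
    if "finite A" "Poly_Mapping.keys r \<subseteq> A" "A \<subseteq> B" for r :: "'b \<Rightarrow>\<^sub>0 'k" and A
    using that Z f by (intro vs_finsum_superset) (auto simp: in_keys_iff subset_iff)
  fix c r assume r: "r \<in> carrier V"
  have "?F (scale_pm c r) = (\<Oplus>\<^bsub>Z\<^esub>p\<in>Poly_Mapping.keys r. Poly_Mapping.lookup (scale_pm c r) p \<odot>\<^bsub>Z\<^esub> f p)"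
    using r V keys_scale_pm[of c r] by (intro sup) auto
  also have "\<dots> = (\<Oplus>\<^bsub>Z\<^esub>p\<in>Poly_Mapping.keys r. c \<odot>\<^bsub>Z\<^esub> (Poly_Mapping.lookup r p \<odot>\<^bsub>Z\<^esub> f p))"
    using r V Z f by (intro vs_finsum_cong) (auto simp: subset_iff)
  also have "\<dots> = c \<odot>\<^bsub>Z\<^esub> ?F r"
    using r V Z f by (intro lin_finsum[symmetric] lin_scale lin_id) auto
  finally show "?F (c \<odot>\<^bsub>V\<^esub> r) = c \<odot>\<^bsub>Z\<^esub> ?F r"
    using V by simp
qed

lemma pm_extend_single:
  assumes "vspace Z" "f b \<in> carrier Z"
  shows "(\<Oplus>\<^bsub>Z\<^esub>p\<in>Poly_Mapping.keys (Poly_Mapping.single b c). Poly_Mapping.lookup (Poly_Mapping.single b c) p \<odot>\<^bsub>Z\<^esub> f p)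
    = c \<odot>\<^bsub>Z\<^esub> f b"
  using assms by (cases "c = 0") simp_all

section \<open>Tensor products as quotients of free vector spaces\<close>

lemma bilinear_relations_carrier:
  assumes V: "vspace V" and W: "vspace W" and r: "r \<in> bilinear_relations V W"
  shows "Poly_Mapping.keys r \<subseteq> carrier V \<times> carrier W"
  using r
proof (induction r)
  case (add f g)
  then show ?case
    using keys_add[of f g] by blast
next
  case (scale f c)
  then show ?case
    using keys_scale_pm[of c f] by blast
qed (use V W in \<open>auto simp: in_keys_iff lookup_minus lookup_add lookup_single when_def split: if_splits\<close>)

lemma subsp_bilinear_relations:
  "vspace V \<Longrightarrow> vspace W \<Longrightarrow> subsp (bilinear_relations V W) (free_space (carrier V \<times> carrier W))"
  using bilinear_relations_carrier[of V W]
  by (simp add: subsp_def subset_iff bilinear_relations.intros)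

lemma bilinear_relations_mono:
  assumes eq: "carrier V = carrier V'" "add V = add V'" "smult V = smult V'"
    "carrier W = carrier W'" "add W = add W'" "smult W = smult W'"
  shows "bilinear_relations V W \<subseteq> bilinear_relations V' W'"
proof
  show "r \<in> bilinear_relations V' W'" if "r \<in> bilinear_relations V W" for r
    using that by induction (auto simp: eq intro: bilinear_relations.intros)
qed

lemma bilinear_relations_cong:
  assumes "carrier V = carrier V'" "add V = add V'" "smult V = smult V'"
    and "carrier W = carrier W'" "add W = add W'" "smult W = smult W'"
  shows "bilinear_relations V W = bilinear_relations V' W'"
  using bilinear_relations_mono[of V V' W W'] bilinear_relations_mono[of V' V W' W] assms by auto

text \<open>The relations see only carrier, addition and scaling. This identifies the tensor square
  of the \<open>hopf\<close> record of the enveloping algebra with that of the plain algebra record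
  in terms of which its coproduct is defined.\<close>

lemma tensor_space_cong:
  assumes "carrier V = carrier V'" "add V = add V'" "smult V = smult V'"
    and "carrier W = carrier W'" "add W = add W'" "smult W = smult W'"
  shows "tensor_space V W = tensor_space V' W'" and "tensor V W = tensor V' W'"
  using bilinear_relations_cong[OF assms]
  by (auto simp: tensor_space_def tensor_def assms fun_eq_iff)

context
  fixes V :: "('k::field, 'a, 'x) module_scheme" and W :: "('k, 'b, 'y) module_scheme"
  assumes V: "vspace V" and W: "vspace W"
begin

private abbreviation "B \<equiv> free_space (carrier V \<times> carrier W)"
private abbreviation "R \<equiv> bilinear_relations V W"

private lemma R: "subsp R B"
  using V W by (rule subsp_bilinear_relations)

lemma vspace_tensor_space: "vspace (tensor_space V W)"
  unfolding tensor_space_def by (rule vspace_quotient[OF _ R]) simp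

lemma tensor_closed: "v \<in> carrier V \<Longrightarrow> w \<in> carrier W \<Longrightarrow> tensor V W v w \<in> carrier (tensor_space V W)"
  unfolding tensor_space_def tensor_def by (rule coset_in_quotient[OF _ R]) auto

private lemma tensor_eqI:
  assumes "Poly_Mapping.single (v, w) 1 - r \<in> R" "v \<in> carrier V" "w \<in> carrier W" "r \<in> carrier B"
  shows "tensor V W v w = R +>\<^bsub>B\<^esub> r"
  unfolding tensor_def by (subst coset_eq_iff[OF _ R]) (use assms in \<open>auto simp: scale_pm_minus\<close>)

lemma bilin_tensor: "bilin V W (tensor_space V W) (tensor V W)"
proof (rule bilinI; rule linear_homI)
  have add: "R +>\<^bsub>B\<^esub> (r + s) = (R +>\<^bsub>B\<^esub> r) \<oplus>\<^bsub>tensor_space V W\<^esub> (R +>\<^bsub>B\<^esub> s)"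
    if "r \<in> carrier B" "s \<in> carrier B" for r s :: "'a \<times> 'b \<Rightarrow>\<^sub>0 'k"
    unfolding tensor_space_def using quotient_add[OF _ R, of r s] that by simp
  have smult: "R +>\<^bsub>B\<^esub> (scale_pm c r) = c \<odot>\<^bsub>tensor_space V W\<^esub> (R +>\<^bsub>B\<^esub> r)"
    if "r \<in> carrier B" for c and r :: "'a \<times> 'b \<Rightarrow>\<^sub>0 'k"
    unfolding tensor_space_def using quotient_smult[OF _ R, of r c] that by simp
  show "tensor V W v (w \<oplus>\<^bsub>W\<^esub> w') = tensor V W v w \<oplus>\<^bsub>tensor_space V W\<^esub> tensor V W v w'"
    if "v \<in> carrier V" "w \<in> carrier W" "w' \<in> carrier W" for v w w'
    using that W keys_add[of "Poly_Mapping.single (v, w) (1::'k)" "Poly_Mapping.single (v, w') 1"]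
    by (subst tensor_eqI[OF bilinear_relations.add_right]) (auto simp: tensor_def add)
  show "tensor V W (v \<oplus>\<^bsub>V\<^esub> v') w = tensor V W v w \<oplus>\<^bsub>tensor_space V W\<^esub> tensor V W v' w"
    if "w \<in> carrier W" "v \<in> carrier V" "v' \<in> carrier V" for v w v'
    using that V keys_add[of "Poly_Mapping.single (v, w) (1::'k)" "Poly_Mapping.single (v', w) 1"]
    by (subst tensor_eqI[OF bilinear_relations.add_left]) (auto simp: tensor_def add)
  show "tensor V W v (c \<odot>\<^bsub>W\<^esub> w) = c \<odot>\<^bsub>tensor_space V W\<^esub> tensor V W v w"
    if "v \<in> carrier V" "w \<in> carrier W" for v w c
    using that W smult[of "Poly_Mapping.single (v, w) 1" c]
    by (subst tensor_eqI[OF bilinear_relations.scale_right]) (auto simp: tensor_def)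
  show "tensor V W (c \<odot>\<^bsub>V\<^esub> v) w = c \<odot>\<^bsub>tensor_space V W\<^esub> tensor V W v w"
    if "w \<in> carrier W" "v \<in> carrier V" for v w c
    using that V smult[of "Poly_Mapping.single (v, w) 1" c]
    by (subst tensor_eqI[OF bilinear_relations.scale_left]) (auto simp: tensor_def)
qed (auto intro: tensor_closed)

text \<open>Pure tensors are the images of the basis vectors of the free space, so linear maps on
  the quotient are determined by them.\<close>

lemma tensor_hom_eqI:
  assumes Z: "vspace Z" and f: "f \<in> linear_hom (tensor_space V W) Z" and g: "g \<in> linear_hom (tensor_space V W) Z"
    and eq: "\<And>v w. v \<in> carrier V \<Longrightarrow> w \<in> carrier W \<Longrightarrow> f (tensor V W v w) = g (tensor V W v w)"
    and X: "X \<in> carrier (tensor_space V W)"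
  shows "f X = g X"
proof (rule quotient_hom_eqI[OF _ R _ X[unfolded tensor_space_def]])
  fix r :: "'a \<times> 'b \<Rightarrow>\<^sub>0 'k" assume r: "r \<in> carrier B"
  have l: "(\<lambda>r. R +>\<^bsub>B\<^esub> r) \<in> linear_hom B (tensor_space V W)"
    unfolding tensor_space_def by (rule lin_coset[OF _ R]) simp
  show "f (R +>\<^bsub>B\<^esub> r) = g (R +>\<^bsub>B\<^esub> r)"
    by (rule pm_hom_eqI[OF _ _ _ _ Z lin_comp[OF l f] lin_comp[OF l g] _ r])
      (use eq in \<open>auto simp: tensor_def\<close>)
qed simp

context
  fixes Z :: "('k, 'c, 'z) module_scheme" and f :: "'a \<Rightarrow> 'b \<Rightarrow> 'c"
  assumes Z: "vspace Z" and f: "bilin V W Z f"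
begin

private abbreviation (input) "F r \<equiv>
  \<Oplus>\<^bsub>Z\<^esub>p\<in>Poly_Mapping.keys r. Poly_Mapping.lookup r p \<odot>\<^bsub>Z\<^esub> f (fst p) (snd p)"

private lemma F: "(\<lambda>r. F r) \<in> linear_hom B Z"
  by (rule lin_pm_extend) (use Z f in \<open>auto intro: bilin_closed\<close>)

private lemma F_single: "v \<in> carrier V \<Longrightarrow> w \<in> carrier W \<Longrightarrow>
    F (Poly_Mapping.single (v, w) c) = c \<odot>\<^bsub>Z\<^esub> f v w"
  using f by (subst pm_extend_single[OF Z]) (auto intro: bilin_closed)

private lemma F_minus:
  assumes "r \<in> carrier B" "s \<in> carrier B" "F r = F s"
  shows "F (r - s) = \<zero>\<^bsub>Z\<^esub>"
proof -
  have "F (r + scale_pm (-1) s) = F r \<oplus>\<^bsub>Z\<^esub> (-1) \<odot>\<^bsub>Z\<^esub> F s"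
    using lin_add[OF F, of r "scale_pm (-1) s"] lin_smult[OF F, of s "-1"] assms(1,2) keys_scale_pm[of "-1" s]
    by auto
  then show ?thesis
    using lin_closed[OF F assms(2)] Z by (simp add: assms(3) scale_pm_minus)
qed

private lemma F_ker: "r \<in> R \<Longrightarrow> F r = \<zero>\<^bsub>Z\<^esub>"
proof (induction r rule: bilinear_relations.induct)
  case zero
  show ?case
    using Z by simp
next
  case (add r s)
  then show ?case
    using lin_add[OF F, of r s] bilinear_relations_carrier[OF V W] Z by simp
next
  case (scale r c)
  then show ?case
    using lin_smult[OF F, of r c] bilinear_relations_carrier[OF V W] Z by simp
next
  case (add_left v v' w)
  have c: "Poly_Mapping.single (v, w) (1::'k) \<in> carrier B" "Poly_Mapping.single (v', w) (1::'k) \<in> carrier B"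
    using add_left by simp_all
  from lin_add[OF F this]
  have e: "F (Poly_Mapping.single (v, w) 1 + Poly_Mapping.single (v', w) 1) = f v w \<oplus>\<^bsub>Z\<^esub> f v' w"
    using add_left Z bilin_closed[OF f] by (simp add: F_single del: keys_single)
  have "Poly_Mapping.single (v \<oplus>\<^bsub>V\<^esub> v', w) (1::'k) \<in> carrier B"
    using add_left V by simp
  moreover have "Poly_Mapping.single (v, w) 1 + Poly_Mapping.single (v', w) (1::'k) \<in> carrier B"
    using vs_add[OF vspace_free_space c] by simp
  moreover have "F (Poly_Mapping.single (v \<oplus>\<^bsub>V\<^esub> v', w) 1) = f v w \<oplus>\<^bsub>Z\<^esub> f v' w"
    using add_left V Z bilin_closed[OF f] lin_add[OF bilin_left[OF f]] by (simp add: F_single del: keys_single)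
  ultimately show ?case
    using e by (intro F_minus) simp_all
next
  case (add_right v w w')
  have c: "Poly_Mapping.single (v, w) (1::'k) \<in> carrier B" "Poly_Mapping.single (v, w') (1::'k) \<in> carrier B"
    using add_right by simp_all
  from lin_add[OF F this]
  have e: "F (Poly_Mapping.single (v, w) 1 + Poly_Mapping.single (v, w') 1) = f v w \<oplus>\<^bsub>Z\<^esub> f v w'"
    using add_right Z bilin_closed[OF f] by (simp add: F_single del: keys_single)
  have "Poly_Mapping.single (v, w \<oplus>\<^bsub>W\<^esub> w') (1::'k) \<in> carrier B"
    using add_right W by simp
  moreover have "Poly_Mapping.single (v, w) 1 + Poly_Mapping.single (v, w') (1::'k) \<in> carrier B"
    using vs_add[OF vspace_free_space c] by simp
  moreover have "F (Poly_Mapping.single (v, w \<oplus>\<^bsub>W\<^esub> w') 1) = f v w \<oplus>\<^bsub>Z\<^esub> f v w'"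
    using add_right W Z bilin_closed[OF f] lin_add[OF bilin_right[OF f]] by (simp add: F_single del: keys_single)
  ultimately show ?case
    using e by (intro F_minus) simp_all
next
  case (scale_left v w c)
  then show ?case
    using V Z f lin_smult[OF bilin_left[OF f]] bilin_closed[OF f]
    by (intro F_minus) (simp_all add: F_single keys_single_subset del: keys_single)
next
  case (scale_right v w c)
  then show ?case
    using W Z f lin_smult[OF bilin_right[OF f]] bilin_closed[OF f]
    by (intro F_minus) (simp_all add: F_single keys_single_subset del: keys_single)
qed

lemma lin_tensor_lift: "(\<lambda>X. tensor_lift Z f X) \<in> linear_hom (tensor_space V W) Z"
  unfolding tensor_space_def tensor_lift_def
  by (rule lin_quotient_lift[OF _ R Z F F_ker]) simp_all

lemma tensor_lift_tensor:
  assumes "v \<in> carrier V" "w \<in> carrier W"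
  shows "tensor_lift Z f (tensor V W v w) = f v w"
  unfolding tensor_def tensor_lift_def
  using quotient_lift_coset[OF _ R Z F F_ker, of "Poly_Mapping.single (v, w) 1"]
    F_single[of v w 1] assms bilin_closed[OF f, of v w] Z by simp

end

text \<open>For fixed y the lift is linear in the tensor. Linearity in the parameter y is then an
  identity between linear maps of the tensor and can be tested on pure tensors.\<close>

lemma tensor_lift_param:
  fixes Z :: "('k, 'c, 'z) module_scheme" and Y :: "('k, 'd, 'u) module_scheme"
  assumes Z: "vspace Z" and Y: "vspace Y" and f: "\<And>y. y \<in> carrier Y \<Longrightarrow> bilin V W Z (f y)"
    and lin: "\<And>v w. v \<in> carrier V \<Longrightarrow> w \<in> carrier W \<Longrightarrow> (\<lambda>y. f y v w) \<in> linear_hom Y Z"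
    and X: "X \<in> carrier (tensor_space V W)"
  shows "(\<lambda>y. tensor_lift Z (f y) X) \<in> linear_hom Y Z"
proof (rule linear_homI)
  note L = lin_tensor_lift[OF Z f] and lift = tensor_lift_tensor[OF Z f]
  fix y assume y: "y \<in> carrier Y"
  show "tensor_lift Z (f y) X \<in> carrier Z"
    using L[OF y] X by auto
  show "tensor_lift Z (f (y \<oplus>\<^bsub>Y\<^esub> y')) X = tensor_lift Z (f y) X \<oplus>\<^bsub>Z\<^esub> tensor_lift Z (f y') X"
    if y': "y' \<in> carrier Y" for y'
    by (rule tensor_hom_eqI[OF Z L lin_plus[OF Z L L] _ X])
      (use y y' Y in \<open>auto simp: lift lin_add[OF lin]\<close>)
  show "tensor_lift Z (f (c \<odot>\<^bsub>Y\<^esub> y)) X = c \<odot>\<^bsub>Z\<^esub> tensor_lift Z (f y) X" for c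
    by (rule tensor_hom_eqI[OF Z L lin_scale[OF Z L] _ X])
      (use y Y in \<open>auto simp: lift lin_smult[OF lin]\<close>)
qed

text \<open>Every representative of X has its keys in the carriers, so f and g are evaluated only
  where they agree. The two images of the coset, and hence the elements picked from them,
  coincide.\<close>

lemma tensor_lift_cong:
  assumes Z: "vspace Z" and closed: "\<And>v w. v \<in> carrier V \<Longrightarrow> w \<in> carrier W \<Longrightarrow> g v w \<in> carrier Z"
    and eq: "\<And>v w. v \<in> carrier V \<Longrightarrow> w \<in> carrier W \<Longrightarrow> f v w = g v w"
    and X: "X \<in> carrier (tensor_space V W)"
  shows "tensor_lift Z f X = tensor_lift Z g X"
proof -
  obtain s where s: "s \<in> carrier B" "X = R +>\<^bsub>B\<^esub> s"
    using X quotient_cases[OF _ R] unfolding tensor_space_def by auto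
  have "r \<in> carrier B" if "r \<in> X" for r
    using that s R vs_add[OF vspace_free_space, of _ "carrier V \<times> carrier W" s]
    unfolding a_r_coset_def' subsp_def by auto
  then have keys: "Poly_Mapping.keys r \<subseteq> carrier V \<times> carrier W" if "r \<in> X" for r
    using that by simp
  show ?thesis
    unfolding tensor_lift_def
    by (rule arg_cong[where f = the_elem], rule image_cong[OF refl], rule vs_finsum_cong[OF Z refl])
      (use keys closed eq Z in \<open>auto simp: subset_iff\<close>)
qed

lemma lin_tensor_lift_comp:
  assumes Z: "vspace Z" and Z': "vspace Z'" and f: "bilin V W Z f" and h: "h \<in> linear_hom Z Z'"
    and X: "X \<in> carrier (tensor_space V W)"
  shows "h (tensor_lift Z f X) = tensor_lift Z' (\<lambda>v w. h (f v w)) X"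
proof -
  have hf: "bilin V W Z' (\<lambda>v w. h (f v w))"
    by (rule bilinI; rule lin_comp[OF _ h]) (auto intro: bilin_left[OF f] bilin_right[OF f])
  show ?thesis
    by (rule tensor_hom_eqI[OF Z' lin_comp[OF lin_tensor_lift[OF Z f] h] lin_tensor_lift[OF Z' hf] _ X])
      (simp add: tensor_lift_tensor[OF Z f] tensor_lift_tensor[OF Z' hf])
qed

text \<open>Scalars are absorbed into the left factor, and zero is the tensor of two zeros, so pure
  tensors and sums are the only cases.\<close>

lemma tensor_space_induct [consumes 1, case_names tensor add]:
  assumes X: "X \<in> carrier (tensor_space V W)"
    and t: "\<And>v w. v \<in> carrier V \<Longrightarrow> w \<in> carrier W \<Longrightarrow> P (tensor V W v w)"
    and a: "\<And>X Y. X \<in> carrier (tensor_space V W) \<Longrightarrow> Y \<in> carrier (tensor_space V W) \<Longrightarrow>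
      P X \<Longrightarrow> P Y \<Longrightarrow> P (X \<oplus>\<^bsub>tensor_space V W\<^esub> Y)"
  shows "P X"
proof -
  obtain r where r: "r \<in> carrier B" "X = R +>\<^bsub>B\<^esub> r"
    using X quotient_cases[OF _ R] unfolding tensor_space_def by auto
  have L: "(\<lambda>r. R +>\<^bsub>B\<^esub> r) \<in> linear_hom B (tensor_space V W)"
    unfolding tensor_space_def by (rule lin_coset[OF _ R]) simp
  have single: "R +>\<^bsub>B\<^esub> Poly_Mapping.single (v, w) c = tensor V W (c \<odot>\<^bsub>V\<^esub> v) w"
    if "v \<in> carrier V" "w \<in> carrier W" for v w c
    using that V by (intro tensor_eqI[symmetric] bilinear_relations.scale_left) auto
  define s where "s A = (\<Sum>b\<in>A. Poly_Mapping.single b (Poly_Mapping.lookup r b))" for A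
  have "P (R +>\<^bsub>B\<^esub> s A) \<and> s A \<in> carrier B" if "finite A" "A \<subseteq> carrier V \<times> carrier W" for A
    using that
  proof (induction A)
    case empty
    then show ?case
      using single[of "\<zero>\<^bsub>V\<^esub>" "\<zero>\<^bsub>W\<^esub>" 0] t V W by (simp add: s_def)
  next
    case (insert b A)
    obtain v w where b: "b = (v, w)" "v \<in> carrier V" "w \<in> carrier W"
      using insert by auto
    have c: "Poly_Mapping.single b (Poly_Mapping.lookup r b) \<in> carrier B"
      using insert by (simp add: keys_single_subset del: keys_single)
    have IH: "P (R +>\<^bsub>B\<^esub> s A)" "s A \<in> carrier B"
      using insert by auto
    have eq: "s (insert b A) = Poly_Mapping.single b (Poly_Mapping.lookup r b) \<oplus>\<^bsub>B\<^esub> s A"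
      using insert by (simp add: s_def)
    have "P (R +>\<^bsub>B\<^esub> Poly_Mapping.single b (Poly_Mapping.lookup r b))"
      using single[OF b(2,3)] t b V by simp
    then show ?case
      unfolding eq lin_add[OF L c IH(2)]
      using vs_add[OF vspace_free_space c IH(2)] a[OF lin_closed[OF L c] lin_closed[OF L IH(2)] _ IH(1)] by simp
  qed
  from this[of "Poly_Mapping.keys r"] show ?thesis
    using r by (auto simp: s_def sum_single_keys)
qed

end

section \<open>Algebras\<close>

lemma linear_hom_cong:
  assumes "carrier V = carrier V'" "add V = add V'" "smult V = smult V'"
    and "carrier W = carrier W'" "add W = add W'" "smult W = smult W'"
  shows "linear_hom V W = linear_hom V' W'"
  by (simp add: linear_hom_def assms)

lemma bilin_cong:
  assumes "carrier V = carrier V'" "add V = add V'" "smult V = smult V'"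
    and "carrier W = carrier W'" "add W = add W'" "smult W = smult W'"
    and "carrier Z = carrier Z'" "add Z = add Z'" "smult Z = smult Z'"
  shows "bilin V W Z f = bilin V' W' Z' f"
  unfolding bilin_def using assms by (simp cong: linear_hom_cong)

lemma vspace_cong:
  fixes V :: "('k::field, 'a, 'x) module_scheme" and V' :: "('k, 'a, 'y) module_scheme"
  assumes eq: "carrier V = carrier V'" "zero V = zero V'" "add V = add V'" "smult V = smult V'"
    and V: "vspace V"
  shows "vspace V'"
proof (rule vspaceI)
  show "abelian_group V'"
  proof (rule abelian_groupI)
    fix a assume a: "a \<in> carrier V'"
    then show "\<exists>b\<in>carrier V'. b \<oplus>\<^bsub>V'\<^esub> a = \<zero>\<^bsub>V'\<^esub>"
      using vs_cancel_left[OF V, of a] vs_smult[OF V, of a "-1"] by (auto simp: eq)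
  qed (use vs_add[OF V] vs_zero[OF V] vs_assoc[OF V] vs_comm[OF V] vs_zero_left[OF V] in \<open>simp_all add: eq\<close>)
qed (use vs_smult[OF V] vs_add_smult[OF V] vs_smult_add[OF V] vs_one_smult[OF V] vs_smult_smult[OF V]
    in \<open>simp_all add: eq\<close>)

lemma assoc_algebra_vspace: "assoc_algebra A \<Longrightarrow> vspace A"
  by (simp add: assoc_algebra_def vspace_def)

lemma assoc_algebra_ring: "assoc_algebra A \<Longrightarrow> ring A"
  by (simp add: assoc_algebra_def)

context
  fixes A :: "('k::field, 'a, 'x) module_scheme"
  assumes A: "assoc_algebra A"
begin

interpretation ring A
  using A by (rule assoc_algebra_ring)

lemma alg_mult [simp]: "a \<in> carrier A \<Longrightarrow> b \<in> carrier A \<Longrightarrow> a \<otimes>\<^bsub>A\<^esub> b \<in> carrier A"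
  by (rule m_closed)

lemma alg_one [simp]: "\<one>\<^bsub>A\<^esub> \<in> carrier A"
  by (rule one_closed)

lemma alg_assoc: "a \<in> carrier A \<Longrightarrow> b \<in> carrier A \<Longrightarrow> c \<in> carrier A \<Longrightarrow>
    (a \<otimes>\<^bsub>A\<^esub> b) \<otimes>\<^bsub>A\<^esub> c = a \<otimes>\<^bsub>A\<^esub> (b \<otimes>\<^bsub>A\<^esub> c)"
  by (rule m_assoc)

lemma alg_one_left [simp]: "a \<in> carrier A \<Longrightarrow> \<one>\<^bsub>A\<^esub> \<otimes>\<^bsub>A\<^esub> a = a"
  by (rule l_one)

lemma alg_one_right [simp]: "a \<in> carrier A \<Longrightarrow> a \<otimes>\<^bsub>A\<^esub> \<one>\<^bsub>A\<^esub> = a"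
  by (rule r_one)

lemma bilin_mult: "bilin A A A (mult A)"
  using A by (intro bilinI linear_homI) (auto simp: assoc_algebra_def l_distr r_distr)

lemmas alg_lin_left = bilin_left[OF bilin_mult]
lemmas alg_lin_right = bilin_right[OF bilin_mult]

lemma assoc_algebra_opposite: "assoc_algebra (opposite A)"
proof -
  have "vspace (opposite A)"
    by (rule vspace_cong[OF _ _ _ _ assoc_algebra_vspace[OF A]]) (simp_all add: opposite_def)
  moreover have "ring (opposite A)"
  proof (rule ringI)
    show "abelian_group (opposite A)"
      using \<open>vspace (opposite A)\<close> by (rule vspace_abelian_group)
    show "Group.monoid (opposite A)"
      by (rule monoidI) (auto simp: opposite_def m_assoc)
  qed (auto simp: opposite_def l_distr r_distr)
  ultimately show ?thesis
    using A by (auto simp: assoc_algebra_def vspace_def opposite_def)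
qed

end

lemma assoc_algebraI:
  fixes A :: "('k::field, 'a, 'x) module_scheme"
  assumes V: "vspace A" and m: "bilin A A A (mult A)" and one: "\<one>\<^bsub>A\<^esub> \<in> carrier A"
    and assoc: "\<And>a b c. a \<in> carrier A \<Longrightarrow> b \<in> carrier A \<Longrightarrow> c \<in> carrier A \<Longrightarrow>
      (a \<otimes>\<^bsub>A\<^esub> b) \<otimes>\<^bsub>A\<^esub> c = a \<otimes>\<^bsub>A\<^esub> (b \<otimes>\<^bsub>A\<^esub> c)"
    and l_one: "\<And>a. a \<in> carrier A \<Longrightarrow> \<one>\<^bsub>A\<^esub> \<otimes>\<^bsub>A\<^esub> a = a"
    and r_one: "\<And>a. a \<in> carrier A \<Longrightarrow> a \<otimes>\<^bsub>A\<^esub> \<one>\<^bsub>A\<^esub> = a"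
  shows "assoc_algebra A"
proof -
  note lin = bilin_left[OF m] bilin_right[OF m]
  have "ring A"
  proof (rule ringI)
    show "abelian_group A"
      using V by (rule vspace_abelian_group)
    show "Group.monoid A"
      by (rule monoidI) (use assms bilin_closed[OF m] in auto)
  qed (use lin_add[OF lin(1)] lin_add[OF lin(2)] in auto)
  then show ?thesis
    using V lin_smult[OF lin(1)] lin_smult[OF lin(2)] by (auto simp: assoc_algebra_def vspace_def)
qed

text \<open>The two products are compared on the carrier only. In this way associativity passes from
  the twisted Weyl algebra to the Heisenberg double, whose multiplication is identified with it just
  there.\<close>

lemma assoc_algebra_cong:
  fixes A :: "('k::field, 'a, 'x) module_scheme" and A' :: "('k, 'a, 'y) module_scheme"
  assumes eq: "carrier A = carrier A'" "one A = one A'" "zero A = zero A'" "add A = add A'" "smult A = smult A'"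
    and mult: "\<And>a b. a \<in> carrier A \<Longrightarrow> b \<in> carrier A \<Longrightarrow> a \<otimes>\<^bsub>A'\<^esub> b = a \<otimes>\<^bsub>A\<^esub> b"
    and A: "assoc_algebra A"
  shows "assoc_algebra A'"
proof (rule assoc_algebraI)
  show "vspace A'"
    using eq(1,3-5) assoc_algebra_vspace[OF A] by (rule vspace_cong)
  show "bilin A' A' A' (mult A')"
    unfolding bilin_cong[OF eq(1,4,5) eq(1,4,5) eq(1,4,5), symmetric]
  proof (rule bilinI)
    have V: "vspace A"
      using A by (rule assoc_algebra_vspace)
    show "(\<lambda>b. a \<otimes>\<^bsub>A'\<^esub> b) \<in> linear_hom A A" if "a \<in> carrier A" for a
      by (rule lin_cong[OF V alg_lin_right[OF A that]]) (simp add: mult that)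
    show "(\<lambda>a. a \<otimes>\<^bsub>A'\<^esub> b) \<in> linear_hom A A" if "b \<in> carrier A" for b
      by (rule lin_cong[OF V alg_lin_left[OF A that]]) (simp add: mult that)
  qed
qed (use alg_mult[OF A] alg_one[OF A] alg_assoc[OF A] alg_one_left[OF A] alg_one_right[OF A] in \<open>simp_all add: mult flip: eq\<close>)

lemma algebra_homI:
  assumes "f \<in> linear_hom A B"
    and "\<And>a b. a \<in> carrier A \<Longrightarrow> b \<in> carrier A \<Longrightarrow> f (a \<otimes>\<^bsub>A\<^esub> b) = f a \<otimes>\<^bsub>B\<^esub> f b"
    and "f \<one>\<^bsub>A\<^esub> = \<one>\<^bsub>B\<^esub>"
  shows "f \<in> algebra_hom A B"
  using assms by (auto simp: algebra_hom_def linear_hom_def ring_hom_def)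

lemma alg_hom_lin: "f \<in> algebra_hom A B \<Longrightarrow> f \<in> linear_hom A B"
  by (simp add: algebra_hom_def)

lemma alg_hom_mult: "f \<in> algebra_hom A B \<Longrightarrow> a \<in> carrier A \<Longrightarrow> b \<in> carrier A \<Longrightarrow>
    f (a \<otimes>\<^bsub>A\<^esub> b) = f a \<otimes>\<^bsub>B\<^esub> f b"
  by (simp add: algebra_hom_def ring_hom_def)

lemma alg_hom_one: "f \<in> algebra_hom A B \<Longrightarrow> f \<one>\<^bsub>A\<^esub> = \<one>\<^bsub>B\<^esub>"
  by (simp add: algebra_hom_def ring_hom_def)

lemma algebra_hom_comp: "f \<in> algebra_hom A B \<Longrightarrow> g \<in> algebra_hom B C \<Longrightarrow> (\<lambda>a. g (f a)) \<in> algebra_hom A C"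
  by (intro algebra_homI lin_comp[of f A B g C])
    (auto simp: alg_hom_lin alg_hom_mult alg_hom_one lin_closed[OF alg_hom_lin])

subsection \<open>Tensor product algebras\<close>

text \<open>The multiplications of tensor algebras and of smash products are both nested lifts of a
  map in four variables. The well-definedness of the nested lift and its value on pure tensors are
  settled here for both.\<close>

lemma tensor_lift2:
  fixes V :: "('k::field, 'a, 'x) module_scheme" and W :: "('k, 'b, 'y) module_scheme"
    and V' :: "('k, 'c, 'u) module_scheme" and W' :: "('k, 'd, 'v) module_scheme"
    and Z :: "('k, 'e, 'z) module_scheme"
  assumes V: "vspace V" and W: "vspace W" and V': "vspace V'" and W': "vspace W'" and Z: "vspace Z"
    and q: "\<And>a b. a \<in> carrier V \<Longrightarrow> b \<in> carrier W \<Longrightarrow> bilin V' W' Z (q a b)"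
    and q': "\<And>c d. c \<in> carrier V' \<Longrightarrow> d \<in> carrier W' \<Longrightarrow> bilin V W Z (\<lambda>a b. q a b c d)"
  shows "bilin (tensor_space V W) (tensor_space V' W') Z
      (\<lambda>X Y. tensor_lift Z (\<lambda>a b. tensor_lift Z (q a b) Y) X)"
    and "a \<in> carrier V \<Longrightarrow> b \<in> carrier W \<Longrightarrow> Y \<in> carrier (tensor_space V' W') \<Longrightarrow>
      tensor_lift Z (\<lambda>a b. tensor_lift Z (q a b) Y) (tensor V W a b) = tensor_lift Z (q a b) Y"
    and "a \<in> carrier V \<Longrightarrow> b \<in> carrier W \<Longrightarrow> c \<in> carrier V' \<Longrightarrow> d \<in> carrier W' \<Longrightarrow>
      tensor_lift Z (\<lambda>a b. tensor_lift Z (q a b) (tensor V' W' c d)) (tensor V W a b) = q a b c d"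
proof -
  note T' = vspace_tensor_space[OF V' W']
  have b: "bilin V W Z (\<lambda>a b. tensor_lift Z (q a b) Y)" if Y: "Y \<in> carrier (tensor_space V' W')" for Y
  proof (rule bilinI)
    show "(\<lambda>b. tensor_lift Z (q a b) Y) \<in> linear_hom W Z" if "a \<in> carrier V" for a
      by (rule tensor_lift_param[OF V' W' Z W q bilin_right[OF q'] Y]) (use that in auto)
    show "(\<lambda>a. tensor_lift Z (q a b) Y) \<in> linear_hom V Z" if "b \<in> carrier W" for b
      by (rule tensor_lift_param[OF V' W' Z V q bilin_left[OF q'] Y]) (use that in auto)
  qed
  show "bilin (tensor_space V W) (tensor_space V' W') Z
      (\<lambda>X Y. tensor_lift Z (\<lambda>a b. tensor_lift Z (q a b) Y) X)"
  proof (rule bilinI)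
    show "(\<lambda>X. tensor_lift Z (\<lambda>a b. tensor_lift Z (q a b) Y) X) \<in> linear_hom (tensor_space V W) Z"
      if "Y \<in> carrier (tensor_space V' W')" for Y
      using V W Z b[OF that] by (rule lin_tensor_lift)
    show "(\<lambda>Y. tensor_lift Z (\<lambda>a b. tensor_lift Z (q a b) Y) X) \<in> linear_hom (tensor_space V' W') Z"
      if "X \<in> carrier (tensor_space V W)" for X
      by (rule tensor_lift_param[OF V W Z T' b _ that]; (assumption | rule lin_tensor_lift[OF V' W' Z q]))
  qed
  show *: "a \<in> carrier V \<Longrightarrow> b \<in> carrier W \<Longrightarrow> Y \<in> carrier (tensor_space V' W') \<Longrightarrow>
      tensor_lift Z (\<lambda>a b. tensor_lift Z (q a b) Y) (tensor V W a b) = tensor_lift Z (q a b) Y" for Y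
    by (rule tensor_lift_tensor[OF V W Z b])
  show "a \<in> carrier V \<Longrightarrow> b \<in> carrier W \<Longrightarrow> c \<in> carrier V' \<Longrightarrow> d \<in> carrier W' \<Longrightarrow>
      tensor_lift Z (\<lambda>a b. tensor_lift Z (q a b) (tensor V' W' c d)) (tensor V W a b) = q a b c d"
    using *[of "tensor V' W' c d"] tensor_closed[OF V' W', of c d]
      tensor_lift_tensor[OF V' W' Z q, of a b c d] by simp
qed

text \<open>Associativity is an identity of trilinear maps, so it extends from pure tensors one
  factor at a time, beginning with the last.\<close>

lemma tensor_assoc_algebraI:
  fixes V :: "('k::field, 'a, 'x) module_scheme" and W :: "('k, 'b, 'y) module_scheme"
  defines "T \<equiv> tensor_space V W"
  assumes V: "vspace V" and W: "vspace W"
    and A: "carrier A = carrier T" "zero A = zero T" "add A = add T" "smult A = smult T"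
    and m: "bilin T T T (mult A)" and one: "\<one>\<^bsub>A\<^esub> \<in> carrier T"
    and l_one: "\<And>v w. v \<in> carrier V \<Longrightarrow> w \<in> carrier W \<Longrightarrow> \<one>\<^bsub>A\<^esub> \<otimes>\<^bsub>A\<^esub> tensor V W v w = tensor V W v w"
    and r_one: "\<And>v w. v \<in> carrier V \<Longrightarrow> w \<in> carrier W \<Longrightarrow> tensor V W v w \<otimes>\<^bsub>A\<^esub> \<one>\<^bsub>A\<^esub> = tensor V W v w"
    and assoc: "\<And>u v w x y z. u \<in> carrier V \<Longrightarrow> v \<in> carrier W \<Longrightarrow> w \<in> carrier V \<Longrightarrow> x \<in> carrier W \<Longrightarrow>
        y \<in> carrier V \<Longrightarrow> z \<in> carrier W \<Longrightarrow>
        (tensor V W u v \<otimes>\<^bsub>A\<^esub> tensor V W w x) \<otimes>\<^bsub>A\<^esub> tensor V W y z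
          = tensor V W u v \<otimes>\<^bsub>A\<^esub> (tensor V W w x \<otimes>\<^bsub>A\<^esub> tensor V W y z)"
  shows "assoc_algebra A"
proof (rule assoc_algebraI)
  have T: "vspace T"
    unfolding T_def using V W by (rule vspace_tensor_space)
  note l = bilin_left[OF m] and r = bilin_right[OF m] and c = bilin_closed[OF m]
  show "vspace A"
    by (rule vspace_cong[OF _ _ _ _ T]) (simp_all add: A)
  show "bilin A A A (mult A)"
    using m bilin_cong[of A T A T A T] A by simp
  note ext = tensor_hom_eqI[OF V W T[unfolded T_def], folded T_def]
  note tc = tensor_closed[OF V W, folded T_def]
  show "\<one>\<^bsub>A\<^esub> \<otimes>\<^bsub>A\<^esub> a = a" if "a \<in> carrier A" for a
    using that A by (intro ext[OF r[OF one] lin_id l_one]) simp_all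
  show "a \<otimes>\<^bsub>A\<^esub> \<one>\<^bsub>A\<^esub> = a" if "a \<in> carrier A" for a
    using that A by (intro ext[OF l[OF one] lin_id r_one]) simp_all
  have 1: "(tensor V W u v \<otimes>\<^bsub>A\<^esub> tensor V W w x) \<otimes>\<^bsub>A\<^esub> c = tensor V W u v \<otimes>\<^bsub>A\<^esub> (tensor V W w x \<otimes>\<^bsub>A\<^esub> c)"
    if "u \<in> carrier V" "v \<in> carrier W" "w \<in> carrier V" "x \<in> carrier W" "c \<in> carrier T" for u v w x c
    by (rule ext[OF r lin_comp[OF r r] assoc]) (use that tc c in auto)
  have 2: "(tensor V W u v \<otimes>\<^bsub>A\<^esub> b) \<otimes>\<^bsub>A\<^esub> c = tensor V W u v \<otimes>\<^bsub>A\<^esub> (b \<otimes>\<^bsub>A\<^esub> c)"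
    if "u \<in> carrier V" "v \<in> carrier W" "b \<in> carrier T" "c \<in> carrier T" for u v b c
    by (rule ext[OF lin_comp[OF r l] lin_comp[OF l r] 1]) (use that tc c in auto)
  have 3: "(a \<otimes>\<^bsub>A\<^esub> b) \<otimes>\<^bsub>A\<^esub> c = a \<otimes>\<^bsub>A\<^esub> (b \<otimes>\<^bsub>A\<^esub> c)"
    if "a \<in> carrier T" "b \<in> carrier T" "c \<in> carrier T" for a b c
    by (rule ext[OF lin_comp[OF l l] l 2]) (use that tc c in auto)
  show "(a \<otimes>\<^bsub>A\<^esub> b) \<otimes>\<^bsub>A\<^esub> c = a \<otimes>\<^bsub>A\<^esub> (b \<otimes>\<^bsub>A\<^esub> c)"
    if "a \<in> carrier A" "b \<in> carrier A" "c \<in> carrier A" for a b c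
    using 3 that A by simp
  show "\<one>\<^bsub>A\<^esub> \<in> carrier A"
    using one A by simp
qed

lemma tensor_algebra_simps [simp]:
  "carrier (tensor_algebra A B) = carrier (tensor_space A B)"
  "zero (tensor_algebra A B) = zero (tensor_space A B)"
  "add (tensor_algebra A B) = add (tensor_space A B)"
  "smult (tensor_algebra A B) = smult (tensor_space A B)"
  "one (tensor_algebra A B) = tensor A B \<one>\<^bsub>A\<^esub> \<one>\<^bsub>B\<^esub>"
  by (simp_all add: tensor_algebra_def)

context
  fixes A :: "('k::field, 'a, 'x) module_scheme" and B :: "('k, 'b, 'y) module_scheme"
  assumes A: "assoc_algebra A" and B: "assoc_algebra B"
begin

private lemma vA: "vspace A" and vB: "vspace B"
  using A B by (auto intro: assoc_algebra_vspace)

private lemma quadrilinear: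
  "a \<in> carrier A \<Longrightarrow> b \<in> carrier B \<Longrightarrow>
    bilin A B (tensor_space A B) (\<lambda>c d. tensor A B (a \<otimes>\<^bsub>A\<^esub> c) (b \<otimes>\<^bsub>B\<^esub> d))"
  "c \<in> carrier A \<Longrightarrow> d \<in> carrier B \<Longrightarrow>
    bilin A B (tensor_space A B) (\<lambda>a b. tensor A B (a \<otimes>\<^bsub>A\<^esub> c) (b \<otimes>\<^bsub>B\<^esub> d))"
  using A B
  by (auto intro!: bilinI
      intro: lin_comp[OF alg_lin_right[OF A] bilin_left[OF bilin_tensor[OF vA vB]]]
        lin_comp[OF alg_lin_right[OF B] bilin_right[OF bilin_tensor[OF vA vB]]]
        lin_comp[OF alg_lin_left[OF A] bilin_left[OF bilin_tensor[OF vA vB]]]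
        lin_comp[OF alg_lin_left[OF B] bilin_right[OF bilin_tensor[OF vA vB]]])

lemma tensor_algebra_mult_tensor:
  "a \<in> carrier A \<Longrightarrow> b \<in> carrier B \<Longrightarrow> c \<in> carrier A \<Longrightarrow> d \<in> carrier B \<Longrightarrow>
    tensor A B a b \<otimes>\<^bsub>tensor_algebra A B\<^esub> tensor A B c d = tensor A B (a \<otimes>\<^bsub>A\<^esub> c) (b \<otimes>\<^bsub>B\<^esub> d)"
  using tensor_lift2(3)[OF vA vB vA vB vspace_tensor_space[OF vA vB] quadrilinear]
  by (simp add: tensor_algebra_def)

lemma assoc_algebra_tensor_algebra: "assoc_algebra (tensor_algebra A B)"
proof (rule tensor_assoc_algebraI[OF vA vB])
  show "bilin (tensor_space A B) (tensor_space A B) (tensor_space A B) (mult (tensor_algebra A B))"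
    using tensor_lift2(1)[OF vA vB vA vB vspace_tensor_space[OF vA vB] quadrilinear]
    by (simp add: tensor_algebra_def)
qed (use A B in \<open>simp_all add: tensor_algebra_mult_tensor tensor_closed[OF vA vB] alg_assoc\<close>)

end

subsection \<open>Quotient algebras\<close>

context
  fixes A :: "('k::field, 'a, 'x) module_scheme" and R :: "'a set"
  assumes A: "assoc_algebra A" and R: "R \<subseteq> carrier A"
begin

private abbreviation "I \<equiv> Idl\<^bsub>A\<^esub> R"

interpretation ring A
  using A by (rule assoc_algebra_ring)

interpretation I: ideal I A
  using R by (rule genideal_ideal)

private lemma V: "vspace A"
  using A by (rule assoc_algebra_vspace)

text \<open>A ring ideal absorbs scalars because c a is the product of c 1 with a.\<close>

lemma subsp_genideal: "subsp I A"
  unfolding subsp_def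
proof (intro conjI allI ballI)
  fix c a assume a: "a \<in> I"
  then have aA: "a \<in> carrier A"
    using I.a_subset by auto
  have "c \<odot>\<^bsub>A\<^esub> a = (c \<odot>\<^bsub>A\<^esub> \<one>\<^bsub>A\<^esub>) \<otimes>\<^bsub>A\<^esub> a"
    using A aA V lin_smult[OF alg_lin_left[OF A aA], of "\<one>\<^bsub>A\<^esub>" c] by simp
  then show "c \<odot>\<^bsub>A\<^esub> a \<in> I"
    using I.I_l_closed[OF a, of "c \<odot>\<^bsub>A\<^esub> \<one>\<^bsub>A\<^esub>"] V by simp
qed (use I.a_subset I.zero_closed in auto)

lemmas quot_coset_eq_iff = coset_eq_iff[OF V subsp_genideal]
lemmas quot_lin_coset = lin_coset[OF V subsp_genideal]
lemmas carrier_quot = carrier_quotient[OF V subsp_genideal]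

lemma quot_mult: "a \<in> carrier A \<Longrightarrow> b \<in> carrier A \<Longrightarrow>
    (I +>\<^bsub>A\<^esub> a) \<otimes>\<^bsub>quotient A I\<^esub> (I +>\<^bsub>A\<^esub> b) = I +>\<^bsub>A\<^esub> (a \<otimes>\<^bsub>A\<^esub> b)"
  by (simp add: quotient_def FactRing_def I.rcoset_mult_add)

lemma quot_one: "\<one>\<^bsub>quotient A I\<^esub> = I +>\<^bsub>A\<^esub> \<one>\<^bsub>A\<^esub>"
  by (simp add: quotient_def FactRing_def)

lemma assoc_algebra_quot: "assoc_algebra (quotient A I)"
  by (rule assoc_algebraI, rule vspace_quotient[OF V subsp_genideal], intro bilinI linear_homI)
    (use V in \<open>auto simp: carrier_quot quot_mult quot_one quotient_add[OF V subsp_genideal]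
      quotient_smult[OF V subsp_genideal] l_distr r_distr m_assoc
      lin_smult[OF alg_lin_left[OF A]] lin_smult[OF alg_lin_right[OF A]]\<close>)

lemma quot_hom_coset: "(\<lambda>a. I +>\<^bsub>A\<^esub> a) \<in> algebra_hom A (quotient A I)"
  by (rule algebra_homI) (simp_all add: quot_lin_coset quot_mult quot_one)

lemma quot_relation:
  assumes "r \<in> R"
  shows "I +>\<^bsub>A\<^esub> r = \<zero>\<^bsub>quotient A I\<^esub>"
proof -
  have r: "r \<in> carrier A" "r \<in> I"
    using assms R genideal_self[OF R] by auto
  then have "I +>\<^bsub>A\<^esub> r = I +>\<^bsub>A\<^esub> \<zero>\<^bsub>A\<^esub>"
    using V by (intro iffD2[OF quot_coset_eq_iff]) simp_all
  then show ?thesis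
    by (simp only: quotient_zero[OF V subsp_genideal])
qed

context
  fixes B :: "('k, 'b, 'y) module_scheme" and f :: "'a \<Rightarrow> 'b"
  assumes B: "assoc_algebra B" and f: "f \<in> algebra_hom A B" and f_R: "\<And>r. r \<in> R \<Longrightarrow> f r = \<zero>\<^bsub>B\<^esub>"
begin

text \<open>The kernel of f is an ideal containing R, and I is the smallest such ideal.\<close>

private lemma ker:
  assumes "r \<in> I"
  shows "f r = \<zero>\<^bsub>B\<^esub>"
proof -
  have "ring_hom_ring A B f"
    using f by (intro ring_hom_ringI2 assoc_algebra_ring A B) (simp add: algebra_hom_def)
  then have "ideal (a_kernel A B f) A"
    by (rule ring_hom_ring.kernel_is_ideal)
  moreover have "R \<subseteq> a_kernel A B f"
    unfolding a_kernel_def' using f_R R by blast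
  ultimately have "I \<subseteq> a_kernel A B f"
    by (rule genideal_minimal)
  then show ?thesis
    using assms unfolding a_kernel_def' by blast
qed

lemma quot_lift_coset: "a \<in> carrier A \<Longrightarrow> the_elem (f ` (I +>\<^bsub>A\<^esub> a)) = f a"
  by (rule quotient_lift_coset[OF V subsp_genideal assoc_algebra_vspace[OF B] alg_hom_lin[OF f] ker])

lemma quot_lift_hom: "(\<lambda>X. the_elem (f ` X)) \<in> algebra_hom (quotient A I) B"
  by (rule algebra_homI, rule lin_quotient_lift[OF V subsp_genideal assoc_algebra_vspace[OF B] alg_hom_lin[OF f] ker])
    (auto simp: carrier_quot quot_mult quot_one quot_lift_coset alg_hom_mult[OF f] alg_hom_one[OF f])

end

end

subsection \<open>Free and presented algebras\<close>

lemma free_algebra_simps [simp]: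
  "carrier (free_algebra X) = {f. Poly_Mapping.keys f \<subseteq> {w. set (letters w) \<subseteq> X}}"
  "mult (free_algebra X) = (*)" "one (free_algebra X) = 1"
  "zero (free_algebra X) = 0" "add (free_algebra X) = (+)" "smult (free_algebra X) = scale_pm"
  by (auto simp: free_algebra_def)

text \<open>Here \<open>0\<close> is the empty word, so these elements are the scalars of the free
  algebra; they are central although the multiplication is not commutative.\<close>

lemma pm_mult_single_zero:
  "(f :: 'x free_monoid \<Rightarrow>\<^sub>0 'k::field) * Poly_Mapping.single 0 c = Poly_Mapping.single 0 c * f"
proof -
  have "(\<Sum>b\<in>A. Poly_Mapping.single b (g b)) * Poly_Mapping.single 0 c =
      Poly_Mapping.single 0 c * (\<Sum>b\<in>A. Poly_Mapping.single b (g b))" for A :: "'x free_monoid set" and g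
    by (simp add: sum_distrib_left sum_distrib_right mult_single mult.commute)
  then show ?thesis
    using sum_single_keys[of f] by metis
qed

lemma assoc_algebra_free_algebra: "assoc_algebra (free_algebra X :: ('k::field, _) module)"
proof (rule assoc_algebraI)
  show "vspace (free_algebra X :: ('k, _) module)"
    by (rule vspace_pmI[where B = "{w. set (letters w) \<subseteq> X}"]) simp_all
  have c: "f * g \<in> carrier (free_algebra X)" if "f \<in> carrier (free_algebra X)" "g \<in> carrier (free_algebra X)"
    for f g :: "'a free_monoid \<Rightarrow>\<^sub>0 'k"
    using that keys_mult[of f g] by (fastforce simp: plus_free_monoid_def)
  show "bilin (free_algebra X) (free_algebra X) (free_algebra X :: ('k, _) module) (mult (free_algebra X))"
    using c by (intro bilinI linear_homI)
      (simp_all add: distrib_left distrib_right scale_pm_eq_mult mult.assoc,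
       simp_all add: pm_mult_single_zero flip: mult.assoc)
qed (auto simp: zero_free_monoid_def mult.assoc)

lemma gen_in_free_algebra: "x \<in> X \<Longrightarrow> (gen x :: _ \<Rightarrow>\<^sub>0 'k::field) \<in> carrier (free_algebra X)"
  by (simp add: gen_def)

lemma single_Cons: "Poly_Mapping.single (Word (x # ws)) 1 = gen x * Poly_Mapping.single (Word ws) (1::'k::field)"
  by (simp add: gen_def mult_single plus_free_monoid_def)

lemma single_snoc: "Poly_Mapping.single (Word (ws @ [x])) 1 = Poly_Mapping.single (Word ws) (1::'k::field) * gen x"
  by (simp add: gen_def mult_single plus_free_monoid_def)

definition free_lift :: "('k::field, 'b, 'y) module_scheme \<Rightarrow> ('x \<Rightarrow> 'b) \<Rightarrow> ('x free_monoid \<Rightarrow>\<^sub>0 'k) \<Rightarrow> 'b" where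
  "free_lift B f r = (\<Oplus>\<^bsub>B\<^esub>w\<in>Poly_Mapping.keys r. Poly_Mapping.lookup r w \<odot>\<^bsub>B\<^esub>
     foldr (\<lambda>x b. f x \<otimes>\<^bsub>B\<^esub> b) (letters w) \<one>\<^bsub>B\<^esub>)"

lemma pres_lift_eq: "pres_lift B f X = the_elem (free_lift B f ` X)"
  by (simp add: pres_lift_def free_lift_def[abs_def])

context
  fixes B :: "('k::field, 'b, 'y) module_scheme" and X :: "'x set" and f :: "'x \<Rightarrow> 'b"
  assumes B: "assoc_algebra B" and f: "\<And>x. x \<in> X \<Longrightarrow> f x \<in> carrier B"
begin

private lemma B_vspace: "vspace B"
  using B by (rule assoc_algebra_vspace)

private abbreviation "W xs \<equiv> foldr (\<lambda>x b. f x \<otimes>\<^bsub>B\<^esub> b) xs \<one>\<^bsub>B\<^esub>"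

private lemma W_closed: "set xs \<subseteq> X \<Longrightarrow> W xs \<in> carrier B"
  by (induction xs) (use B f in auto)

private lemma W_append: "set xs \<subseteq> X \<Longrightarrow> set ys \<subseteq> X \<Longrightarrow> W (xs @ ys) = W xs \<otimes>\<^bsub>B\<^esub> W ys"
proof (induction xs)
  case Nil
  then show ?case
    using B W_closed by simp
next
  case (Cons x xs)
  have "W ((x # xs) @ ys) = f x \<otimes>\<^bsub>B\<^esub> (W xs \<otimes>\<^bsub>B\<^esub> W ys)"
    using Cons by simp
  then show ?case
    using Cons.prems B f[of x] W_closed[of xs] W_closed[of ys] by (simp add: alg_assoc)
qed

lemma lin_free_lift: "free_lift B f \<in> linear_hom (free_algebra X) B"
  unfolding free_lift_def[abs_def]
  by (rule lin_pm_extend[where B = "{w. set (letters w) \<subseteq> X}"]) (use W_closed B_vspace in auto)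

lemma free_lift_single: "set xs \<subseteq> X \<Longrightarrow>
    free_lift B f (Poly_Mapping.single (Word xs) c) = c \<odot>\<^bsub>B\<^esub> foldr (\<lambda>x b. f x \<otimes>\<^bsub>B\<^esub> b) xs \<one>\<^bsub>B\<^esub>"
  unfolding free_lift_def using W_closed[of xs] B_vspace by (subst pm_extend_single) auto

lemma free_lift_gen: "x \<in> X \<Longrightarrow> free_lift B f (gen x) = f x"
  using free_lift_single[of "[x]" 1] f[of x] B B_vspace by (simp add: gen_def)

text \<open>Multiplicativity holds on words by \<open>W_append\<close> and extends bilinearly, one
  factor at a time.\<close>

lemma free_lift_hom: "free_lift B f \<in> algebra_hom (free_algebra X) B"
proof (rule algebra_homI[OF lin_free_lift])
  let ?F = "free_algebra X :: ('k, _) module"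
  note L = lin_free_lift
  note ext = pm_hom_eqI[where B = "{w. set (letters w) \<subseteq> X}" and V = ?F, OF _ _ _ _ B_vspace]
  note FA = assoc_algebra_free_algebra[of X]
  show "free_lift B f \<one>\<^bsub>?F\<^esub> = \<one>\<^bsub>B\<^esub>"
    using free_lift_single[of "[]" 1] B_vspace B by (simp add: zero_free_monoid_def flip: single_one)
  have 1: "free_lift B f (Poly_Mapping.single v 1 * Poly_Mapping.single w 1) =
      free_lift B f (Poly_Mapping.single v 1) \<otimes>\<^bsub>B\<^esub> free_lift B f (Poly_Mapping.single w 1)"
    if "set (letters v) \<subseteq> X" "set (letters w) \<subseteq> X" for v w
    using that free_lift_single[of "letters v" 1] free_lift_single[of "letters w" 1]
      free_lift_single[of "letters v @ letters w" 1] W_append[of "letters v" "letters w"]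
      W_closed[of "letters v"] W_closed[of "letters w"] B B_vspace
    by (simp add: mult_single plus_free_monoid_def)
  have cl: "Poly_Mapping.single v 1 \<in> carrier ?F" if "set (letters v) \<subseteq> X" for v
    using that by simp
  have 2: "free_lift B f (Poly_Mapping.single v 1 \<otimes>\<^bsub>?F\<^esub> s) =
      free_lift B f (Poly_Mapping.single v 1) \<otimes>\<^bsub>B\<^esub> free_lift B f s"
    if v: "set (letters v) \<subseteq> X" and s: "s \<in> carrier ?F" for v s
    by (rule ext[OF _ _ _ _ lin_comp[OF alg_lin_right[OF FA cl[OF v]] L]
          lin_comp[OF L alg_lin_right[OF B lin_closed[OF L cl[OF v]]]] _ s])
      (use 1[OF v] in simp_all)
  show "free_lift B f (r \<otimes>\<^bsub>?F\<^esub> s) = free_lift B f r \<otimes>\<^bsub>B\<^esub> free_lift B f s"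
    if r: "r \<in> carrier ?F" and s: "s \<in> carrier ?F" for r s
    by (rule ext[OF _ _ _ _ lin_comp[OF alg_lin_left[OF FA s] L]
          lin_comp[OF L alg_lin_left[OF B lin_closed[OF L s]]] _ r])
      (use 2[OF _ s] in simp_all)
qed

lemma free_lift_diff:
  assumes "r \<in> carrier (free_algebra X)" "s \<in> carrier (free_algebra X)"
  shows "free_lift B f (r - s) = free_lift B f r \<oplus>\<^bsub>B\<^esub> (-1) \<odot>\<^bsub>B\<^esub> free_lift B f s"
proof -
  have s: "scale_pm (-1) s \<in> carrier (free_algebra X)"
    using assms(2) keys_scale_pm[of "-1" s] by auto
  show ?thesis
    using lin_add[OF lin_free_lift assms(1) s] lin_smult[OF lin_free_lift assms(2), of "-1"]
    by (simp add: scale_pm_minus)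
qed

end

context
  fixes X :: "'x set" and R :: "('x free_monoid \<Rightarrow>\<^sub>0 'k::field) set"
  assumes R: "R \<subseteq> carrier (free_algebra X)"
begin

private abbreviation "Q \<equiv> presented_algebra X R"

lemma assoc_algebra_presented_algebra: "assoc_algebra (presented_algebra X R)"
  unfolding presented_algebra_def using assoc_algebra_free_algebra R by (rule assoc_algebra_quot)

lemma pres_gen_closed: "x \<in> X \<Longrightarrow> pres_gen X R x \<in> carrier (presented_algebra X R)"
  unfolding presented_algebra_def pres_gen_def
  by (auto simp: carrier_quot[OF assoc_algebra_free_algebra R] gen_def)

private abbreviation "coset r \<equiv> (Idl\<^bsub>free_algebra X\<^esub> R) +>\<^bsub>free_algebra X\<^esub> r"

private lemma coset: "coset \<in> algebra_hom (free_algebra X) (presented_algebra X R)"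
  unfolding presented_algebra_def by (rule quot_hom_coset[OF assoc_algebra_free_algebra R])

text \<open>Common core of the two induction rules below, which build words from the left and from
  the right.\<close>

private lemma words_induct:
  assumes a: "a \<in> carrier (presented_algebra X R)"
    and words: "\<And>xs. set xs \<subseteq> X \<Longrightarrow> P (coset (Poly_Mapping.single (Word xs) 1))"
    and add: "\<And>a b. a \<in> carrier (presented_algebra X R) \<Longrightarrow> b \<in> carrier (presented_algebra X R) \<Longrightarrow>
      P a \<Longrightarrow> P b \<Longrightarrow> P (a \<oplus>\<^bsub>presented_algebra X R\<^esub> b)"
    and smult: "\<And>c a. a \<in> carrier (presented_algebra X R) \<Longrightarrow> P a \<Longrightarrow> P (c \<odot>\<^bsub>presented_algebra X R\<^esub> a)"
  shows "P a"
proof -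
  note vQ = assoc_algebra_vspace[OF assoc_algebra_presented_algebra]
  obtain r where r: "r \<in> carrier (free_algebra X)" "a = coset r"
    using a by (auto simp: presented_algebra_def carrier_quot[OF assoc_algebra_free_algebra R])
  have L: "coset \<in> linear_hom (free_algebra X) Q"
    using coset by (rule alg_hom_lin)
  have w: "P (coset (Poly_Mapping.single w c))" if "set (letters w) \<subseteq> X" for w c
  proof -
    have "Poly_Mapping.single w 1 \<in> carrier (free_algebra X :: ('k, _) module)"
      using that by simp
    from lin_smult[OF L this, of c] lin_closed[OF L this] show ?thesis
      using words[OF that] smult[of "coset (Poly_Mapping.single w 1)" c] by simp
  qed
  define s where "s A = (\<Sum>b\<in>A. Poly_Mapping.single b (Poly_Mapping.lookup r b))" for A
  have "P (coset (s A)) \<and> s A \<in> carrier (free_algebra X)" if "finite A" "\<forall>w\<in>A. set (letters w) \<subseteq> X" for A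
    using that
  proof (induction A)
    case empty
    then show ?case
      using w[of 0 0] by (simp add: s_def zero_free_monoid_def)
  next
    case (insert w A)
    have c: "Poly_Mapping.single w (Poly_Mapping.lookup r w) \<in> carrier (free_algebra X)"
      using insert by (simp add: keys_single_subset del: keys_single)
    have IH: "P (coset (s A))" "s A \<in> carrier (free_algebra X)"
      using insert by auto
    have eq: "s (insert w A) = Poly_Mapping.single w (Poly_Mapping.lookup r w) \<oplus>\<^bsub>free_algebra X\<^esub> s A"
      using insert by (simp add: s_def)
    show ?case
      unfolding eq lin_add[OF L c IH(2)]
      using vs_add[OF assoc_algebra_vspace[OF assoc_algebra_free_algebra] c IH(2)]
        add[OF lin_closed[OF L c] lin_closed[OF L IH(2)] w IH(1)] insert.prems by simp
  qed
  from this[of "Poly_Mapping.keys r"] show ?thesis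
    using r by (auto simp: s_def sum_single_keys)
qed

lemma presented_algebra_induct [consumes 1, case_names one add smult gen]:
  assumes a: "a \<in> carrier (presented_algebra X R)"
    and one: "P \<one>\<^bsub>presented_algebra X R\<^esub>"
    and add: "\<And>a b. a \<in> carrier (presented_algebra X R) \<Longrightarrow> b \<in> carrier (presented_algebra X R) \<Longrightarrow>
      P a \<Longrightarrow> P b \<Longrightarrow> P (a \<oplus>\<^bsub>presented_algebra X R\<^esub> b)"
    and smult: "\<And>c a. a \<in> carrier (presented_algebra X R) \<Longrightarrow> P a \<Longrightarrow> P (c \<odot>\<^bsub>presented_algebra X R\<^esub> a)"
    and gen: "\<And>x a. x \<in> X \<Longrightarrow> a \<in> carrier (presented_algebra X R) \<Longrightarrow> P a \<Longrightarrow>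
      P (pres_gen X R x \<otimes>\<^bsub>presented_algebra X R\<^esub> a)"
  shows "P a"
  using a
proof (rule words_induct)
  fix xs assume "set xs \<subseteq> X"
  then have "P (coset (Poly_Mapping.single (Word xs) 1)) \<and> coset (Poly_Mapping.single (Word xs) 1) \<in> carrier Q"
  proof (induction xs)
    case Nil
    then show ?case
      using one alg_hom_one[OF coset] alg_one[OF assoc_algebra_presented_algebra]
      by (simp add: zero_free_monoid_def flip: single_one)
  next
    case (Cons x xs)
    have "coset (Poly_Mapping.single (Word (x # xs)) 1) = pres_gen X R x \<otimes>\<^bsub>Q\<^esub> coset (Poly_Mapping.single (Word xs) 1)"
      using Cons.prems alg_hom_mult[OF coset, of "gen x" "Poly_Mapping.single (Word xs) 1"]
      unfolding single_Cons pres_gen_def by (simp add: gen_def)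
    then show ?case
      using Cons gen pres_gen_closed alg_mult[OF assoc_algebra_presented_algebra] by simp
  qed
  then show "P (coset (Poly_Mapping.single (Word xs) 1))" ..
qed (use add smult in auto)

text \<open>Splits off the last letter of a word. It serves the antipode law for the product of a
  with S b, in which a generator multiplied on the right meets its own negative.\<close>

lemma presented_algebra_induct_right [consumes 1, case_names one add smult gen]:
  assumes a: "a \<in> carrier (presented_algebra X R)"
    and one: "P \<one>\<^bsub>presented_algebra X R\<^esub>"
    and add: "\<And>a b. a \<in> carrier (presented_algebra X R) \<Longrightarrow> b \<in> carrier (presented_algebra X R) \<Longrightarrow>
      P a \<Longrightarrow> P b \<Longrightarrow> P (a \<oplus>\<^bsub>presented_algebra X R\<^esub> b)"
    and smult: "\<And>c a. a \<in> carrier (presented_algebra X R) \<Longrightarrow> P a \<Longrightarrow> P (c \<odot>\<^bsub>presented_algebra X R\<^esub> a)"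
    and gen: "\<And>x a. x \<in> X \<Longrightarrow> a \<in> carrier (presented_algebra X R) \<Longrightarrow> P a \<Longrightarrow>
      P (a \<otimes>\<^bsub>presented_algebra X R\<^esub> pres_gen X R x)"
  shows "P a"
  using a
proof (rule words_induct)
  fix xs assume "set xs \<subseteq> X"
  then have "P (coset (Poly_Mapping.single (Word xs) 1)) \<and> coset (Poly_Mapping.single (Word xs) 1) \<in> carrier Q"
  proof (induction xs rule: rev_induct)
    case Nil
    then show ?case
      using one alg_hom_one[OF coset] alg_one[OF assoc_algebra_presented_algebra]
      by (simp add: zero_free_monoid_def flip: single_one)
  next
    case (snoc x xs)
    have "coset (Poly_Mapping.single (Word (xs @ [x])) 1) = coset (Poly_Mapping.single (Word xs) 1) \<otimes>\<^bsub>Q\<^esub> pres_gen X R x"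
      using snoc.prems alg_hom_mult[OF coset, of "Poly_Mapping.single (Word xs) 1" "gen x"]
      unfolding single_snoc pres_gen_def by (simp add: gen_def)
    then show ?case
      using snoc gen pres_gen_closed alg_mult[OF assoc_algebra_presented_algebra] by simp
  qed
  then show "P (coset (Poly_Mapping.single (Word xs) 1))" ..
qed (use add smult in auto)

lemma pres_relation: "r \<in> R \<Longrightarrow> (Idl\<^bsub>free_algebra X\<^esub> R) +>\<^bsub>free_algebra X\<^esub> r = \<zero>\<^bsub>presented_algebra X R\<^esub>"
  unfolding presented_algebra_def by (rule quot_relation[OF assoc_algebra_free_algebra R])

lemma pres_coset_hom: "(\<lambda>r. (Idl\<^bsub>free_algebra X\<^esub> R) +>\<^bsub>free_algebra X\<^esub> r) \<in> algebra_hom (free_algebra X) (presented_algebra X R)"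
  by (rule coset)

context
  fixes B :: "('k, 'b, 'y) module_scheme" and f :: "'x \<Rightarrow> 'b"
  assumes B: "assoc_algebra B" and f: "\<And>x. x \<in> X \<Longrightarrow> f x \<in> carrier B"
    and f_R: "\<And>r. r \<in> R \<Longrightarrow> free_lift B f r = \<zero>\<^bsub>B\<^esub>"
begin

lemma pres_lift_hom: "pres_lift B f \<in> algebra_hom (presented_algebra X R) B"
  unfolding pres_lift_eq[abs_def] presented_algebra_def
  by (rule quot_lift_hom[OF assoc_algebra_free_algebra R B free_lift_hom[OF B f] f_R])

lemma pres_lift_gen:
  assumes "x \<in> X"
  shows "pres_lift B f (pres_gen X R x) = f x"
proof -
  have "the_elem (free_lift B f ` (coset (gen x))) = free_lift B f (gen x)"
    by (rule quot_lift_coset[OF assoc_algebra_free_algebra R B free_lift_hom[OF B f] f_R])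
      (use gen_in_free_algebra[OF assms] in auto)
  also have "\<dots> = f x"
    by (rule free_lift_gen[OF B f assms])
  finally show ?thesis
    by (simp only: pres_lift_eq pres_gen_def)
qed

end

end

section \<open>Power series\<close>

lemma mvps_algebra_simps [simp]:
  "carrier mvps_algebra = UNIV" "mult mvps_algebra = (*)" "one mvps_algebra = 1"
  "zero mvps_algebra = 0" "add mvps_algebra = (+)" "smult mvps_algebra = mvps_scale"
  by (simp_all add: mvps_algebra_def)

lemma coeff_arith [simp]:
  "coeff 0 m = (0::'k::ab_group_add)"
  "coeff (P + Q) m = coeff P m + (coeff Q m :: 'k)"
  "coeff (P - Q) m = coeff P m - (coeff Q m :: 'k)"
  "coeff (- P) m = - (coeff P m :: 'k)"
  by (transfer, simp)+

lemma coeff_one: "coeff (1 :: ('v::finite, 'k::comm_ring_1) mvps) m = (if m = (\<lambda>_. 0) then 1 else 0)"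
  by transfer simp

lemma coeff_times:
  "coeff (P * Q) m = (\<Sum>(a, b)\<in>splits m. coeff P a * coeff Q b)"
  for P :: "('v::finite, 'k::comm_ring_1) mvps"
  by transfer simp

lemma coeff_scale [simp]: "coeff (mvps_scale c P) m = c * coeff P m"
  by (simp add: mvps_scale_def)

lemma coeff_monom: "coeff (mvps_monom a) m = (if m = a then 1 else 0)"
  by (simp add: mvps_monom_def)

lemma coeff_sum [simp]: "coeff (sum f A) m = (\<Sum>i\<in>A. coeff (f i) m :: 'k::ab_group_add)"
  by (induction A rule: infinite_finite_induct) simp_all

lemma coeff_pderiv: "coeff (mvps_pderiv j P) m = of_nat (Suc (m j)) * coeff P (m(j := Suc (m j)))"
  by (simp add: mvps_pderiv_def)

lemma splits_zero: "splits (\<lambda>_. 0 :: nat) = {(\<lambda>_. 0, \<lambda>_. 0)}"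
  by (auto simp: splits_def fun_eq_iff)

lemma const_term_simps [simp]:
  "const_term (0 :: ('v::finite, 'k::comm_ring_1) mvps) = 0"
  "const_term (1 :: ('v::finite, 'k::comm_ring_1) mvps) = 1"
  "const_term (P + Q) = const_term P + const_term (Q :: ('v::finite, 'k::comm_ring_1) mvps)"
  "const_term (mvps_scale c P) = c * const_term P"
  "const_term (P * Q) = const_term P * const_term (Q :: ('v::finite, 'k::comm_ring_1) mvps)"
  by (simp_all add: const_term_def coeff_one coeff_times splits_zero)

lemma mvps_scale_mult:
  "mvps_scale c P * Q = mvps_scale c (P * Q)" "P * mvps_scale c Q = mvps_scale c (P * Q)"
  for P :: "('v::finite, 'k::comm_ring_1) mvps"
  by (auto intro!: mvps_eqI sum.cong simp: coeff_times sum_distrib_left mult.assoc mult.left_commute)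

lemma mvps_scale_simps:
  "mvps_scale c (P + Q) = mvps_scale c P + mvps_scale c (Q :: ('v, 'k::comm_ring_1) mvps)"
  "mvps_scale (c + d) P = mvps_scale c P + mvps_scale d P"
  "mvps_scale c (mvps_scale d P) = mvps_scale (c * d) P"
  "mvps_scale 1 P = P" "mvps_scale 0 P = 0"
  "mvps_scale c (0 :: ('v, 'k::comm_ring_1) mvps) = 0"
  by (auto intro!: mvps_eqI simp: algebra_simps)

lemma assoc_algebra_mvps: "assoc_algebra (mvps_algebra :: ('k::field, ('v::finite, 'k) mvps) module)"
proof (rule assoc_algebraI)
  show "vspace (mvps_algebra :: ('k, ('v, 'k) mvps) module)"
  proof (rule vspaceI)
    show "abelian_group (mvps_algebra :: ('k, ('v, 'k) mvps) module)"
      by (rule abelian_groupI) (auto simp: algebra_simps intro: exI[of _ "- P" for P])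
  qed (simp_all add: mvps_scale_simps)
  show "bilin mvps_algebra mvps_algebra (mvps_algebra :: ('k, ('v, 'k) mvps) module) (mult mvps_algebra)"
    by (intro bilinI linear_homI) (simp_all add: distrib_left distrib_right mvps_scale_mult)
qed (simp_all add: mult.assoc)

lemmas vspace_mvps = assoc_algebra_vspace[OF assoc_algebra_mvps]

lemma finsum_mvps [simp]:
  "finsum (mvps_algebra :: ('k::field, ('v::finite, 'k) mvps) module) f I = sum f I"
proof (cases "finite I")
  case True
  then show ?thesis
    by (induction I) (simp_all add: vspace_mvps vs_finsum_insert)
qed (simp add: vspace_mvps vs_finsum_infinite)

lemma mvps_monom_mult:
  "mvps_monom a * mvps_monom b = (mvps_monom (\<lambda>v. a v + b v) :: ('v::finite, 'k::comm_ring_1) mvps)"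
proof (rule mvps_eqI)
  fix m :: "'v \<Rightarrow> nat"
  have "coeff (mvps_monom a * mvps_monom b) m = (\<Sum>p\<in>splits m. if p = (a, b) then 1 else (0::'k))"
    unfolding coeff_times by (rule sum.cong) (auto simp: coeff_monom split: if_splits)
  then show "coeff (mvps_monom a * mvps_monom b) m = coeff (mvps_monom (\<lambda>v. a v + b v) :: ('v, 'k) mvps) m"
    using finite_splits[of m] by (subst (asm) sum.delta) (auto simp: coeff_monom splits_def)
qed

lemma coeff_var_mult:
  "coeff (mvps_var j * Q) m = (if m j = 0 then 0 else coeff Q (m(j := m j - 1)))"
  for Q :: "('v::finite, 'k::comm_ring_1) mvps"
proof -
  let ?e = "\<lambda>v. if v = j then 1 else (0::nat)"
  have "coeff (mvps_var j * Q) m = (\<Sum>p\<in>splits m. if p = (?e, m(j := m j - 1)) then coeff Q (m(j := m j - 1)) else 0)"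
    unfolding coeff_times
  proof (rule sum.cong)
    fix p assume "p \<in> splits m"
    then obtain a b where p: "p = (a, b)" "m = (\<lambda>v. a v + b v)"
      by (auto simp: splits_def)
    then have "b = m(j := m j - 1)" if "a = ?e"
      using that by (auto simp: fun_eq_iff)
    then show "(case p of (a, b) \<Rightarrow> coeff (mvps_var j) a * coeff Q b) =
        (if p = (?e, m(j := m j - 1)) then coeff Q (m(j := m j - 1)) else 0)"
      by (auto simp: p(1) mvps_var_def coeff_monom)
  qed simp
  also have "\<dots> = (if (?e, m(j := m j - 1)) \<in> splits m then coeff Q (m(j := m j - 1)) else 0)"
    by simp
  also have "(?e, m(j := m j - 1)) \<in> splits m \<longleftrightarrow> m j \<noteq> 0"
    by (auto simp: splits_def fun_eq_iff)
  finally show ?thesis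
    by simp
qed

lemma pderiv_add: "mvps_pderiv l (P + Q) = mvps_pderiv l P + mvps_pderiv l (Q :: ('v, 'k::comm_ring_1) mvps)"
  by (rule mvps_eqI) (simp add: coeff_pderiv algebra_simps)

lemma pderiv_scale_one: "mvps_pderiv l (mvps_scale c 1) = (0 :: ('v::finite, 'k::comm_ring_1) mvps)"
  by (rule mvps_eqI) (auto simp: coeff_pderiv coeff_one fun_eq_iff)

lemma pderiv_var_mult:
  "mvps_pderiv l (mvps_var j * Q) = (if l = j then Q else 0) + mvps_var j * mvps_pderiv l Q"
  for Q :: "('v::finite, 'k::comm_ring_1) mvps"
proof (rule mvps_eqI)
  fix m :: "'v \<Rightarrow> nat"
  show "coeff (mvps_pderiv l (mvps_var j * Q)) m = coeff ((if l = j then Q else 0) + mvps_var j * mvps_pderiv l Q) m"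
  proof (cases "l = j")
    case True
    then show ?thesis
      by (cases "m j") (auto simp: coeff_pderiv coeff_var_mult distrib_right fun_upd_idem)
  next
    case False
    then have "m(l := Suc (m l), j := m j - 1) = m(j := m j - 1, l := Suc (m l))"
      by (simp add: fun_upd_twist)
    then show ?thesis
      using False by (simp add: coeff_pderiv coeff_var_mult)
  qed
qed

text \<open>Each nonconstant monomial is assigned to one variable occurring in it, and Q_j collects
  the monomials assigned to j, divided by that variable. For the zero exponent the choice is
  arbitrary and harmless, as the constant term is split off.\<close>

lemma mvps_decompose:
  fixes P :: "('v::finite, 'k::comm_ring_1) mvps"
  obtains Q where "P = mvps_scale (const_term P) 1 + (\<Sum>j\<in>UNIV. mvps_var j * Q j)"
proof -
  define c where "c m = (SOME j. m j \<noteq> (0::nat))" for m :: "'v \<Rightarrow> nat"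
  define Q where "Q j = Mvps (\<lambda>m. if c (m(j := Suc (m j))) = j then coeff P (m(j := Suc (m j))) else 0)" for j
  have "P = mvps_scale (const_term P) 1 + (\<Sum>j\<in>UNIV. mvps_var j * Q j)"
  proof (rule mvps_eqI)
    fix m :: "'v \<Rightarrow> nat"
    show "coeff P m = coeff (mvps_scale (const_term P) 1 + (\<Sum>j\<in>UNIV. mvps_var j * Q j)) m"
    proof (cases "m = (\<lambda>_. 0)")
      case True
      then show ?thesis
        by (simp add: coeff_one const_term_def coeff_var_mult)
    next
      case False
      then have c: "m (c m) \<noteq> 0"
        unfolding c_def by (metis (mono_tags, lifting) ext someI_ex)
      have "coeff (mvps_var j * Q j) m = (if j = c m then coeff P m else 0)" for j
        using c by (auto simp: coeff_var_mult Q_def)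
      then show ?thesis
        using False by (simp add: coeff_one)
    qed
  qed
  then show ?thesis
    by (rule that)
qed

section \<open>Derivations of the power series ring\<close>

definition mvps_derivation :: "(('v::finite, 'k::comm_ring_1) mvps \<Rightarrow> ('v, 'k) mvps) \<Rightarrow> bool" where
  "mvps_derivation D \<longleftrightarrow> (\<forall>P Q. D (P + Q) = D P + D Q) \<and> (\<forall>c P. D (mvps_scale c P) = mvps_scale c (D P)) \<and>
     (\<forall>P Q. D (P * Q) = D P * Q + P * D Q)"

lemma derivation_one:
  assumes "mvps_derivation D"
  shows "D 1 = 0"
proof -
  have "D (1 * 1) = D 1 * 1 + 1 * D 1"
    using assms unfolding mvps_derivation_def by blast
  then show ?thesis
    by simp
qed

text \<open>
  No continuity is assumed: the difference of both sides annihilates the variables, so by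
  \<open>mvps_decompose\<close> it raises the order of vanishing arbitrarily.
\<close>

lemma derivation_chain_rule:
  fixes D :: "('v::finite, 'k::comm_ring_1) mvps \<Rightarrow> ('v, 'k) mvps"
  assumes D: "mvps_derivation D"
  shows "D P = (\<Sum>l\<in>UNIV. mvps_pderiv l P * D (mvps_var l))"
proof -
  define E where "E P = D P - (\<Sum>l\<in>UNIV. mvps_pderiv l P * D (mvps_var l))" for P
  have E_var: "E (mvps_var j * Q) = mvps_var j * E Q" for j Q
  proof -
    have "(\<Sum>l\<in>UNIV. mvps_pderiv l (mvps_var j * Q) * D (mvps_var l))
      = (\<Sum>l\<in>UNIV. if l = j then Q * D (mvps_var j) else 0) +
        (\<Sum>l\<in>UNIV. mvps_var j * (mvps_pderiv l Q * D (mvps_var l)))"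
      unfolding sum.distrib[symmetric]
      by (rule sum.cong) (simp_all add: pderiv_var_mult distrib_right mult.assoc)
    then show ?thesis
      using D by (simp add: E_def mvps_derivation_def sum_distrib_left[symmetric] algebra_simps)
  qed
  have E_add: "E (P + Q) = E P + E Q" for P Q
    using D by (simp add: E_def mvps_derivation_def pderiv_add distrib_right sum.distrib)
  have E_sum: "E (sum f A) = (\<Sum>i\<in>A. E (f i))" for f and A :: "'v set"
    using E_add[of 0 0] by (induction A rule: infinite_finite_induct) (simp_all add: E_add)
  have E_decompose: "E P = (\<Sum>j\<in>UNIV. mvps_var j * E (Q j))"
    if "P = mvps_scale c 1 + (\<Sum>j\<in>UNIV. mvps_var j * Q j)" for P c Q
  proof -
    have "E (mvps_scale c 1 + R) = E R" for R
      using D by (simp add: E_def pderiv_add pderiv_scale_one mvps_derivation_def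
          derivation_one[OF D] mvps_scale_simps)
    then have "E P = E (\<Sum>j\<in>UNIV. mvps_var j * Q j)"
      using that by simp
    also have "\<dots> = (\<Sum>j\<in>UNIV. E (mvps_var j * Q j))"
      by (rule E_sum)
    finally show ?thesis
      by (simp add: E_var)
  qed
  have "coeff (E P) m = 0" if "sum m UNIV < N" for N m P
    using that
  proof (induction N arbitrary: m P)
    case (Suc N)
    obtain Q where Q: "P = mvps_scale (const_term P) 1 + (\<Sum>j\<in>UNIV. mvps_var j * Q j)"
      by (rule mvps_decompose)
    have "coeff (mvps_var j * E (Q j)) m = 0" for j
    proof (cases "m j = 0")
      case False
      have "sum m UNIV = m j + sum m (UNIV - {j})"
        by (rule sum.remove) auto
      moreover have "sum (m(j := m j - 1)) UNIV = m j - 1 + sum m (UNIV - {j})"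
        by (subst sum.remove[of _ j]) auto
      ultimately show ?thesis
        using Suc False by (simp add: coeff_var_mult)
    qed (simp add: coeff_var_mult)
    then show ?case
      by (simp add: E_decompose[OF Q])
  qed simp
  then have "E P = 0"
    by (intro mvps_eqI) (simp, blast)
  then show ?thesis
    by (simp add: E_def)
qed

text \<open>Since P vanishes through total degree |m|, its partial derivatives vanish below degree
  |m|. In the chain rule only the constant terms of the D (\<open>mvps_var l\<close>) can then
  contribute to the coefficient at m, and they select l = i.\<close>

lemma derivation_leading_coeff:
  fixes D :: "('v::finite, 'k::comm_ring_1) mvps \<Rightarrow> ('v, 'k) mvps"
  assumes D: "mvps_derivation D" and c: "\<And>l. const_term (D (mvps_var l)) = (if l = i then 1 else 0)"
    and P: "\<And>a. sum a UNIV \<le> sum m UNIV \<Longrightarrow> coeff P a = 0"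
  shows "coeff (D P) m = of_nat (Suc (m i)) * coeff P (m(i := Suc (m i)))"
proof -
  have "coeff (mvps_pderiv l P * D (mvps_var l)) m = (if l = i then coeff (mvps_pderiv l P) m else 0)" for l
  proof -
    have m: "(m, \<lambda>_. 0) \<in> splits m"
      by (simp add: splits_def)
    have "coeff (mvps_pderiv l P) (fst p) * coeff (D (mvps_var l)) (snd p) = 0"
      if p_in: "p \<in> splits m - {(m, \<lambda>_. 0)}" for p
    proof -
      obtain a b where p: "p = (a, b)" and ab: "(a, b) \<in> splits m" "(a, b) \<noteq> (m, \<lambda>_. 0)"
        using p_in by (cases p) simp
      then have *: "m = (\<lambda>v. a v + b v)"
        by (auto simp: splits_def)
      then obtain v where "b v \<noteq> 0"
        using ab(2) by (auto simp: fun_eq_iff)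
      then have "0 < sum b UNIV"
        by (simp add: sum_pos2[of _ v])
      moreover have "sum (a(l := Suc (a l))) UNIV = Suc (sum a UNIV)"
        by (subst (1 2) sum.remove[of _ l]) auto
      ultimately have "coeff P (a(l := Suc (a l))) = 0"
        by (intro P) (simp add: * sum.distrib)
      then show ?thesis
        by (simp add: p coeff_pderiv)
    qed
    then show ?thesis
      using c[of l] by (simp add: coeff_times sum.remove[OF finite_splits m] const_term_def case_prod_unfold)
  qed
  then show ?thesis
    by (subst derivation_chain_rule[OF D]) (simp add: coeff_pderiv)
qed

subsection \<open>Continuity\<close>

lemma continuous_functionalD:
  assumes "continuous_functional l"
  shows "l (P + Q) = l P + l Q" "l (mvps_scale c P) = c * l P" "l 0 = 0"
proof -
  show *: "l (P + Q) = l P + l Q" and "l (mvps_scale c P) = c * l P" for P Q c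
    using assms unfolding continuous_functional_def by blast+
  show "l 0 = 0"
    using *[of 0 0] by simp
qed

lemma continuous_functional_coeff: "continuous_functional (\<lambda>P. coeff P m)"
  unfolding continuous_functional_def by (auto intro!: exI[of _ "{m}"])

lemma continuous_functional_zero: "continuous_functional (\<lambda>_. 0)"
  unfolding continuous_functional_def by auto

lemma continuous_functional_add:
  assumes "continuous_functional l" "continuous_functional l'"
  shows "continuous_functional (\<lambda>P. l P + l' P)"
proof -
  obtain A A' where "finite A" "\<And>P. (\<forall>a\<in>A. coeff P a = 0) \<Longrightarrow> l P = 0"
    "finite A'" "\<And>P. (\<forall>a\<in>A'. coeff P a = 0) \<Longrightarrow> l' P = 0"
    using assms unfolding continuous_functional_def by metis
  then have "\<exists>A. finite A \<and> (\<forall>P. (\<forall>a\<in>A. coeff P a = 0) \<longrightarrow> l P + l' P = 0)"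
    by (intro exI[of _ "A \<union> A'"]) auto
  then show ?thesis
    using continuous_functionalD[OF assms(1)] continuous_functionalD[OF assms(2)]
    unfolding continuous_functional_def by (simp add: algebra_simps)
qed

lemma continuous_functional_scale:
  assumes "continuous_functional l"
  shows "continuous_functional (\<lambda>P. c * l P)"
proof -
  obtain A where "finite A" "\<And>P. (\<forall>a\<in>A. coeff P a = 0) \<Longrightarrow> l P = 0"
    using assms unfolding continuous_functional_def by metis
  then have "\<exists>A. finite A \<and> (\<forall>P. (\<forall>a\<in>A. coeff P a = 0) \<longrightarrow> c * l P = 0)"
    by (intro exI[of _ A]) auto
  then show ?thesis
    using continuous_functionalD[OF assms] unfolding continuous_functional_def by (simp add: algebra_simps)
qed

lemma continuous_functional_sum:
  "(\<And>i. i \<in> I \<Longrightarrow> continuous_functional (l i)) \<Longrightarrow> continuous_functional (\<lambda>P. \<Sum>i\<in>I. l i P)"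
  by (induction I rule: infinite_finite_induct)
    (simp_all add: continuous_functional_zero continuous_functional_add)

text \<open>Each of the finitely many coefficients seen by l depends, through f, on finitely many
  coefficients of the argument; the union of these sets is still finite.\<close>

lemma continuous_functional_comp:
  assumes l: "continuous_functional l" and f: "continuous_linear f"
  shows "continuous_functional (\<lambda>P. l (f P))"
proof -
  obtain A where A: "finite A" "\<And>P. (\<forall>a\<in>A. coeff P a = 0) \<Longrightarrow> l P = 0"
    using l unfolding continuous_functional_def by metis
  have "\<exists>B. finite B \<and> (\<forall>P. (\<forall>b\<in>B. coeff P b = 0) \<longrightarrow> coeff (f P) a = 0)" for a
    using f unfolding continuous_linear_def continuous_functional_def by blast
  then obtain B where B: "\<And>a. finite (B a)" "\<And>a P. (\<forall>b\<in>B a. coeff P b = 0) \<Longrightarrow> coeff (f P) a = 0"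
    by metis
  have "\<exists>A. finite A \<and> (\<forall>P. (\<forall>a\<in>A. coeff P a = 0) \<longrightarrow> l (f P) = 0)"
    using A B by (intro exI[of _ "\<Union>a\<in>A. B a"]) auto
  moreover have "f (P + Q) = f P + f Q" "f (mvps_scale c P) = mvps_scale c (f P)" for P Q c
    using f continuous_functionalD(1,2)[of "\<lambda>P. coeff (f P) _"] unfolding continuous_linear_def
    by (auto intro!: mvps_eqI)
  ultimately show ?thesis
    using continuous_functionalD[OF l] unfolding continuous_functional_def by simp
qed

text \<open>A continuous functional vanishes on every series without coefficients in some finite set
  A, so P may be replaced by its truncation to A, a finite combination of monomials.\<close>

lemma continuous_functional_expansion:
  fixes l :: "('v::finite, 'k::comm_ring_1) mvps \<Rightarrow> 'k"
  assumes l: "continuous_functional l"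
  shows "finite {a. l (mvps_monom a) \<noteq> 0}"
    and "l P = (\<Sum>a | l (mvps_monom a) \<noteq> 0. coeff P a * l (mvps_monom a))"
proof -
  obtain A where A: "finite A" "\<And>P. (\<forall>a\<in>A. coeff P a = 0) \<Longrightarrow> l P = 0"
    using l unfolding continuous_functional_def by metis
  have sub: "{a. l (mvps_monom a) \<noteq> 0} \<subseteq> A"
    using A(2) by (force simp: coeff_monom)
  then show "finite {a. l (mvps_monom a) \<noteq> 0}"
    using A(1) finite_subset by blast
  have l_sum: "l (sum f B) = (\<Sum>i\<in>B. l (f i))" for f and B :: "('v \<Rightarrow> nat) set"
    using continuous_functionalD[OF l] by (induction B rule: infinite_finite_induct) simp_all
  define P' where "P' = (\<Sum>a\<in>A. mvps_scale (coeff P a) (mvps_monom a))"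
  have "coeff P' a = coeff P a" if "a \<in> A" for a
    using that A(1) by (simp add: P'_def coeff_monom if_distrib cong: if_cong)
  then have "l (P - P') = 0"
    by (intro A(2)) simp
  then have "l P = l P'"
    using continuous_functionalD(1)[OF l, of "P - P'" P'] by simp
  also have "\<dots> = (\<Sum>a\<in>A. coeff P a * l (mvps_monom a))"
    by (simp add: P'_def l_sum continuous_functionalD[OF l])
  also have "\<dots> = (\<Sum>a | l (mvps_monom a) \<noteq> 0. coeff P a * l (mvps_monom a))"
    using A(1) sub by (intro sum.mono_neutral_right) auto
  finally show "l P = (\<Sum>a | l (mvps_monom a) \<noteq> 0. coeff P a * l (mvps_monom a))" .
qed

lemma continuous_functional_mult_coeff:
  fixes R :: "('v::finite, 'k::comm_ring_1) mvps"
  shows "continuous_functional (\<lambda>P. coeff (mvps_pderiv l P * R) m)"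
proof -
  have "continuous_functional (\<lambda>P. \<Sum>p\<in>splits m. (of_nat (Suc (fst p l)) * coeff R (snd p)) * coeff P ((fst p)(l := Suc (fst p l))))"
    by (intro continuous_functional_sum continuous_functional_scale continuous_functional_coeff)
  then show ?thesis
    by (simp add: coeff_times coeff_pderiv case_prod_unfold mult_ac(1,3) mult.commute[of "coeff R _"] del: of_nat_Suc)
qed

lemma continuous_linear_derivation:
  assumes "mvps_derivation D"
  shows "continuous_linear D"
  unfolding continuous_linear_def
proof
  fix m
  have "(\<lambda>P. coeff (D P) m) = (\<lambda>P. \<Sum>l\<in>UNIV. coeff (mvps_pderiv l P * D (mvps_var l)) m)"
    by (rule ext) (subst derivation_chain_rule[OF assms], simp)
  then show "continuous_functional (\<lambda>P. coeff (D P) m)"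
    by (simp add: continuous_functional_sum continuous_functional_mult_coeff)
qed

subsection \<open>Exponents of completed tensor products\<close>

lemma case_sum_Inl_Inr: "case_sum (m \<circ> Inl) (m \<circ> Inr) = m"
  by (rule ext) (auto split: sum.split)

lemma case_sum_zero_iff: "case_sum a b = (\<lambda>_. 0) \<longleftrightarrow> a = (\<lambda>_. 0) \<and> b = (\<lambda>_. 0::nat)"
  by (auto simp: fun_eq_iff split: sum.splits)

text \<open>A splitting of an exponent on the disjoint union of the variables is a pair of
  splittings, one for each summand.\<close>

lemma coeff_times_case_sum:
  fixes F G :: "('v::finite + 'w::finite, 'k::comm_ring_1) mvps"
  shows "coeff (F * G) (case_sum a b) =
    (\<Sum>(a1, a2)\<in>splits a. \<Sum>(b1, b2)\<in>splits b. coeff F (case_sum a1 b1) * coeff G (case_sum a2 b2))"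
proof -
  have "coeff (F * G) (case_sum a b) =
    (\<Sum>(p, q)\<in>splits a \<times> splits b. coeff F (case_sum (fst p) (fst q)) * coeff G (case_sum (snd p) (snd q)))"
    unfolding coeff_times
    by (rule sum.reindex_bij_witness[where i = "\<lambda>x. (case_sum (fst (fst x)) (fst (snd x)), case_sum (snd (fst x)) (snd (snd x)))"
          and j = "\<lambda>x. ((fst x \<circ> Inl, snd x \<circ> Inl), (fst x \<circ> Inr, snd x \<circ> Inr))"])
      (auto simp: splits_def fun_eq_iff split: sum.splits, auto simp: case_sum_Inl_Inr)
  then show ?thesis
    by (simp add: sum.cartesian_product case_prod_unfold)
qed

section \<open>Enveloping algebras\<close>

lemma tensor_algebra_cong:
  assumes "carrier A = carrier A'" "add A = add A'" "smult A = smult A'" "mult A = mult A'" "one A = one A'"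
    and "carrier B = carrier B'" "add B = add B'" "smult B = smult B'" "mult B = mult B'" "one B = one B'"
  shows "tensor_algebra A B = tensor_algebra A' B'"
  using tensor_space_cong[of A A' B B'] by (simp add: tensor_algebra_def assms)

locale based_lie_algebra =
  fixes scale :: "'k::field_char_0 \<Rightarrow> 'g::ab_group_add \<Rightarrow> 'g"
    and br :: "'g \<Rightarrow> 'g \<Rightarrow> 'g"
    and x :: "'n::finite \<Rightarrow> 'g"
  assumes lie: "lie_algebra scale br" and basis: "is_basis scale x"
begin

abbreviation U :: "('k, ('g free_monoid \<Rightarrow>\<^sub>0 'k) set) hopf" where
  "U \<equiv> enveloping_algebra scale br"

abbreviation \<iota> :: "'g \<Rightarrow> ('g free_monoid \<Rightarrow>\<^sub>0 'k) set" where
  "\<iota> \<equiv> env_gen scale br"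

abbreviation xh :: "'n \<Rightarrow> ('g free_monoid \<Rightarrow>\<^sub>0 'k) set" where
  "xh i \<equiv> \<iota> (x i)"

abbreviation UU :: "('k, _) module" where
  "UU \<equiv> tensor_algebra U U"

abbreviation U0 :: "('k, ('g free_monoid \<Rightarrow>\<^sub>0 'k) set) module" where
  "U0 \<equiv> presented_algebra UNIV (enveloping_relations scale br)"

lemma U_simps: "carrier U = carrier U0" "mult U = mult U0" "one U = one U0" "zero U = zero U0"
  "add U = add U0" "smult U = smult U0"
  by (simp_all add: enveloping_algebra_def Let_def)

lemma enveloping_relations_closed: "enveloping_relations scale br \<subseteq> carrier (free_algebra UNIV)"
  by auto

lemma assoc_algebra_U [simp]: "assoc_algebra U"
  by (rule assoc_algebra_cong[OF _ _ _ _ _ _ assoc_algebra_presented_algebra[OF enveloping_relations_closed]])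
    (simp_all add: U_simps)

lemma vspace_U [simp]: "vspace U"
  by (rule assoc_algebra_vspace) simp

lemma \<iota>_closed [simp]: "\<iota> y \<in> carrier U"
  using pres_gen_closed[OF enveloping_relations_closed, of y] by (simp add: env_gen_def U_simps)

sublocale vector_space scale
  using lie by (simp add: lie_algebra_def)

lemma br_add_left: "br (y + y') z = br y z + br y' z"
  using lie by (auto simp: lie_algebra_def Vector_Spaces.linear_iff)

lemma br_add_right: "br y (z + z') = br y z + br y z'"
  using lie by (auto simp: lie_algebra_def Vector_Spaces.linear_iff)

lemma br_self: "br y y = 0"
  using lie by (simp add: lie_algebra_def)

lemma br_anti: "br y z = - br z y"
proof -
  have "br y y + br y z + (br z y + br z z) = 0"
    using br_self[of "y + z"] by (simp only: br_add_left br_add_right ac_simps)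
  then show ?thesis
    by (simp add: br_self eq_neg_iff_add_eq_0)
qed

lemma br_minus_minus: "br (- y) (- z) = br y z"
proof -
  have l: "br (- y) z = - br y z" for y z
    using br_add_left[of "- y" y z] br_add_left[of 0 0 z] by (simp add: eq_neg_iff_add_eq_0)
  have "br (- y) (- z) = - br y (- z)"
    by (rule l)
  also have "\<dots> = br (- z) y"
    using br_anti[of y "- z"] by simp
  also have "\<dots> = br y z"
    using br_anti[of y z] by (simp add: l)
  finally show ?thesis .
qed



section \<open>Universal property of the enveloping algebra\<close>

context
  fixes B :: "('k, 'b, 'y) module_scheme" and f :: "'g \<Rightarrow> 'b"
  assumes B: "assoc_algebra B" and f: "\<And>y. f y \<in> carrier B"
    and f_add: "\<And>y z. f (y + z) = f y \<oplus>\<^bsub>B\<^esub> f z"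
    and f_scale: "\<And>c y. f (scale c y) = c \<odot>\<^bsub>B\<^esub> f y"
    and f_br: "\<And>y z. f y \<otimes>\<^bsub>B\<^esub> f z = f z \<otimes>\<^bsub>B\<^esub> f y \<oplus>\<^bsub>B\<^esub> f (br y z)"
begin

private lemma relations:
  assumes "r \<in> enveloping_relations scale br"
  shows "free_lift B f r = \<zero>\<^bsub>B\<^esub>"
proof -
  have vB: "vspace B"
    using B by (rule assoc_algebra_vspace)
  note L = lin_free_lift[OF B, of UNIV f]
  have [simp]: "free_lift B f (r - s) = free_lift B f r \<oplus>\<^bsub>B\<^esub> (-1) \<odot>\<^bsub>B\<^esub> free_lift B f s" for r s
    by (rule free_lift_diff[OF B]) (use f in auto)
  have [simp]: "free_lift B f (r + s) = free_lift B f r \<oplus>\<^bsub>B\<^esub> free_lift B f s" for r s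
    using lin_add[OF L, of r s] f by simp
  have [simp]: "free_lift B f (scale_pm c r) = c \<odot>\<^bsub>B\<^esub> free_lift B f r" for c r
    using lin_smult[OF L, of r c] f by simp
  have [simp]: "free_lift B f (r * s) = free_lift B f r \<otimes>\<^bsub>B\<^esub> free_lift B f s" for r s
    using alg_hom_mult[OF free_lift_hom[OF B, of UNIV f], of r s] f by simp
  have [simp]: "free_lift B f (gen y) = f y" for y
    by (rule free_lift_gen[OF B, of UNIV]) (use f in auto)
  have cancel: "(a \<oplus>\<^bsub>B\<^esub> b) \<oplus>\<^bsub>B\<^esub> (-1) \<odot>\<^bsub>B\<^esub> a \<oplus>\<^bsub>B\<^esub> (-1) \<odot>\<^bsub>B\<^esub> b = \<zero>\<^bsub>B\<^esub>"
    if "a \<in> carrier B" "b \<in> carrier B" for a b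
  proof -
    have "(a \<oplus>\<^bsub>B\<^esub> b) \<oplus>\<^bsub>B\<^esub> (-1) \<odot>\<^bsub>B\<^esub> a \<oplus>\<^bsub>B\<^esub> (-1) \<odot>\<^bsub>B\<^esub> b
      = (a \<oplus>\<^bsub>B\<^esub> (-1) \<odot>\<^bsub>B\<^esub> a) \<oplus>\<^bsub>B\<^esub> (b \<oplus>\<^bsub>B\<^esub> (-1) \<odot>\<^bsub>B\<^esub> b)"
      using that vB by (simp only: vs_assoc vs_left_comm vs_comm vs_smult vs_add)
    then show ?thesis
      using that vB by simp
  qed
  consider (add) y z where "r = gen (y + z) - (gen y + gen z)"
    | (scale) c y where "r = gen (scale c y) - scale_pm c (gen y)"
    | (br) y z where "r = gen y * gen z - gen z * gen y - gen (br y z)"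
    using assms by (auto simp: enveloping_relations_def)
  then show ?thesis
  proof cases
    case br
    then have "free_lift B f r = (f z \<otimes>\<^bsub>B\<^esub> f y \<oplus>\<^bsub>B\<^esub> f (br y z)) \<oplus>\<^bsub>B\<^esub> (-1) \<odot>\<^bsub>B\<^esub> (f z \<otimes>\<^bsub>B\<^esub> f y)
        \<oplus>\<^bsub>B\<^esub> (-1) \<odot>\<^bsub>B\<^esub> f (br y z)"
      by (simp add: f_br[of y z])
    then show ?thesis
      using cancel f B by simp
  next
    case scale
    then show ?thesis
      using f vB vs_cancel[OF vB vs_smult[OF vB f]] by (simp add: f_scale)
  qed (use f vB in \<open>simp_all add: f_add\<close>)
qed

lemma env_lift_hom: "pres_lift B f \<in> algebra_hom U B"
proof -
  have "pres_lift B f \<in> algebra_hom U0 B"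
    by (rule pres_lift_hom[OF enveloping_relations_closed B f relations])
  then show ?thesis
    by (simp add: algebra_hom_def linear_hom_def ring_hom_def U_simps)
qed

lemma env_lift_gen: "pres_lift B f (\<iota> y) = f y"
  unfolding env_gen_def
  by (rule pres_lift_gen[OF enveloping_relations_closed B f relations]) simp_all

end

lemma \<iota>_relations:
  "\<iota> (y + z) = \<iota> y \<oplus>\<^bsub>U\<^esub> \<iota> z"
  "\<iota> (scale c y) = c \<odot>\<^bsub>U\<^esub> \<iota> y"
  "\<iota> y \<otimes>\<^bsub>U\<^esub> \<iota> z = \<iota> z \<otimes>\<^bsub>U\<^esub> \<iota> y \<oplus>\<^bsub>U\<^esub> \<iota> (br y z)"
proof -
  let ?F = "free_algebra UNIV :: ('k, _) module"
  define q where "q r = (Idl\<^bsub>?F\<^esub> (enveloping_relations scale br)) +>\<^bsub>?F\<^esub> r" for r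
  have "(\<lambda>r. q r) \<in> algebra_hom ?F U"
    using pres_coset_hom[OF enveloping_relations_closed]
    unfolding q_def by (simp add: algebra_hom_def linear_hom_def ring_hom_def U_simps)
  then have q: "q \<in> algebra_hom ?F U"
    by simp
  have [simp]: "q r \<in> carrier U" for r
    using lin_closed[OF alg_hom_lin[OF q]] by simp
  have q_add: "q (r + s) = q r \<oplus>\<^bsub>U\<^esub> q s" for r s
    using lin_add[OF alg_hom_lin[OF q], of r s] by simp
  have q_scale: "q (scale_pm c r) = c \<odot>\<^bsub>U\<^esub> q r" for c r
    using lin_smult[OF alg_hom_lin[OF q], of r c] by simp
  have q_mult: "q (r * s) = q r \<otimes>\<^bsub>U\<^esub> q s" for r s
    using alg_hom_mult[OF q, of r s] by simp
  have q_diff: "q (r - s) = q r \<oplus>\<^bsub>U\<^esub> (-1) \<odot>\<^bsub>U\<^esub> q s" for r s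
    using q_add[of r "scale_pm (-1) s"] by (simp add: q_scale scale_pm_minus)
  have eq: "q r = q s" if "r - s \<in> enveloping_relations scale br" for r s
  proof -
    have z: "q (r - s) = \<zero>\<^bsub>U\<^esub>"
      using pres_relation[OF enveloping_relations_closed that] by (simp add: q_def U_simps)
    show ?thesis
      by (rule vs_eqI[OF vspace_U]) (use z in \<open>simp_all add: q_diff\<close>)
  qed
  have gen: "\<iota> y = q (gen y)" for y
    by (simp add: env_gen_def pres_gen_def q_def)
  show "\<iota> (y + z) = \<iota> y \<oplus>\<^bsub>U\<^esub> \<iota> z"
    unfolding gen q_add[symmetric] by (rule eq) (auto simp: enveloping_relations_def)
  show "\<iota> (scale c y) = c \<odot>\<^bsub>U\<^esub> \<iota> y"
    unfolding gen q_scale[symmetric] by (rule eq) (auto simp: enveloping_relations_def)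
  show "\<iota> y \<otimes>\<^bsub>U\<^esub> \<iota> z = \<iota> z \<otimes>\<^bsub>U\<^esub> \<iota> y \<oplus>\<^bsub>U\<^esub> \<iota> (br y z)"
    unfolding gen q_add[symmetric] q_mult[symmetric]
    by (rule eq) (auto simp: enveloping_relations_def diff_diff_eq[symmetric])
qed

lemma \<iota>_minus: "\<iota> (- y) = (-1) \<odot>\<^bsub>U\<^esub> \<iota> y"
  using \<iota>_relations(2)[of "-1" y] by simp

text \<open>The presentation has every element of the Lie algebra as a generator, whereas inductions
  should meet only basis elements. In the applications f is multiplication by fixed elements on the
  left, on the right or on both sides.\<close>

lemma U_induct_aux:
  assumes one: "P \<one>\<^bsub>U\<^esub>"
    and add: "\<And>a b. a \<in> carrier U \<Longrightarrow> b \<in> carrier U \<Longrightarrow> P a \<Longrightarrow> P b \<Longrightarrow> P (a \<oplus>\<^bsub>U\<^esub> b)"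
    and smult: "\<And>c a. a \<in> carrier U \<Longrightarrow> P a \<Longrightarrow> P (c \<odot>\<^bsub>U\<^esub> a)"
    and f: "f \<in> linear_hom U U" and gen: "\<And>i. P (f (xh i))"
  shows "P (f (\<iota> y))"
proof -
  have "y \<in> span (range x)"
    using basis by (simp add: is_basis_def)
  then show ?thesis
  proof (induction y rule: span_induct_alt)
    case base
    \<comment> \<open>The empty combination is reached through \<open>one\<close>, as the multiple
      of 1 by the scalar 0.\<close>
    have "f (\<iota> 0) = 0 \<odot>\<^bsub>U\<^esub> f (\<iota> 0)"
      using \<iota>_relations(2)[of 0 0] lin_smult[OF f, of "\<iota> 0" 0] by simp
    also have "\<dots> = 0 \<odot>\<^bsub>U\<^esub> \<one>\<^bsub>U\<^esub>"
      using lin_closed[OF f, of "\<iota> 0"] by simp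
    finally show ?case
      using smult[OF _ one, of 0] by simp
  next
    case (step c z y)
    then obtain i where "z = x i"
      by auto
    then show ?case
      using add[OF _ _ smult[OF _ gen] step.IH] lin_closed[OF f]
      by (simp add: \<iota>_relations(1,2) lin_add[OF f] lin_smult[OF f])
  qed
qed

lemma U_induct [consumes 1, case_names one add smult gen]:
  assumes a: "a \<in> carrier U" and one: "P \<one>\<^bsub>U\<^esub>"
    and add: "\<And>a b. a \<in> carrier U \<Longrightarrow> b \<in> carrier U \<Longrightarrow> P a \<Longrightarrow> P b \<Longrightarrow> P (a \<oplus>\<^bsub>U\<^esub> b)"
    and smult: "\<And>c a. a \<in> carrier U \<Longrightarrow> P a \<Longrightarrow> P (c \<odot>\<^bsub>U\<^esub> a)"
    and gen: "\<And>i a. a \<in> carrier U \<Longrightarrow> P a \<Longrightarrow> P (xh i \<otimes>\<^bsub>U\<^esub> a)"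
  shows "P a"
  using a unfolding U_simps
proof (rule presented_algebra_induct[OF enveloping_relations_closed, where P = P])
  fix y a assume "a \<in> carrier U0" "P a"
  then have a: "a \<in> carrier U" "P a"
    by (simp_all add: U_simps)
  have "P (\<iota> y \<otimes>\<^bsub>U\<^esub> a)"
    by (rule U_induct_aux[where P = P and f = "\<lambda>v. v \<otimes>\<^bsub>U\<^esub> a"], fact one, erule (3) add, erule (1) smult,
        rule alg_lin_left[OF assoc_algebra_U a(1)], rule gen[OF a])
  then show "P (pres_gen UNIV (enveloping_relations scale br) y \<otimes>\<^bsub>U0\<^esub> a)"
    by (simp add: env_gen_def U_simps)
qed (use one add smult in \<open>simp_all add: U_simps\<close>)

lemma U_induct_right [consumes 1, case_names one add smult gen]:
  assumes a: "a \<in> carrier U" and one: "P \<one>\<^bsub>U\<^esub>"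
    and add: "\<And>a b. a \<in> carrier U \<Longrightarrow> b \<in> carrier U \<Longrightarrow> P a \<Longrightarrow> P b \<Longrightarrow> P (a \<oplus>\<^bsub>U\<^esub> b)"
    and smult: "\<And>c a. a \<in> carrier U \<Longrightarrow> P a \<Longrightarrow> P (c \<odot>\<^bsub>U\<^esub> a)"
    and gen: "\<And>i a. a \<in> carrier U \<Longrightarrow> P a \<Longrightarrow> P (a \<otimes>\<^bsub>U\<^esub> xh i)"
  shows "P a"
  using a unfolding U_simps
proof (rule presented_algebra_induct_right[OF enveloping_relations_closed, where P = P])
  fix y a assume "a \<in> carrier U0" "P a"
  then have a: "a \<in> carrier U" "P a"
    by (simp_all add: U_simps)
  have "P (a \<otimes>\<^bsub>U\<^esub> \<iota> y)"
    by (rule U_induct_aux[where P = P and f = "\<lambda>v. a \<otimes>\<^bsub>U\<^esub> v"], fact one, erule (3) add, erule (1) smult,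
        rule alg_lin_right[OF assoc_algebra_U a(1)], rule gen[OF a])
  then show "P (a \<otimes>\<^bsub>U0\<^esub> pres_gen UNIV (enveloping_relations scale br) y)"
    by (simp add: env_gen_def U_simps)
qed (use one add smult in \<open>simp_all add: U_simps\<close>)

subsection \<open>The Hopf structure\<close>

abbreviation tens (infixl "\<otimes>\<otimes>" 75) where "a \<otimes>\<otimes> b \<equiv> tensor U U a b"

abbreviation \<Delta> where "\<Delta> \<equiv> comult U"
abbreviation \<epsilon> where "\<epsilon> \<equiv> counit U"
abbreviation S where "S \<equiv> antipode U"

lemma assoc_algebra_UU [simp]: "assoc_algebra UU"
  by (rule assoc_algebra_tensor_algebra) simp_all

lemma vspace_UU [simp]: "vspace UU" "vspace (tensor_space U U)"
  by (simp_all add: assoc_algebra_vspace vspace_tensor_space)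

lemma tens_closed [simp]: "a \<in> carrier U \<Longrightarrow> b \<in> carrier U \<Longrightarrow> a \<otimes>\<otimes> b \<in> carrier (tensor_space U U)"
  by (rule tensor_closed) simp_all

lemma tens_mult [simp]: "a \<in> carrier U \<Longrightarrow> b \<in> carrier U \<Longrightarrow> c \<in> carrier U \<Longrightarrow> d \<in> carrier U \<Longrightarrow>
    (a \<otimes>\<otimes> b) \<otimes>\<^bsub>UU\<^esub> (c \<otimes>\<otimes> d) = (a \<otimes>\<^bsub>U\<^esub> c) \<otimes>\<otimes> (b \<otimes>\<^bsub>U\<^esub> d)"
  by (rule tensor_algebra_mult_tensor) simp_all

lemma bilin_tens: "bilin U U (tensor_space U U) (tensor U U)"
  by (rule bilin_tensor) simp_all

lemmas tens_add_left = lin_add[OF bilin_left[OF bilin_tens]]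
  and tens_smult_left = lin_smult[OF bilin_left[OF bilin_tens]]
  and tens_add_right = lin_add[OF bilin_right[OF bilin_tens]]
  and tens_smult_right = lin_smult[OF bilin_right[OF bilin_tens]]

definition primitive :: "'g \<Rightarrow> _" where
  "primitive y = \<iota> y \<otimes>\<otimes> \<one>\<^bsub>U\<^esub> \<oplus>\<^bsub>UU\<^esub> \<one>\<^bsub>U\<^esub> \<otimes>\<otimes> \<iota> y"

lemma primitive_closed [simp]: "primitive y \<in> carrier (tensor_space U U)"
  using vs_add[OF vspace_UU(1)] by (simp add: primitive_def)

text \<open>The mixed terms, with y in one factor and z in the other, are symmetric in y and z and
  cancel in the commutator. This is the relation that makes the coproduct well defined.\<close>

lemma primitive_bracket:
  "primitive y \<otimes>\<^bsub>UU\<^esub> primitive z = primitive z \<otimes>\<^bsub>UU\<^esub> primitive y \<oplus>\<^bsub>UU\<^esub> primitive (br y z)"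
proof -
  have expand: "primitive y \<otimes>\<^bsub>UU\<^esub> primitive z = (\<iota> y \<otimes>\<^bsub>U\<^esub> \<iota> z) \<otimes>\<otimes> \<one>\<^bsub>U\<^esub> \<oplus>\<^bsub>UU\<^esub> (\<iota> y \<otimes>\<otimes> \<iota> z \<oplus>\<^bsub>UU\<^esub>
      (\<iota> z \<otimes>\<otimes> \<iota> y \<oplus>\<^bsub>UU\<^esub> \<one>\<^bsub>U\<^esub> \<otimes>\<otimes> (\<iota> y \<otimes>\<^bsub>U\<^esub> \<iota> z)))" for y z
    using lin_add[OF alg_lin_left[OF assoc_algebra_UU, of "primitive z"], of "\<iota> y \<otimes>\<otimes> \<one>\<^bsub>U\<^esub>" "\<one>\<^bsub>U\<^esub> \<otimes>\<otimes> \<iota> y"]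
      lin_add[OF alg_lin_right[OF assoc_algebra_UU, of "\<iota> y \<otimes>\<otimes> \<one>\<^bsub>U\<^esub>"], of "\<iota> z \<otimes>\<otimes> \<one>\<^bsub>U\<^esub>" "\<one>\<^bsub>U\<^esub> \<otimes>\<otimes> \<iota> z"]
      lin_add[OF alg_lin_right[OF assoc_algebra_UU, of "\<one>\<^bsub>U\<^esub> \<otimes>\<otimes> \<iota> y"], of "\<iota> z \<otimes>\<otimes> \<one>\<^bsub>U\<^esub>" "\<one>\<^bsub>U\<^esub> \<otimes>\<otimes> \<iota> z"]
      vs_add[OF vspace_UU(2)]
    by (simp add: primitive_def[of z] primitive_def[of y] vs_assoc[OF vspace_UU(2)])
  have ac: "(p \<oplus>\<^bsub>V\<^esub> t) \<oplus>\<^bsub>V\<^esub> (q \<oplus>\<^bsub>V\<^esub> (r \<oplus>\<^bsub>V\<^esub> (s \<oplus>\<^bsub>V\<^esub> w))) = (p \<oplus>\<^bsub>V\<^esub> (r \<oplus>\<^bsub>V\<^esub> (q \<oplus>\<^bsub>V\<^esub> s))) \<oplus>\<^bsub>V\<^esub> (t \<oplus>\<^bsub>V\<^esub> w)"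
    if "vspace V" "p \<in> carrier V" "q \<in> carrier V" "r \<in> carrier V" "s \<in> carrier V" "t \<in> carrier V" "w \<in> carrier V"
    for p q r s t w and V :: "('k, 'c, 'z) module_scheme"
    using that by (simp only: vs_assoc vs_comm vs_left_comm vs_add)
  have "primitive y \<otimes>\<^bsub>UU\<^esub> primitive z = ((\<iota> z \<otimes>\<^bsub>U\<^esub> \<iota> y) \<otimes>\<otimes> \<one>\<^bsub>U\<^esub> \<oplus>\<^bsub>tensor_space U U\<^esub> \<iota> (br y z) \<otimes>\<otimes> \<one>\<^bsub>U\<^esub>)
      \<oplus>\<^bsub>tensor_space U U\<^esub> (\<iota> y \<otimes>\<otimes> \<iota> z \<oplus>\<^bsub>tensor_space U U\<^esub> (\<iota> z \<otimes>\<otimes> \<iota> y \<oplus>\<^bsub>tensor_space U U\<^esub>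
      (\<one>\<^bsub>U\<^esub> \<otimes>\<otimes> (\<iota> z \<otimes>\<^bsub>U\<^esub> \<iota> y) \<oplus>\<^bsub>tensor_space U U\<^esub> \<one>\<^bsub>U\<^esub> \<otimes>\<otimes> \<iota> (br y z))))"
    unfolding expand[of y z] \<iota>_relations(3)[of y z] by (simp add: tens_add_left tens_add_right)
  also have "\<dots> = primitive z \<otimes>\<^bsub>UU\<^esub> primitive y \<oplus>\<^bsub>UU\<^esub> primitive (br y z)"
    unfolding expand[of z y] by (subst ac) (simp_all add: primitive_def)
  finally show ?thesis .
qed

lemma comult_hom: "\<Delta> \<in> algebra_hom U UU"
  and comult_gen: "\<Delta> (\<iota> y) = primitive y"
proof -
  have eq: "\<Delta> = pres_lift UU primitive"
  proof -
    have 1: "tensor_algebra U0 U0 = UU" "tensor U0 U0 = tensor U U"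
      by (rule tensor_algebra_cong tensor_space_cong; simp add: U_simps)+
    have "\<Delta> = pres_lift (tensor_algebra U0 U0) (\<lambda>y. tensor U0 U0 (\<iota> y) \<one>\<^bsub>U0\<^esub>
        \<oplus>\<^bsub>tensor_algebra U0 U0\<^esub> tensor U0 U0 \<one>\<^bsub>U0\<^esub> (\<iota> y))"
      by (simp add: enveloping_algebra_def Let_def)
    then show ?thesis
      by (simp only: 1 primitive_def[abs_def] U_simps(3)[symmetric])
  qed
  have p: "primitive y \<in> carrier UU" for y
    by simp
  have add: "primitive (y + z) = primitive y \<oplus>\<^bsub>UU\<^esub> primitive z" for y z
    by (simp add: primitive_def \<iota>_relations tens_add_left tens_add_right vs_assoc[OF vspace_UU(2)]
        vs_left_comm[OF vspace_UU(2)])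
  have scale: "primitive (scale c y) = c \<odot>\<^bsub>UU\<^esub> primitive y" for c y
    by (simp add: primitive_def \<iota>_relations tens_smult_left tens_smult_right vs_smult_add[OF vspace_UU(2)])
  note lift = env_lift_hom[OF assoc_algebra_UU p add scale primitive_bracket]
    env_lift_gen[OF assoc_algebra_UU p add scale primitive_bracket]
  show "\<Delta> \<in> algebra_hom U UU" "\<Delta> (\<iota> y) = primitive y"
    unfolding eq by (fact lift(1), fact lift(2))
qed

lemma assoc_algebra_scalars: "assoc_algebra (scalars :: ('a::field, 'a) module)"
  by (rule assoc_algebraI)
    (auto simp: vspace_scalars algebra_simps intro!: bilinI linear_homI)

lemma counit_hom: "\<epsilon> \<in> algebra_hom U scalars"
  and counit_gen: "\<epsilon> (\<iota> y) = 0"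
proof -
  have eq: "\<epsilon> = pres_lift scalars (\<lambda>_. 0)"
    by (simp add: enveloping_algebra_def Let_def)
  show "\<epsilon> \<in> algebra_hom U scalars" "\<epsilon> (\<iota> y) = 0"
    unfolding eq
    using env_lift_hom[OF assoc_algebra_scalars, of "\<lambda>_. 0"] env_lift_gen[OF assoc_algebra_scalars, of "\<lambda>_. 0"]
    by simp_all
qed

text \<open>Negation satisfies the defining relations in the opposite algebra because [-z, -y] =
  [z, y] = -[y, z].\<close>

lemma antipode_hom: "S \<in> algebra_hom U (opposite U)"
  and antipode_gen: "S (\<iota> y) = \<iota> (- y)"
proof -
  have eq: "S = pres_lift (opposite U) (\<lambda>y. \<iota> (- y))"
  proof -
    have "S = pres_lift (opposite U0) (\<lambda>y. \<iota> (- y))"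
      by (simp add: enveloping_algebra_def Let_def)
    also have "\<dots> = pres_lift (opposite U) (\<lambda>y. \<iota> (- y))"
      \<comment> \<open>The opposites of \<open>U\<close> and of \<open>U0\<close> are records of
        different types with equal fields, so the sums have to be unfolded down to those
        fields.\<close>
      unfolding pres_lift_def[abs_def] finsum_def finprod_def by (simp add: opposite_def U_simps)
    finally show ?thesis .
  qed
  have add: "\<iota> (- (y + z)) = \<iota> (- y) \<oplus>\<^bsub>opposite U\<^esub> \<iota> (- z)" for y z
    using \<iota>_relations(1)[of "- y" "- z"] by (simp add: opposite_def)
  have scale: "\<iota> (- scale c y) = c \<odot>\<^bsub>opposite U\<^esub> \<iota> (- y)" for c y
    using \<iota>_relations(2)[of c "- y"] by (simp add: opposite_def)
  have br: "\<iota> (- y) \<otimes>\<^bsub>opposite U\<^esub> \<iota> (- z) =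
      \<iota> (- z) \<otimes>\<^bsub>opposite U\<^esub> \<iota> (- y) \<oplus>\<^bsub>opposite U\<^esub> \<iota> (- br y z)" for y z
    using \<iota>_relations(3)[of "- z" "- y"] br_anti[of y z] by (simp add: opposite_def br_minus_minus)
  have c: "\<iota> (- y) \<in> carrier (opposite U)" for y
    by (simp add: opposite_def)
  note op = assoc_algebra_opposite[OF assoc_algebra_U]
  show "S \<in> algebra_hom U (opposite U)" "S (\<iota> y) = \<iota> (- y)"
    unfolding eq by (fact env_lift_hom[OF op c add scale br], fact env_lift_gen[OF op c add scale br])
qed

lemma antipode_lin: "S \<in> linear_hom U U"
  using alg_hom_lin[OF antipode_hom] by (simp add: linear_hom_def opposite_def)

lemma antipode_closed [simp]: "a \<in> carrier U \<Longrightarrow> S a \<in> carrier U"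
  using antipode_lin by blast

lemma antipode_mult: "a \<in> carrier U \<Longrightarrow> b \<in> carrier U \<Longrightarrow> S (a \<otimes>\<^bsub>U\<^esub> b) = S b \<otimes>\<^bsub>U\<^esub> S a"
  using alg_hom_mult[OF antipode_hom, of a b] by (simp add: opposite_def)

lemma antipode_one [simp]: "S \<one>\<^bsub>U\<^esub> = \<one>\<^bsub>U\<^esub>"
  using alg_hom_one[OF antipode_hom] by (simp add: opposite_def)

lemma counit_lin: "\<epsilon> \<in> linear_hom U scalars"
  using counit_hom by (rule alg_hom_lin)

lemma counit_mult: "a \<in> carrier U \<Longrightarrow> b \<in> carrier U \<Longrightarrow> \<epsilon> (a \<otimes>\<^bsub>U\<^esub> b) = \<epsilon> a * \<epsilon> b"
  using alg_hom_mult[OF counit_hom, of a b] by simp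

lemma counit_one [simp]: "\<epsilon> \<one>\<^bsub>U\<^esub> = 1"
  using alg_hom_one[OF counit_hom] by simp

lemma comult_lin: "\<Delta> \<in> linear_hom U (tensor_space U U)"
  using alg_hom_lin[OF comult_hom] by (simp add: linear_hom_def)

lemma comult_closed [simp]: "a \<in> carrier U \<Longrightarrow> \<Delta> a \<in> carrier (tensor_space U U)"
  using comult_lin by blast

lemma comult_mult: "a \<in> carrier U \<Longrightarrow> b \<in> carrier U \<Longrightarrow> \<Delta> (a \<otimes>\<^bsub>U\<^esub> b) = \<Delta> a \<otimes>\<^bsub>UU\<^esub> \<Delta> b"
  by (rule alg_hom_mult[OF comult_hom])

lemma comult_one [simp]: "\<Delta> \<one>\<^bsub>U\<^esub> = \<one>\<^bsub>U\<^esub> \<otimes>\<otimes> \<one>\<^bsub>U\<^esub>"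
  using alg_hom_one[OF comult_hom] by simp

end

section \<open>The pairing and its dual basis\<close>

text \<open>That \<phi>_i^j equals the Kronecker delta up to O(\<partial>) is a statement about
  constant terms and is recorded in this form; the series themselves reappear as
  \<open>phim\<close>.\<close>

locale leading_delta_action = based_lie_algebra scale br x
  for scale :: "'k::field_char_0 \<Rightarrow> 'g::ab_group_add \<Rightarrow> 'g"
    and br :: "'g \<Rightarrow> 'g \<Rightarrow> 'g"
    and x :: "'n::finite \<Rightarrow> 'g" +
  fixes \<phi> :: "('g free_monoid \<Rightarrow>\<^sub>0 'k) set \<Rightarrow> ('n, 'k) mvps \<Rightarrow> ('n, 'k) mvps"
  assumes action: "left_hopf_action U mvps_algebra \<phi>"
    and leading: "const_term (\<phi> (\<ominus>\<^bsub>U\<^esub> xh i) (mvps_var j)) = (if i = j then 1 else 0)"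
begin

text \<open>Composition with the antipode turns the left action into a right action in which
  \<open>\<iota> y\<close> acts by the derivation D_y. The antipode thereby disappears from the
  formulas for the pairing and for the smash product.\<close>

definition \<psi> :: "('g free_monoid \<Rightarrow>\<^sub>0 'k) set \<Rightarrow> ('n, 'k) mvps \<Rightarrow> ('n, 'k) mvps" where
  "\<psi> a P = \<phi> (S a) P"

definition pr :: "('g free_monoid \<Rightarrow>\<^sub>0 'k) set \<Rightarrow> ('n, 'k) mvps \<Rightarrow> 'k" where
  "pr a P = const_term (\<psi> a P)"

lemma deformed_pairing_eq: "deformed_pairing U \<phi> = pr"
  by (simp add: fun_eq_iff deformed_pairing_def pr_def \<psi>_def)

lemma \<phi>_lin: "a \<in> carrier U \<Longrightarrow> \<phi> a \<in> linear_hom mvps_algebra mvps_algebra"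
  and \<phi>_lin_left: "(\<lambda>a. \<phi> a P) \<in> linear_hom U mvps_algebra"
  and \<phi>_mult: "a \<in> carrier U \<Longrightarrow> b \<in> carrier U \<Longrightarrow> \<phi> (a \<otimes>\<^bsub>U\<^esub> b) P = \<phi> a (\<phi> b P)"
  and \<phi>_one: "\<phi> \<one>\<^bsub>U\<^esub> P = P"
  and \<phi>_times: "a \<in> carrier U \<Longrightarrow>
    \<phi> a (P * Q) = tensor_lift mvps_algebra (\<lambda>b c. \<phi> b P * \<phi> c Q) (\<Delta> a)"
  using action by (simp_all add: left_hopf_action_def)

lemma \<psi>_lin: "a \<in> carrier U \<Longrightarrow> \<psi> a \<in> linear_hom mvps_algebra mvps_algebra"
  using \<phi>_lin[of "S a"] by (simp add: \<psi>_def[abs_def])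

lemma \<psi>_lin_left: "(\<lambda>a. \<psi> a P) \<in> linear_hom U mvps_algebra"
  unfolding \<psi>_def by (rule lin_comp[OF antipode_lin \<phi>_lin_left])

lemma \<psi>_mult: "a \<in> carrier U \<Longrightarrow> b \<in> carrier U \<Longrightarrow> \<psi> (a \<otimes>\<^bsub>U\<^esub> b) P = \<psi> b (\<psi> a P)"
  by (simp add: \<psi>_def antipode_mult \<phi>_mult)

lemma \<psi>_one [simp]: "\<psi> \<one>\<^bsub>U\<^esub> P = P"
  by (simp add: \<psi>_def \<phi>_one)

lemma bilin_mvps_product:
  assumes "f \<in> linear_hom U mvps_algebra" "g \<in> linear_hom U mvps_algebra"
  shows "bilin U U mvps_algebra (\<lambda>a b. f a * g b :: ('n, 'k) mvps)"
  using lin_add[OF assms(1)] lin_add[OF assms(2)] lin_smult[OF assms(1)] lin_smult[OF assms(2)]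
  by (intro bilinI linear_homI) (simp_all add: distrib_left distrib_right mvps_scale_mult)

lemma tensor_lift_primitive:
  assumes Z: "vspace Z" and f: "bilin U U Z f"
  shows "tensor_lift Z f (primitive y) = f (\<iota> y) \<one>\<^bsub>U\<^esub> \<oplus>\<^bsub>Z\<^esub> f \<one>\<^bsub>U\<^esub> (\<iota> y)"
  using tensor_lift_tensor[OF vspace_U vspace_U Z f]
  by (simp add: primitive_def lin_add[OF lin_tensor_lift[OF vspace_U vspace_U Z f]])

text \<open>The element S (\<open>\<iota> y\<close>) is again primitive, so the module algebra law
  for it has just two terms.\<close>

lemma \<psi>_derivation: "mvps_derivation (\<psi> (\<iota> y))"
proof -
  have "\<psi> (\<iota> y) (P * Q) = \<psi> (\<iota> y) P * Q + P * \<psi> (\<iota> y) Q" for P Q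
    using tensor_lift_primitive[OF vspace_mvps bilin_mvps_product[OF \<phi>_lin_left \<phi>_lin_left], of P Q "- y"]
    by (simp add: \<psi>_def antipode_gen \<phi>_times comult_gen \<phi>_one)
  then show ?thesis
    using lin_add[OF \<psi>_lin[OF \<iota>_closed]] lin_smult[OF \<psi>_lin[OF \<iota>_closed]]
    by (simp add: mvps_derivation_def)
qed

lemma \<psi>_leading: "const_term (\<psi> (xh i) (mvps_var l)) = (if l = i then 1 else 0)"
  using leading[of i l] by (auto simp: \<psi>_def antipode_gen \<iota>_minus vs_uminus)

lemma pr_lin_left: "(\<lambda>a. pr a P) \<in> linear_hom U scalars"
  unfolding pr_def by (rule lin_comp[OF \<psi>_lin_left]) (rule linear_homI, simp_all)

lemma pr_add_left: "a \<in> carrier U \<Longrightarrow> b \<in> carrier U \<Longrightarrow> pr (a \<oplus>\<^bsub>U\<^esub> b) P = pr a P + pr b P"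
  using lin_add[OF pr_lin_left] by simp

lemma pr_smult_left: "a \<in> carrier U \<Longrightarrow> pr (c \<odot>\<^bsub>U\<^esub> a) P = c * pr a P"
  using lin_smult[OF pr_lin_left] by simp

lemma pr_finsum_left: "(\<And>i. i \<in> I \<Longrightarrow> f i \<in> carrier U) \<Longrightarrow> pr (finsum U f I) P = (\<Sum>i\<in>I. pr (f i) P)"
  using lin_finsum[OF vspace_U vspace_scalars pr_lin_left, of I f P] by simp

lemma pr_mult: "a \<in> carrier U \<Longrightarrow> b \<in> carrier U \<Longrightarrow> pr (a \<otimes>\<^bsub>U\<^esub> b) P = pr b (\<psi> a P)"
  by (simp add: pr_def \<psi>_mult)

lemma pr_one [simp]: "pr \<one>\<^bsub>U\<^esub> P = const_term P"
  by (simp add: pr_def)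

text \<open>Multiplying a by a generator on the left precomposes the functional with a derivation,
  and derivations are continuous.\<close>

lemma pr_continuous: "a \<in> carrier U \<Longrightarrow> continuous_functional (pr a)"
proof (induction a rule: U_induct)
  case one
  then show ?case
    using continuous_functional_coeff[of "\<lambda>_. 0"] by (simp add: const_term_def[abs_def] pr_one[abs_def])
next
  case (add a b)
  then have "pr (a \<oplus>\<^bsub>U\<^esub> b) = (\<lambda>P. pr a P + pr b P)"
    by (intro ext pr_add_left)
  then show ?case
    using add by (simp add: continuous_functional_add)
next
  case (smult c a)
  then have "pr (c \<odot>\<^bsub>U\<^esub> a) = (\<lambda>P. c * pr a P)"
    by (intro ext pr_smult_left)
  then show ?case
    using smult by (simp add: continuous_functional_scale)
next
  case (gen i a)
  then have "pr (xh i \<otimes>\<^bsub>U\<^esub> a) = (\<lambda>P. pr a (\<psi> (xh i) P))"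
    by (intro ext pr_mult) simp_all
  then show ?case
    using continuous_functional_comp[OF gen(2) continuous_linear_derivation[OF \<psi>_derivation]] by simp
qed

lemmas pr_right = continuous_functionalD[OF pr_continuous]

lemma pr_unit: "a \<in> carrier U \<Longrightarrow> pr a 1 = \<epsilon> a"
proof (induction a rule: U_induct)
  case (gen i a)
  then show ?case
    by (simp add: pr_mult derivation_one[OF \<psi>_derivation] pr_right counit_mult counit_gen)
qed (simp_all add: pr_add_left pr_smult_left lin_add[OF counit_lin] lin_smult[OF counit_lin])

lemma bilin_scalar_product:
  assumes "f \<in> linear_hom U scalars" "g \<in> linear_hom U scalars"
  shows "bilin U U scalars (\<lambda>a b. f a * g b)"
  using lin_add[OF assms(1)] lin_add[OF assms(2)] lin_smult[OF assms(1)] lin_smult[OF assms(2)]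
  by (intro bilinI linear_homI) (simp_all add: algebra_simps)

text \<open>The pairing of the tensor square of U with P \<otimes> Q; with monomials for P and Q it
  separates the elements of the tensor square.\<close>

definition pr2 :: "('n, 'k) mvps \<Rightarrow> ('n, 'k) mvps \<Rightarrow> _ \<Rightarrow> 'k" where
  "pr2 P Q = tensor_lift scalars (\<lambda>a b. pr a P * pr b Q)"

lemma pr2_lin: "pr2 P Q \<in> linear_hom (tensor_space U U) scalars"
  unfolding pr2_def
  using lin_tensor_lift[OF vspace_U vspace_U vspace_scalars bilin_scalar_product[OF pr_lin_left pr_lin_left]] .

lemma pr2_tens: "a \<in> carrier U \<Longrightarrow> b \<in> carrier U \<Longrightarrow> pr2 P Q (a \<otimes>\<otimes> b) = pr a P * pr b Q"
  unfolding pr2_def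
  by (rule tensor_lift_tensor[OF vspace_U vspace_U vspace_scalars bilin_scalar_product[OF pr_lin_left pr_lin_left]])

lemma UU_lin_right: "X \<in> carrier (tensor_space U U) \<Longrightarrow>
    (\<lambda>Y. X \<otimes>\<^bsub>UU\<^esub> Y) \<in> linear_hom (tensor_space U U) (tensor_space U U)"
  using alg_lin_right[OF assoc_algebra_UU, of X] by (simp add: linear_hom_def)

lemma UU_lin_left: "X \<in> carrier (tensor_space U U) \<Longrightarrow>
    (\<lambda>Y. Y \<otimes>\<^bsub>UU\<^esub> X) \<in> linear_hom (tensor_space U U) (tensor_space U U)"
  using alg_lin_left[OF assoc_algebra_UU, of X] by (simp add: linear_hom_def)

lemma UU_closed [simp]: "X \<in> carrier (tensor_space U U) \<Longrightarrow> Y \<in> carrier (tensor_space U U) \<Longrightarrow>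
    X \<otimes>\<^bsub>UU\<^esub> Y \<in> carrier (tensor_space U U)"
  using alg_mult[OF assoc_algebra_UU] by simp

lemma primitive_mult_tens:
  assumes "a \<in> carrier U" "b \<in> carrier U"
  shows "primitive y \<otimes>\<^bsub>UU\<^esub> (a \<otimes>\<otimes> b) = (\<iota> y \<otimes>\<^bsub>U\<^esub> a) \<otimes>\<otimes> b \<oplus>\<^bsub>tensor_space U U\<^esub> a \<otimes>\<otimes> (\<iota> y \<otimes>\<^bsub>U\<^esub> b)"
    and "(a \<otimes>\<otimes> b) \<otimes>\<^bsub>UU\<^esub> primitive y = (a \<otimes>\<^bsub>U\<^esub> \<iota> y) \<otimes>\<otimes> b \<oplus>\<^bsub>tensor_space U U\<^esub> a \<otimes>\<otimes> (b \<otimes>\<^bsub>U\<^esub> \<iota> y)"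
  using lin_add[OF UU_lin_left[of "a \<otimes>\<otimes> b"], of "\<iota> y \<otimes>\<otimes> \<one>\<^bsub>U\<^esub>" "\<one>\<^bsub>U\<^esub> \<otimes>\<otimes> \<iota> y"]
    lin_add[OF UU_lin_right[of "a \<otimes>\<otimes> b"], of "\<iota> y \<otimes>\<otimes> \<one>\<^bsub>U\<^esub>" "\<one>\<^bsub>U\<^esub> \<otimes>\<otimes> \<iota> y"] assms
  by (simp_all add: primitive_def)

lemma bilin_\<psi>_product: "bilin U U mvps_algebra (\<lambda>a b. \<psi> a P * \<psi> b Q)"
  by (rule bilin_mvps_product[OF \<psi>_lin_left \<psi>_lin_left])

text \<open>Obtained by induction from the derivation property of the generators, which bypasses a
  formula for the coproduct of S a.\<close>

lemma \<psi>_times: "a \<in> carrier U \<Longrightarrow> tensor_lift mvps_algebra (\<lambda>a b. \<psi> a P * \<psi> b Q) (\<Delta> a) = \<psi> a (P * Q)"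
proof (induction a arbitrary: P Q rule: U_induct)
  let ?L = "\<lambda>P Q. tensor_lift mvps_algebra (\<lambda>a b. \<psi> a P * \<psi> b Q)"
  note lin = lin_tensor_lift[OF vspace_U vspace_U vspace_mvps bilin_\<psi>_product]
    and tens = tensor_lift_tensor[OF vspace_U vspace_U vspace_mvps bilin_\<psi>_product]
  {
    case one
    then show ?case
      by (simp add: tens)
  next
    case (add a b)
    then show ?case
      by (simp add: lin_add[OF comult_lin] lin_add[OF lin] lin_add[OF \<psi>_lin_left])
  next
    case (smult c a)
    then show ?case
      by (simp add: lin_smult[OF comult_lin] lin_smult[OF lin] lin_smult[OF \<psi>_lin_left])
  next
    case (gen i a)
    have "?L P Q (primitive y \<otimes>\<^bsub>UU\<^esub> Y) = ?L (\<psi> (\<iota> y) P) Q Y + ?L P (\<psi> (\<iota> y) Q) Y"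
      if Y: "Y \<in> carrier (tensor_space U U)" for P Q y Y
      using tensor_hom_eqI[OF vspace_U vspace_U vspace_mvps
          lin_comp[OF UU_lin_right[OF primitive_closed[of y]] lin[of P Q]]
          lin_plus[OF vspace_mvps lin[of "\<psi> (\<iota> y) P" Q] lin[of P "\<psi> (\<iota> y) Q"]] _ Y]
      by (simp add: primitive_mult_tens lin_add[OF lin] tens \<psi>_mult)
    then have "?L P Q (\<Delta> (xh i \<otimes>\<^bsub>U\<^esub> a)) = \<psi> a (\<psi> (xh i) P * Q) + \<psi> a (P * \<psi> (xh i) Q)"
      using gen by (simp add: comult_mult comult_gen)
    also have "\<dots> = \<psi> a (\<psi> (xh i) (P * Q))"
      using \<psi>_derivation[of "x i"] lin_add[OF \<psi>_lin[OF gen(1)]] by (simp add: mvps_derivation_def)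
    finally show ?case
      using gen by (simp add: \<psi>_mult)
  }
qed

lemma pr_times:
  assumes "a \<in> carrier U"
  shows "pr2 P Q (\<Delta> a) = pr a (P * Q)"
proof -
  have "const_term (tensor_lift mvps_algebra (\<lambda>a b. \<psi> a P * \<psi> b Q) (\<Delta> a)) = pr2 P Q (\<Delta> a)"
    unfolding pr2_def pr_def using assms
    by (subst lin_tensor_lift_comp[OF vspace_U vspace_U vspace_mvps vspace_scalars bilin_\<psi>_product, where h = const_term])
      (auto intro: linear_homI)
  then show ?thesis
    using assms by (simp add: \<psi>_times pr_def)
qed

subsection \<open>Words\<close>

primrec word :: "'n list \<Rightarrow> ('g free_monoid \<Rightarrow>\<^sub>0 'k) set" where
  "word [] = \<one>\<^bsub>U\<^esub>"
| "word (i # w) = xh i \<otimes>\<^bsub>U\<^esub> word w"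

lemma word_closed [simp]: "word w \<in> carrier U"
  by (induction w) simp_all

lemma word_append: "word (v @ w) = word v \<otimes>\<^bsub>U\<^esub> word w"
  by (induction v) (simp_all add: alg_assoc)

lemma sum_count_list: "(\<Sum>j\<in>UNIV. count_list w (j :: 'n)) = length w"
proof (induction w)
  case (Cons i w)
  have "(\<Sum>j\<in>UNIV. count_list (i # w) j) = (\<Sum>j\<in>UNIV. count_list w j + (if i = j then 1 else 0))"
    by (rule sum.cong) auto
  then show ?case
    using Cons by (simp add: sum.distrib)
qed simp

text \<open>The first letter acts by a derivation whose effect on the lowest-degree part is that of
  a partial derivative. The degree drops by one with each letter, and repeated differentiation
  accumulates the factorials.\<close>

lemma pr_word_leading:
  assumes "\<And>a. sum a UNIV < length w \<Longrightarrow> coeff P a = 0"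
  shows "pr (word w) P = of_nat (\<Prod>j\<in>UNIV. fact (count_list w j)) * coeff P (count_list w)"
  using assms
proof (induction w arbitrary: P)
  case Nil
  then show ?case
    by (simp add: const_term_def)
next
  case (Cons i w)
  let ?m = "count_list w"
  have c: "coeff (\<psi> (xh i) P) m = of_nat (Suc (m i)) * coeff P (m(i := Suc (m i)))"
    if "sum m UNIV \<le> length w" for m
    by (rule derivation_leading_coeff[OF \<psi>_derivation \<psi>_leading]) (use that Cons.prems in auto)
  have s: "sum (m(i := Suc (m i))) UNIV = Suc (sum m UNIV)" for m
    by (subst (1 2) sum.remove[of _ i]) auto
  have "pr (word w) (\<psi> (xh i) P) = of_nat (\<Prod>j\<in>UNIV. fact (?m j)) * coeff (\<psi> (xh i) P) ?m"
    by (rule Cons.IH) (use c s Cons.prems in \<open>auto simp: less_imp_le\<close>)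
  also have "coeff (\<psi> (xh i) P) ?m = of_nat (Suc (?m i)) * coeff P (?m(i := Suc (?m i)))"
    by (rule c) (simp add: sum_count_list)
  also have "?m(i := Suc (?m i)) = count_list (i # w)"
    by auto
  finally have "pr (word w) (\<psi> (xh i) P) =
      of_nat ((\<Prod>j\<in>UNIV. fact (?m j)) * Suc (?m i)) * coeff P (count_list (i # w))"
    by (simp only: of_nat_mult mult.assoc)
  also have "(\<Prod>j\<in>UNIV. fact (?m j)) * Suc (?m i) = (\<Prod>j\<in>UNIV. fact (count_list (i # w) j))"
    by (simp add: prod.remove[of UNIV i] algebra_simps)
  finally show ?case
    by (simp add: pr_mult)
qed

lemma ex_word: "\<exists>w. count_list w = (a :: 'n \<Rightarrow> nat)"
proof (induction "sum a UNIV" arbitrary: a)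
  case 0
  then have "a = (\<lambda>_. 0)"
    by auto
  then show ?case
    by (intro exI[of _ "[]"]) (simp add: fun_eq_iff)
next
  case (Suc k)
  then obtain j where j: "a j \<noteq> 0"
    by (metis sum.neutral Zero_not_Suc)
  have "sum a UNIV = a j + sum a (UNIV - {j})"
    by (rule sum.remove) auto
  moreover have "sum (a(j := a j - 1)) UNIV = a j - 1 + sum a (UNIV - {j})"
    by (subst sum.remove[of _ j]) auto
  ultimately have "k = sum (a(j := a j - 1)) UNIV"
    using Suc(2) j by linarith
  from Suc(1)[OF this] obtain w where "count_list w = a(j := a j - 1)"
    by blast
  then show ?case
    using j by (intro exI[of _ "j # w"]) (auto simp: fun_eq_iff)
qed

subsection \<open>The dual basis\<close>

text \<open>The order of the letters is a mere choice; other orders are handled by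
  \<open>expand_permute\<close>.\<close>

definition basis_word :: "('n \<Rightarrow> nat) \<Rightarrow> ('g free_monoid \<Rightarrow>\<^sub>0 'k) set" where
  "basis_word a = word (SOME w. count_list w = a)"

definition exponent_fact :: "('n \<Rightarrow> nat) \<Rightarrow> 'k" where
  "exponent_fact a = of_nat (\<Prod>j\<in>UNIV. fact (a j))"

lemma exponent_fact_nonzero: "exponent_fact a \<noteq> 0"
  by (simp add: exponent_fact_def del: of_nat_prod)

lemma basis_word_count: "\<exists>w. count_list w = a \<and> basis_word a = word w"
  unfolding basis_word_def using someI_ex[OF ex_word[of a]] by blast

lemma basis_word_closed [simp]: "basis_word a \<in> carrier U"
  by (simp add: basis_word_def)

lemma pr_basis_word:
  assumes "sum a UNIV \<le> sum b UNIV"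
  shows "pr (basis_word a) (mvps_monom b) = (if a = b then exponent_fact a else 0)"
proof -
  obtain w where w: "count_list w = a" "basis_word a = word w"
    using basis_word_count by blast
  then have "length w = sum a UNIV"
    using sum_count_list[of w] by simp
  then have "pr (word w) (mvps_monom b) = exponent_fact a * coeff (mvps_monom b) a"
    using assms w by (subst pr_word_leading) (auto simp: coeff_monom exponent_fact_def)
  then show ?thesis
    by (simp add: w coeff_monom)
qed

lemma finite_exponents: "finite {b :: 'n \<Rightarrow> nat. sum b UNIV < k}"
proof (rule finite_subset)
  have "b j \<le> k" if "sum b UNIV < k" for b :: "'n \<Rightarrow> nat" and j
    using that member_le_sum[of j UNIV b] by simp
  then show "{b :: 'n \<Rightarrow> nat. sum b UNIV < k} \<subseteq> PiE UNIV (\<lambda>_. {..k})"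
    by auto
  show "finite (PiE (UNIV :: 'n set) (\<lambda>_. {..k}))"
    by (rule finite_PiE) auto
qed

text \<open>Gaussian elimination on the triangular matrix described by \<open>pr_basis_word\<close>:
  the pairings with monomials of lower degree are removed, and the result is divided by the diagonal
  entry.\<close>

definition dual_step :: "(('n \<Rightarrow> nat) \<Rightarrow> ('g free_monoid \<Rightarrow>\<^sub>0 'k) set) \<Rightarrow> ('n \<Rightarrow> nat) \<Rightarrow> ('g free_monoid \<Rightarrow>\<^sub>0 'k) set" where
  "dual_step f a = inverse (exponent_fact a) \<odot>\<^bsub>U\<^esub> (basis_word a \<oplus>\<^bsub>U\<^esub> (-1) \<odot>\<^bsub>U\<^esub>
     (\<Oplus>\<^bsub>U\<^esub>b\<in>{b. sum b UNIV < sum a UNIV}. pr (basis_word a) (mvps_monom b) \<odot>\<^bsub>U\<^esub> f b))"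

definition u :: "('n \<Rightarrow> nat) \<Rightarrow> ('g free_monoid \<Rightarrow>\<^sub>0 'k) set" where
  "u = wfrec (measure (\<lambda>a. sum a UNIV)) dual_step"

lemma u_cut: "u a = dual_step (cut u (measure (\<lambda>a. sum a UNIV)) a) a"
  unfolding u_def by (rule wfrec) simp

lemma u_closed [simp]: "u a \<in> carrier U"
proof (induction a rule: measure_induct_rule[of "\<lambda>a. sum a UNIV"])
  case (less a)
  then show ?case
    by (subst u_cut) (auto simp: dual_step_def cut_def intro!: vs_smult[OF vspace_U] vs_add[OF vspace_U] vs_finsum[OF vspace_U])
qed

text \<open>\<open>dual_step\<close> evaluates its argument only in smaller total degree, where
  \<open>cut\<close> changes nothing. Closedness of u is proved beforehand because the congruence
  rule for sums asks for summands in the carrier.\<close>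

lemma u_rec: "u a = dual_step u a"
proof -
  have "(\<Oplus>\<^bsub>U\<^esub>b\<in>{b. sum b UNIV < sum a UNIV}. pr (basis_word a) (mvps_monom b) \<odot>\<^bsub>U\<^esub> cut u (measure (\<lambda>a. sum a UNIV)) a b)
    = (\<Oplus>\<^bsub>U\<^esub>b\<in>{b. sum b UNIV < sum a UNIV}. pr (basis_word a) (mvps_monom b) \<odot>\<^bsub>U\<^esub> u b)"
    by (rule vs_finsum_cong) (simp_all add: cut_def)
  then show ?thesis
    by (subst u_cut) (simp add: dual_step_def)
qed

text \<open>If b has smaller degree than a, the subtracted sum contributes exactly the pairing of
  \<open>basis_word a\<close> with b and cancels it. Otherwise that sum vanishes by induction and
  the diagonal entry, or zero, remains.\<close>

lemma pr_u_monom: "pr (u a) (mvps_monom b) = (if a = b then 1 else 0)"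
proof (induction a rule: measure_induct_rule[of "\<lambda>a. sum a UNIV"])
  case (less a)
  let ?B = "{b. sum b UNIV < sum a UNIV}"
  have "pr (u a) (mvps_monom b) = inverse (exponent_fact a) *
      (pr (basis_word a) (mvps_monom b) - (\<Sum>c\<in>?B. pr (basis_word a) (mvps_monom c) * pr (u c) (mvps_monom b)))"
    by (subst u_rec) (simp add: dual_step_def pr_smult_left pr_add_left pr_finsum_left)
  also have "(\<Sum>c\<in>?B. pr (basis_word a) (mvps_monom c) * pr (u c) (mvps_monom b)) =
      (\<Sum>c\<in>?B. if c = b then pr (basis_word a) (mvps_monom b) else 0)"
    by (rule sum.cong) (use less in auto)
  also have "\<dots> = (if b \<in> ?B then pr (basis_word a) (mvps_monom b) else 0)"
    using finite_exponents by (subst sum.delta) auto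
  finally show ?case
    using pr_basis_word[of a b] exponent_fact_nonzero[of a] by (auto simp: not_less)
qed

text \<open>By continuity the functional is determined by its values on monomials, which are
  Kronecker deltas.\<close>

lemma pr_u: "pr (u a) P = coeff P a"
proof -
  have "pr (u a) P = (\<Sum>b | pr (u a) (mvps_monom b) \<noteq> 0. coeff P b * pr (u a) (mvps_monom b))"
    by (rule continuous_functional_expansion(2)[OF pr_continuous]) simp
  also have "{b. pr (u a) (mvps_monom b) \<noteq> 0} = {a}"
    by (auto simp: pr_u_monom)
  finally show ?thesis
    by (simp add: pr_u_monom)
qed

section \<open>Expansion of elements in the dual basis\<close>

definition supp :: "('g free_monoid \<Rightarrow>\<^sub>0 'k) set \<Rightarrow> ('n \<Rightarrow> nat) set" where
  "supp v = {b. pr v (mvps_monom b) \<noteq> 0}"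

lemma finite_supp [simp]: "v \<in> carrier U \<Longrightarrow> finite (supp v)"
  unfolding supp_def by (rule continuous_functional_expansion(1)[OF pr_continuous])

text \<open>A linear endomorphism with values in the span of the u_a. Spanning is expressed by
  saying that it fixes every element, a property that passes to sums and multiples.\<close>

definition expand :: "('g free_monoid \<Rightarrow>\<^sub>0 'k) set \<Rightarrow> ('g free_monoid \<Rightarrow>\<^sub>0 'k) set" where
  "expand v = (\<Oplus>\<^bsub>U\<^esub>b\<in>supp v. pr v (mvps_monom b) \<odot>\<^bsub>U\<^esub> u b)"

lemma expand_superset:
  "finite A \<Longrightarrow> supp v \<subseteq> A \<Longrightarrow> expand v = (\<Oplus>\<^bsub>U\<^esub>b\<in>A. pr v (mvps_monom b) \<odot>\<^bsub>U\<^esub> u b)"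
  unfolding expand_def by (rule vs_finsum_superset) (auto simp: supp_def)

lemma supp_add: "v \<in> carrier U \<Longrightarrow> w \<in> carrier U \<Longrightarrow> supp (v \<oplus>\<^bsub>U\<^esub> w) \<subseteq> supp v \<union> supp w"
  by (auto simp: supp_def pr_add_left)

lemma supp_smult: "v \<in> carrier U \<Longrightarrow> supp (c \<odot>\<^bsub>U\<^esub> v) \<subseteq> supp v"
  by (auto simp: supp_def pr_smult_left)

lemma expand_lin: "expand \<in> linear_hom U U"
proof (rule linear_homI)
  fix v w assume v: "v \<in> carrier U" and w: "w \<in> carrier U"
  let ?A = "supp v \<union> supp w"
  have "expand (v \<oplus>\<^bsub>U\<^esub> w) = (\<Oplus>\<^bsub>U\<^esub>b\<in>?A. pr (v \<oplus>\<^bsub>U\<^esub> w) (mvps_monom b) \<odot>\<^bsub>U\<^esub> u b)"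
    by (rule expand_superset) (use v w supp_add in auto)
  also have "\<dots> = (\<Oplus>\<^bsub>U\<^esub>b\<in>?A. pr v (mvps_monom b) \<odot>\<^bsub>U\<^esub> u b \<oplus>\<^bsub>U\<^esub> pr w (mvps_monom b) \<odot>\<^bsub>U\<^esub> u b)"
    using v w by (intro vs_finsum_cong) (simp_all add: pr_add_left vs_add_smult)
  also have "\<dots> = expand v \<oplus>\<^bsub>U\<^esub> expand w"
    using v w by (simp add: vs_finsum_add expand_superset[of ?A])
  finally show "expand (v \<oplus>\<^bsub>U\<^esub> w) = expand v \<oplus>\<^bsub>U\<^esub> expand w" .
next
  fix c v assume v: "v \<in> carrier U"
  have "expand (c \<odot>\<^bsub>U\<^esub> v) = (\<Oplus>\<^bsub>U\<^esub>b\<in>supp v. pr (c \<odot>\<^bsub>U\<^esub> v) (mvps_monom b) \<odot>\<^bsub>U\<^esub> u b)"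
    by (rule expand_superset) (use v supp_smult in auto)
  also have "\<dots> = (\<Oplus>\<^bsub>U\<^esub>b\<in>supp v. c \<odot>\<^bsub>U\<^esub> (pr v (mvps_monom b) \<odot>\<^bsub>U\<^esub> u b))"
    using v by (intro vs_finsum_cong) (simp_all add: pr_smult_left)
  also have "\<dots> = c \<odot>\<^bsub>U\<^esub> expand v"
    unfolding expand_def
    by (rule lin_finsum[OF vspace_U vspace_U lin_scale[OF vspace_U lin_id], symmetric]) simp
  finally show "expand (c \<odot>\<^bsub>U\<^esub> v) = c \<odot>\<^bsub>U\<^esub> expand v" .
qed (simp add: expand_def)

lemma expand_u: "expand (u a) = u a"
proof -
  have "supp (u a) = {a}"
    by (auto simp: supp_def pr_u_monom)
  then show ?thesis
    by (simp add: expand_def pr_u_monom)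
qed

text \<open>Solving the recursion for \<open>basis_word a\<close> exhibits it as a combination of
  u_a and of u_b of lower degree, all of which are fixed.\<close>

lemma expand_basis_word: "expand (basis_word a) = basis_word a"
proof -
  let ?s = "\<Oplus>\<^bsub>U\<^esub>b\<in>{b. sum b UNIV < sum a UNIV}. pr (basis_word a) (mvps_monom b) \<odot>\<^bsub>U\<^esub> u b"
  have s: "?s \<in> carrier U"
    by simp
  have "exponent_fact a \<odot>\<^bsub>U\<^esub> u a = basis_word a \<oplus>\<^bsub>U\<^esub> (-1) \<odot>\<^bsub>U\<^esub> ?s"
    using exponent_fact_nonzero[of a] by (subst u_rec) (simp add: dual_step_def)
  then have "exponent_fact a \<odot>\<^bsub>U\<^esub> u a \<oplus>\<^bsub>U\<^esub> ?s = basis_word a \<oplus>\<^bsub>U\<^esub> ((-1) \<odot>\<^bsub>U\<^esub> ?s \<oplus>\<^bsub>U\<^esub> ?s)"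
    using s by (simp add: vs_assoc[OF vspace_U])
  then have basis_word: "basis_word a = exponent_fact a \<odot>\<^bsub>U\<^esub> u a \<oplus>\<^bsub>U\<^esub> ?s"
    using s by (simp add: vs_cancel_left)
  have "expand ?s = ?s"
    by (subst lin_finsum[OF vspace_U vspace_U expand_lin]) (simp_all add: lin_smult[OF expand_lin] expand_u)
  then show ?thesis
    by (subst (1 2) basis_word) (simp add: lin_add[OF expand_lin] lin_smult[OF expand_lin] expand_u s)
qed

text \<open>Reordering the letters of a word changes it by a combination of shorter words.\<close>

lemma expand_bracket:
  assumes IH: "\<And>w. length w < k \<Longrightarrow> expand (word w) = word w" and k: "length v + length w + 1 < k"
  shows "expand (word v \<otimes>\<^bsub>U\<^esub> (\<iota> y \<otimes>\<^bsub>U\<^esub> word w)) = word v \<otimes>\<^bsub>U\<^esub> (\<iota> y \<otimes>\<^bsub>U\<^esub> word w)"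
proof (rule U_induct_aux[where P = "\<lambda>a. expand a = a" and f = "\<lambda>a. word v \<otimes>\<^bsub>U\<^esub> (a \<otimes>\<^bsub>U\<^esub> word w)"])
  show "expand \<one>\<^bsub>U\<^esub> = \<one>\<^bsub>U\<^esub>"
    using IH[of "[]"] k by simp
  show "(\<lambda>a. word v \<otimes>\<^bsub>U\<^esub> (a \<otimes>\<^bsub>U\<^esub> word w)) \<in> linear_hom U U"
    by (rule lin_comp[OF alg_lin_left[OF assoc_algebra_U word_closed] alg_lin_right[OF assoc_algebra_U word_closed]])
  show "expand (word v \<otimes>\<^bsub>U\<^esub> (xh i \<otimes>\<^bsub>U\<^esub> word w)) = word v \<otimes>\<^bsub>U\<^esub> (xh i \<otimes>\<^bsub>U\<^esub> word w)" for i
    using IH[of "v @ i # w"] k by (simp add: word_append)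
qed (simp_all add: lin_add[OF expand_lin] lin_smult[OF expand_lin])

text \<open>The two words differ by a term with one letter fewer, containing the bracket. That term
  is fixed by \<open>expand\<close>, so it can be cancelled from both sides.\<close>

lemma expand_swap:
  assumes IH: "\<And>w. length w < length v + length w' + 2 \<Longrightarrow> expand (word w) = word w"
  shows "expand (word (v @ i # j # w')) = word (v @ i # j # w') \<longleftrightarrow> expand (word (v @ j # i # w')) = word (v @ j # i # w')"
proof -
  let ?d = "word v \<otimes>\<^bsub>U\<^esub> (\<iota> (br (x i) (x j)) \<otimes>\<^bsub>U\<^esub> word w')"
  have "xh i \<otimes>\<^bsub>U\<^esub> (xh j \<otimes>\<^bsub>U\<^esub> word w') = (xh i \<otimes>\<^bsub>U\<^esub> xh j) \<otimes>\<^bsub>U\<^esub> word w'"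
    by (simp add: alg_assoc)
  also have "\<dots> = xh j \<otimes>\<^bsub>U\<^esub> (xh i \<otimes>\<^bsub>U\<^esub> word w') \<oplus>\<^bsub>U\<^esub> \<iota> (br (x i) (x j)) \<otimes>\<^bsub>U\<^esub> word w'"
    unfolding \<iota>_relations(3)[of "x i" "x j"]
    by (simp add: lin_add[OF alg_lin_left[OF assoc_algebra_U]] alg_assoc)
  finally have eq: "word (v @ i # j # w') = word (v @ j # i # w') \<oplus>\<^bsub>U\<^esub> ?d"
    by (simp add: word_append lin_add[OF alg_lin_right[OF assoc_algebra_U]])
  have d: "expand ?d = ?d"
    by (rule expand_bracket[of "length v + length w' + 2"]) (use IH in auto)
  have c: "expand (word w) \<in> carrier U" for w
    using lin_closed[OF expand_lin] by simp
  have "expand (word (v @ i # j # w')) = expand (word (v @ j # i # w')) \<oplus>\<^bsub>U\<^esub> ?d"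
    unfolding eq using d by (simp add: lin_add[OF expand_lin])
  moreover have "a \<oplus>\<^bsub>U\<^esub> ?d = b \<oplus>\<^bsub>U\<^esub> ?d \<longleftrightarrow> a = b" if "a \<in> carrier U" "b \<in> carrier U" for a b
    using that by (intro vs_add_right_cancel[OF vspace_U]) simp_all
  ultimately show ?thesis
    unfolding eq using c by simp
qed

lemma expand_move:
  assumes IH: "\<And>w. length w < k \<Longrightarrow> expand (word w) = word w" and k: "length v + length r + length w + 1 = k"
  shows "expand (word (v @ i # r @ w)) = word (v @ i # r @ w) \<longleftrightarrow> expand (word (v @ r @ i # w)) = word (v @ r @ i # w)"
  using k
proof (induction r arbitrary: v)
  case (Cons j r)
  have "expand (word (v @ i # j # r @ w)) = word (v @ i # j # r @ w) \<longleftrightarrow>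
      expand (word (v @ j # i # r @ w)) = word (v @ j # i # r @ w)"
    by (rule expand_swap) (use IH Cons.prems in auto)
  then show ?case
    using Cons.IH[of "v @ [j]"] Cons.prems by simp
qed simp

text \<open>The first letter of w is located in w' and moved to the front by
  \<open>expand_move\<close>; the remaining letters follow by induction, with that letter appended
  to the prefix v.\<close>

lemma expand_permute:
  assumes IH: "\<And>w. length w < k \<Longrightarrow> expand (word w) = word w"
    and "length v + length w = k" "count_list w = count_list w'"
  shows "expand (word (v @ w)) = word (v @ w) \<longleftrightarrow> expand (word (v @ w')) = word (v @ w')"
  using assms(2,3)
proof (induction w arbitrary: v w')
  case Nil
  then have "w' = []"
    by (cases w') (auto simp: fun_eq_iff split: if_splits)
  then show ?case
    by simp
next
  case (Cons i w)
  have "i \<in> set w'"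
    using fun_cong[OF Cons.prems(2), of i] by (metis count_list.simps(2) count_notin add_is_0 one_neq_zero)
  then obtain r t where w': "w' = r @ i # t"
    by (meson split_list)
  have eq: "count_list w = count_list (r @ t)"
  proof
    fix j show "count_list w j = count_list (r @ t) j"
      using fun_cong[OF Cons.prems(2), of j] by (simp add: w' split: if_splits)
  qed
  have "length w = length (r @ t)"
    using sum_count_list[of w] sum_count_list[of "r @ t"] eq by simp
  then show ?case
    using Cons.IH[of "v @ [i]" "r @ t"] Cons.prems(1) eq expand_move[OF IH, where v = v and r = r and w = t and i = i] by (simp add: w')
qed

text \<open>In a strong induction on the length, w is reordered into the word chosen for its
  exponent, which is fixed by \<open>expand_basis_word\<close>.\<close>

lemma expand_word: "expand (word w) = word w"
proof (induction w rule: length_induct)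
  case (1 w)
  obtain w' where w': "count_list w' = count_list w" "basis_word (count_list w) = word w'"
    using basis_word_count by blast
  show ?case
    using expand_permute[where k = "length w" and v = "[]" and w = w and w' = w'] 1 w' expand_basis_word[of "count_list w"] by simp
qed

lemma expand_id: "v \<in> carrier U \<Longrightarrow> expand v = v"
proof -
  \<comment> \<open>The claim is strengthened by a word in front, so that in the generator case the
    letter moves into this word; \<open>expand\<close> itself has no evident compatibility with
    products.\<close>
  have "\<forall>w. expand (word w \<otimes>\<^bsub>U\<^esub> v) = word w \<otimes>\<^bsub>U\<^esub> v" if "v \<in> carrier U" for v
    using that
  proof (induction v rule: U_induct)
    case (gen i v)
    have "word w \<otimes>\<^bsub>U\<^esub> (xh i \<otimes>\<^bsub>U\<^esub> v) = word (w @ [i]) \<otimes>\<^bsub>U\<^esub> v" for w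
      using gen(1) by (simp add: word_append alg_assoc)
    then show ?case
      using gen(2) by simp
  qed (simp_all add: expand_word lin_add[OF expand_lin] lin_smult[OF expand_lin]
      lin_add[OF alg_lin_right[OF assoc_algebra_U]] lin_smult[OF alg_lin_right[OF assoc_algebra_U]])
  from this[of v, rule_format, of "[]"] show "v \<in> carrier U \<Longrightarrow> expand v = v"
    by simp
qed

lemma u_expansion:
  "v \<in> carrier U \<Longrightarrow> finite A \<Longrightarrow> supp v \<subseteq> A \<Longrightarrow> v = (\<Oplus>\<^bsub>U\<^esub>b\<in>A. pr v (mvps_monom b) \<odot>\<^bsub>U\<^esub> u b)"
  using expand_id[of v] expand_superset[of A v] by simp

text \<open>\<open>expand\<close> depends on its argument only through the pairings with monomials,
  and it is the identity.\<close>

lemma pr_nondegenerate: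
  assumes "v \<in> carrier U" "w \<in> carrier U" "\<And>b. pr v (mvps_monom b) = pr w (mvps_monom b)"
  shows "v = w"
proof -
  have "expand v = expand w"
    using assms(3) by (simp add: expand_def supp_def)
  then show ?thesis
    using assms by (simp add: expand_id)
qed

lemma u_hom_eqI:
  assumes Z: "vspace Z" and f: "f \<in> linear_hom U Z" and g: "g \<in> linear_hom U Z"
    and eq: "\<And>a. f (u a) = g (u a)" and v: "v \<in> carrier U"
  shows "f v = g v"
proof -
  have "h (expand v) = (\<Oplus>\<^bsub>Z\<^esub>b\<in>supp v. pr v (mvps_monom b) \<odot>\<^bsub>Z\<^esub> h (u b))" if h: "h \<in> linear_hom U Z" for h
    unfolding expand_def by (subst lin_finsum[OF vspace_U Z h]) (simp_all add: lin_smult[OF h])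
  from this[OF f] this[OF g] have "f (expand v) = g (expand v)"
    by (simp only: eq)
  then show ?thesis
    using v by (simp only: expand_id)
qed

lemma u_zero: "u (\<lambda>_. 0) = \<one>\<^bsub>U\<^esub>"
  by (rule pr_nondegenerate) (auto simp: pr_u_monom const_term_def coeff_monom)

lemma counit_u: "\<epsilon> (u a) = (if a = (\<lambda>_. 0) then 1 else 0)"
  using pr_unit[of "u a"] by (simp add: pr_u coeff_one)

subsection \<open>The coproduct on the dual basis\<close>

text \<open>The identity tensored with the pairing against the monomial b; it extracts the left
  coefficient of u_b in an element of the tensor square.\<close>

definition contract :: "('n \<Rightarrow> nat) \<Rightarrow> _ \<Rightarrow> ('g free_monoid \<Rightarrow>\<^sub>0 'k) set" where
  "contract b = tensor_lift U (\<lambda>p q. pr q (mvps_monom b) \<odot>\<^bsub>U\<^esub> p)"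

lemma bilin_contract: "bilin U U U (\<lambda>p q. pr q (mvps_monom b) \<odot>\<^bsub>U\<^esub> p)"
  by (intro bilinI linear_homI) (simp_all add: pr_add_left pr_smult_left vs_smult_add vs_add_smult mult.commute)

lemma contract_lin: "contract b \<in> linear_hom (tensor_space U U) U"
  unfolding contract_def using lin_tensor_lift[OF vspace_U vspace_U vspace_U bilin_contract] .

lemma contract_tens: "p \<in> carrier U \<Longrightarrow> q \<in> carrier U \<Longrightarrow> contract b (p \<otimes>\<otimes> q) = pr q (mvps_monom b) \<odot>\<^bsub>U\<^esub> p"
  unfolding contract_def by (rule tensor_lift_tensor[OF vspace_U vspace_U vspace_U bilin_contract])

text \<open>The expansion is claimed for all finite sets beyond some A rather than for one set, so
  that expansions of two tensors can be added over a common index set.\<close>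

lemma UU_expansion:
  assumes "Y \<in> carrier (tensor_space U U)"
  shows "\<exists>A. finite A \<and> (\<forall>B. finite B \<longrightarrow> A \<subseteq> B \<longrightarrow> Y = (\<Oplus>\<^bsub>tensor_space U U\<^esub>b\<in>B. contract b Y \<otimes>\<otimes> u b))"
  using assms
proof (induction Y rule: tensor_space_induct[OF vspace_U vspace_U, consumes 1, case_names tensor add])
  case (tensor p q)
  have "p \<otimes>\<otimes> q = (\<Oplus>\<^bsub>tensor_space U U\<^esub>b\<in>B. contract b (p \<otimes>\<otimes> q) \<otimes>\<otimes> u b)" if B: "finite B" "supp q \<subseteq> B" for B
  proof -
    have "p \<otimes>\<otimes> q = p \<otimes>\<otimes> (\<Oplus>\<^bsub>U\<^esub>b\<in>B. pr q (mvps_monom b) \<odot>\<^bsub>U\<^esub> u b)"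
      using u_expansion[OF tensor(2) B] by simp
    also have "\<dots> = (\<Oplus>\<^bsub>tensor_space U U\<^esub>b\<in>B. p \<otimes>\<otimes> (pr q (mvps_monom b) \<odot>\<^bsub>U\<^esub> u b))"
      by (rule lin_finsum[OF vspace_U vspace_UU(2) bilin_right[OF bilin_tens tensor(1)]]) simp
    also have "\<dots> = (\<Oplus>\<^bsub>tensor_space U U\<^esub>b\<in>B. contract b (p \<otimes>\<otimes> q) \<otimes>\<otimes> u b)"
      by (rule vs_finsum_cong) (simp_all add: tensor contract_tens tens_smult_left tens_smult_right)
    finally show ?thesis .
  qed
  then show ?case
    using tensor by (intro exI[of _ "supp q"]) simp
next
  case (add Y Y')
  from add(3) obtain A where
    A: "finite A \<and> (\<forall>B. finite B \<longrightarrow> A \<subseteq> B \<longrightarrow> Y = (\<Oplus>\<^bsub>tensor_space U U\<^esub>b\<in>B. contract b Y \<otimes>\<otimes> u b))" ..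
  from add(4) obtain A' where
    A': "finite A' \<and> (\<forall>B. finite B \<longrightarrow> A' \<subseteq> B \<longrightarrow> Y' = (\<Oplus>\<^bsub>tensor_space U U\<^esub>b\<in>B. contract b Y' \<otimes>\<otimes> u b))" ..
  have c: "contract b Y \<in> carrier U" "contract b Y' \<in> carrier U" for b
    using lin_closed[OF contract_lin] add by auto
  have "Y \<oplus>\<^bsub>tensor_space U U\<^esub> Y' = (\<Oplus>\<^bsub>tensor_space U U\<^esub>b\<in>B. contract b (Y \<oplus>\<^bsub>tensor_space U U\<^esub> Y') \<otimes>\<otimes> u b)"
    if B: "finite B" "A \<union> A' \<subseteq> B" for B
  proof -
    have "(\<Oplus>\<^bsub>tensor_space U U\<^esub>b\<in>B. contract b (Y \<oplus>\<^bsub>tensor_space U U\<^esub> Y') \<otimes>\<otimes> u b) =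
        (\<Oplus>\<^bsub>tensor_space U U\<^esub>b\<in>B. contract b Y \<otimes>\<otimes> u b \<oplus>\<^bsub>tensor_space U U\<^esub> contract b Y' \<otimes>\<otimes> u b)"
      by (rule vs_finsum_cong) (use add c in \<open>simp_all add: lin_add[OF contract_lin] tens_add_left\<close>)
    also have "\<dots> = (\<Oplus>\<^bsub>tensor_space U U\<^esub>b\<in>B. contract b Y \<otimes>\<otimes> u b) \<oplus>\<^bsub>tensor_space U U\<^esub>
        (\<Oplus>\<^bsub>tensor_space U U\<^esub>b\<in>B. contract b Y' \<otimes>\<otimes> u b)"
      by (rule vs_finsum_add) (use c in simp_all)
    also have "\<dots> = Y \<oplus>\<^bsub>tensor_space U U\<^esub> Y'"
      using A[THEN conjunct2, rule_format, OF B(1)] A'[THEN conjunct2, rule_format, OF B(1)] B(2) by simp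
    finally show ?thesis ..
  qed
  then show ?case
    using A[THEN conjunct1] A'[THEN conjunct1] by (intro exI[of _ "A \<union> A'"]) simp
qed

lemma pr_contract:
  assumes "Y \<in> carrier (tensor_space U U)"
  shows "pr (contract b Y) P = pr2 P (mvps_monom b) Y"
  using tensor_hom_eqI[OF vspace_U vspace_U vspace_scalars lin_comp[OF contract_lin pr_lin_left] pr2_lin _ assms]
  by (simp add: contract_tens pr_smult_left pr2_tens mult.commute)

text \<open>The two factors are separated in turn: nondegeneracy on U identifies all contractions,
  and the expansion over a common finite set recovers the tensor from them.\<close>

lemma pr2_nondegenerate:
  assumes Y: "Y \<in> carrier (tensor_space U U)" and Y': "Y' \<in> carrier (tensor_space U U)"
    and eq: "\<And>b c. pr2 (mvps_monom b) (mvps_monom c) Y = pr2 (mvps_monom b) (mvps_monom c) Y'"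
  shows "Y = Y'"
proof -
  have contract: "contract b Y = contract b Y'" for b
    using Y Y' eq lin_closed[OF contract_lin] by (intro pr_nondegenerate) (auto simp: pr_contract)
  from UU_expansion[OF Y] obtain A where
    A: "finite A \<and> (\<forall>B. finite B \<longrightarrow> A \<subseteq> B \<longrightarrow> Y = (\<Oplus>\<^bsub>tensor_space U U\<^esub>b\<in>B. contract b Y \<otimes>\<otimes> u b))" ..
  from UU_expansion[OF Y'] obtain A' where
    A': "finite A' \<and> (\<forall>B. finite B \<longrightarrow> A' \<subseteq> B \<longrightarrow> Y' = (\<Oplus>\<^bsub>tensor_space U U\<^esub>b\<in>B. contract b Y' \<otimes>\<otimes> u b))" ..
  have fin: "finite (A \<union> A')"
    using A A' by simp
  have "Y = (\<Oplus>\<^bsub>tensor_space U U\<^esub>b\<in>A \<union> A'. contract b Y' \<otimes>\<otimes> u b)"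
    using A[THEN conjunct2, rule_format, OF fin] by (simp only: contract Un_upper1)
  also have "\<dots> = Y'"
    using A'[THEN conjunct2, rule_format, OF fin] by (simp only: Un_upper2)
  finally show ?thesis .
qed

text \<open>By \<open>pr_times\<close> the coproduct of u_a paired with two monomials is u_a paired
  with their product, a single monomial. It is therefore 1 or 0 according to whether the exponents
  add up to a.\<close>

lemma comult_u: "\<Delta> (u a) = (\<Oplus>\<^bsub>tensor_space U U\<^esub>p\<in>splits a. u (fst p) \<otimes>\<otimes> u (snd p))"
proof (rule pr2_nondegenerate)
  fix b c
  have "pr2 (mvps_monom b) (mvps_monom c) (\<Oplus>\<^bsub>tensor_space U U\<^esub>p\<in>splits a. u (fst p) \<otimes>\<otimes> u (snd p))
      = (\<Sum>p\<in>splits a. pr2 (mvps_monom b) (mvps_monom c) (u (fst p) \<otimes>\<otimes> u (snd p)))"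
    by (subst lin_finsum[OF vspace_UU(2) vspace_scalars pr2_lin]) simp_all
  also have "\<dots> = (\<Sum>p\<in>splits a. if p = (b, c) then 1 else 0)"
    by (rule sum.cong) (auto simp: pr2_tens pr_u_monom)
  also have "\<dots> = (if (b, c) \<in> splits a then 1 else 0)"
    by simp
  also have "\<dots> = (if (\<lambda>v. b v + c v) = a then 1 else 0)"
    by (simp add: splits_def)
  finally show "pr2 (mvps_monom b) (mvps_monom c) (\<Delta> (u a)) =
      pr2 (mvps_monom b) (mvps_monom c) (\<Oplus>\<^bsub>tensor_space U U\<^esub>p\<in>splits a. u (fst p) \<otimes>\<otimes> u (snd p))"
    by (auto simp: pr_times mvps_monom_mult pr_u_monom)
qed simp_all

lemma lift_comult_u:
  assumes Z: "vspace Z" and f: "bilin U U Z f"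
  shows "tensor_lift Z f (\<Delta> (u a)) = (\<Oplus>\<^bsub>Z\<^esub>p\<in>splits a. f (u (fst p)) (u (snd p)))"
  unfolding comult_u
  by (subst lin_finsum[OF vspace_UU(2) Z lin_tensor_lift[OF vspace_U vspace_U Z f]])
    (use Z bilin_closed[OF f] tensor_lift_tensor[OF vspace_U vspace_U Z f] in \<open>auto intro!: vs_finsum_cong\<close>)

end

text \<open>Both sides run over the decompositions of c into three exponents; the reindexing
  regroups them from (a + b) + d to a + (b + d).\<close>

lemma finsum_splits_assoc:
  fixes c :: "'n::finite \<Rightarrow> nat"
  assumes V: "vspace V" and g: "\<And>a b d. g a b d \<in> carrier V"
  shows "(\<Oplus>\<^bsub>V\<^esub>p\<in>splits c. \<Oplus>\<^bsub>V\<^esub>q\<in>splits (fst p). g (fst q) (snd q) (snd p)) =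
    (\<Oplus>\<^bsub>V\<^esub>p\<in>splits c. \<Oplus>\<^bsub>V\<^esub>q\<in>splits (snd p). g (fst p) (fst q) (snd q))"
proof -
  let ?h = "\<lambda>x :: (('n \<Rightarrow> nat) \<times> ('n \<Rightarrow> nat)) \<times> (('n \<Rightarrow> nat) \<times> ('n \<Rightarrow> nat)).
    ((fst (snd x), \<lambda>v. snd (snd x) v + snd (fst x) v), (snd (snd x), snd (fst x)))"
  have inj: "inj_on ?h (Sigma (splits c) (\<lambda>p. splits (fst p)))"
    by (rule inj_onI) (auto simp: splits_def)
  have "x \<in> ?h ` Sigma (splits c) (\<lambda>p. splits (fst p))" if "x \<in> Sigma (splits c) (\<lambda>p. splits (snd p))" for x
    using that
    by (intro image_eqI[where x = "((\<lambda>v. fst (fst x) v + fst (snd x) v, snd (snd x)), (fst (fst x), fst (snd x)))"])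
      (auto simp: splits_def fun_eq_iff add.assoc)
  moreover have "?h x \<in> Sigma (splits c) (\<lambda>p. splits (snd p))" if "x \<in> Sigma (splits c) (\<lambda>p. splits (fst p))" for x
    using that by (auto simp: splits_def add.assoc)
  ultimately have im: "?h ` Sigma (splits c) (\<lambda>p. splits (fst p)) = Sigma (splits c) (\<lambda>p. splits (snd p))"
    by blast
  have "(\<Oplus>\<^bsub>V\<^esub>p\<in>splits c. \<Oplus>\<^bsub>V\<^esub>q\<in>splits (fst p). g (fst q) (snd q) (snd p)) =
      (\<Oplus>\<^bsub>V\<^esub>x\<in>Sigma (splits c) (\<lambda>p. splits (fst p)). g (fst (snd x)) (snd (snd x)) (snd (fst x)))"
    using V g by (subst vs_finsum_Sigma) simp_all
  also have "\<dots> = (\<Oplus>\<^bsub>V\<^esub>x\<in>?h ` Sigma (splits c) (\<lambda>p. splits (fst p)). g (fst (fst x)) (fst (snd x)) (snd (snd x)))"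
    using V g inj by (subst vs_finsum_reindex) simp_all
  also have "\<dots> = (\<Oplus>\<^bsub>V\<^esub>p\<in>splits c. \<Oplus>\<^bsub>V\<^esub>q\<in>splits (snd p). g (fst p) (fst q) (snd q))"
    unfolding im using V g by (subst vs_finsum_Sigma) simp_all
  finally show ?thesis .
qed

context leading_delta_action
begin

section \<open>The enveloping algebra is a Hopf algebra\<close>

lemma lin_lift_comult:
  assumes "vspace Z" "bilin U U Z f"
  shows "(\<lambda>a. tensor_lift Z f (\<Delta> a)) \<in> linear_hom U Z"
  by (rule lin_comp[OF comult_lin lin_tensor_lift[OF vspace_U vspace_U assms]])

lemma bilin_lift_comult_left:
  assumes W: "vspace W" and Z: "vspace Z" and f: "\<And>c. c \<in> carrier W \<Longrightarrow> bilin U U Z (\<lambda>a b. f a b c)"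
    and lin: "\<And>a b. a \<in> carrier U \<Longrightarrow> b \<in> carrier U \<Longrightarrow> (\<lambda>c. f a b c) \<in> linear_hom W Z"
  shows "bilin U W Z (\<lambda>a c. tensor_lift Z (\<lambda>a1 a2. f a1 a2 c) (\<Delta> a))"
proof (rule bilinI)
  show "(\<lambda>c. tensor_lift Z (\<lambda>a1 a2. f a1 a2 c) (\<Delta> a)) \<in> linear_hom W Z" if "a \<in> carrier U" for a
    by (rule tensor_lift_param[OF vspace_U vspace_U Z W f lin]) (use that in simp_all)
  show "(\<lambda>a. tensor_lift Z (\<lambda>a1 a2. f a1 a2 c) (\<Delta> a)) \<in> linear_hom U Z" if "c \<in> carrier W" for c
    by (rule lin_lift_comult[OF Z f[OF that]])
qed

abbreviation UUU :: "('k, _) module" where "UUU \<equiv> tensor_space U (tensor_space U U)"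

abbreviation tens3 where "tens3 a Y \<equiv> tensor U (tensor_space U U) a Y"

lemma vspace_UUU [simp]: "vspace UUU"
  by (rule vspace_tensor_space) simp_all

lemma bilin_tens3: "bilin U (tensor_space U U) UUU tens3"
  by (rule bilin_tensor) simp_all

lemma tens3_closed [simp]: "a \<in> carrier U \<Longrightarrow> Y \<in> carrier (tensor_space U U) \<Longrightarrow> tens3 a Y \<in> carrier UUU"
  by (rule bilin_closed[OF bilin_tens3])

lemma bilin_tens3_tens:
  "c \<in> carrier U \<Longrightarrow> bilin U U UUU (\<lambda>a b. tens3 a (b \<otimes>\<otimes> c))"
  "a \<in> carrier U \<Longrightarrow> b \<in> carrier U \<Longrightarrow> (\<lambda>c. tens3 a (b \<otimes>\<otimes> c)) \<in> linear_hom U UUU"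
  by (auto intro!: bilinI intro: bilin_left[OF bilin_tens3] lin_comp[OF _ bilin_right[OF bilin_tens3]]
      bilin_left[OF bilin_tens] bilin_right[OF bilin_tens])

lemma bilin_tens3_comult: "bilin U U UUU (\<lambda>a b. tens3 a (\<Delta> b))"
  by (rule bilinI) (auto intro: bilin_left[OF bilin_tens3] lin_comp[OF comult_lin bilin_right[OF bilin_tens3]])

text \<open>On u_c both iterated coproducts are the sum over all decompositions of c into three
  exponents; linearity does the rest.\<close>

lemma comult_coassoc:
  assumes "h \<in> carrier U"
  shows "tensor_lift UUU (\<lambda>a b. tensor_lift UUU (\<lambda>a1 a2. tens3 a1 (a2 \<otimes>\<otimes> b)) (\<Delta> a)) (\<Delta> h)
    = tensor_lift UUU (\<lambda>a b. tens3 a (\<Delta> b)) (\<Delta> h)"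
proof (rule u_hom_eqI[OF _ _ _ _ assms])
  note b = bilin_lift_comult_left[OF vspace_U vspace_UUU bilin_tens3_tens(1) bilin_tens3_tens(2)]
  show "(\<lambda>h. tensor_lift UUU (\<lambda>a b. tensor_lift UUU (\<lambda>a1 a2. tens3 a1 (a2 \<otimes>\<otimes> b)) (\<Delta> a)) (\<Delta> h)) \<in> linear_hom U UUU"
    by (rule lin_lift_comult[OF vspace_UUU b])
  show "(\<lambda>h. tensor_lift UUU (\<lambda>a b. tens3 a (\<Delta> b)) (\<Delta> h)) \<in> linear_hom U UUU"
    by (rule lin_lift_comult[OF vspace_UUU bilin_tens3_comult])
  fix c
  have "tensor_lift UUU (\<lambda>a b. tensor_lift UUU (\<lambda>a1 a2. tens3 a1 (a2 \<otimes>\<otimes> b)) (\<Delta> a)) (\<Delta> (u c)) =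
      (\<Oplus>\<^bsub>UUU\<^esub>p\<in>splits c. \<Oplus>\<^bsub>UUU\<^esub>q\<in>splits (fst p). tens3 (u (fst q)) (u (snd q) \<otimes>\<otimes> u (snd p)))"
    by (simp add: lift_comult_u[OF vspace_UUU b] lift_comult_u[OF vspace_UUU bilin_tens3_tens(1)])
  also have "\<dots> = (\<Oplus>\<^bsub>UUU\<^esub>p\<in>splits c. \<Oplus>\<^bsub>UUU\<^esub>q\<in>splits (snd p). tens3 (u (fst p)) (u (fst q) \<otimes>\<otimes> u (snd q)))"
    by (rule finsum_splits_assoc) simp_all
  also have "\<dots> = (\<Oplus>\<^bsub>UUU\<^esub>p\<in>splits c. tens3 (u (fst p)) (\<Delta> (u (snd p))))"
    unfolding comult_u
    by (rule vs_finsum_cong) (simp_all add: lin_finsum[OF vspace_UU(2) vspace_UUU bilin_right[OF bilin_tens3]])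
  also have "\<dots> = tensor_lift UUU (\<lambda>a b. tens3 a (\<Delta> b)) (\<Delta> (u c))"
    by (rule lift_comult_u[OF vspace_UUU bilin_tens3_comult, symmetric])
  finally show "tensor_lift UUU (\<lambda>a b. tensor_lift UUU (\<lambda>a1 a2. tens3 a1 (a2 \<otimes>\<otimes> b)) (\<Delta> a)) (\<Delta> (u c)) =
      tensor_lift UUU (\<lambda>a b. tens3 a (\<Delta> b)) (\<Delta> (u c))" .
qed simp

lemma bilin_smult_left: "f \<in> linear_hom U scalars \<Longrightarrow> bilin U U U (\<lambda>a b. f a \<odot>\<^bsub>U\<^esub> b)"
  by (intro bilinI linear_homI)
    (simp_all add: lin_add[of f U scalars] lin_smult[of f U scalars] vs_smult_add vs_add_smult mult.commute)

lemma bilin_smult_right: "f \<in> linear_hom U scalars \<Longrightarrow> bilin U U U (\<lambda>a b. f b \<odot>\<^bsub>U\<^esub> a)"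
  by (intro bilinI linear_homI)
    (simp_all add: lin_add[of f U scalars] lin_smult[of f U scalars] vs_smult_add vs_add_smult mult.commute)

text \<open>The counit vanishes on u_a unless a = 0, so a single summand of the coproduct of u_c
  survives.\<close>

lemma comult_counit:
  assumes h: "h \<in> carrier U"
  shows "tensor_lift U (\<lambda>a b. \<epsilon> a \<odot>\<^bsub>U\<^esub> b) (\<Delta> h) = h" "tensor_lift U (\<lambda>a b. \<epsilon> b \<odot>\<^bsub>U\<^esub> a) (\<Delta> h) = h"
proof -
  note l = bilin_smult_left[OF counit_lin] and r = bilin_smult_right[OF counit_lin]
  have "tensor_lift U (\<lambda>a b. \<epsilon> a \<odot>\<^bsub>U\<^esub> b) (\<Delta> (u c)) = u c" for c
  proof -
    have i: "(\<lambda>_. 0, c) \<in> splits c"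
      by (simp add: splits_def)
    have z: "\<epsilon> (u (fst p)) \<odot>\<^bsub>U\<^esub> u (snd p) = \<zero>\<^bsub>U\<^esub>" if "p \<in> splits c" "p \<noteq> (\<lambda>_. 0, c)" for p
    proof -
      have "fst p \<noteq> (\<lambda>_. 0)"
        using that by (auto simp: splits_def)
      then show ?thesis
        by (simp add: counit_u)
    qed
    show ?thesis
      unfolding lift_comult_u[OF vspace_U l]
      by (subst vs_finsum_single[OF vspace_U finite_splits i _ z]) (simp_all add: counit_u)
  qed
  then show "tensor_lift U (\<lambda>a b. \<epsilon> a \<odot>\<^bsub>U\<^esub> b) (\<Delta> h) = h"
    by (rule u_hom_eqI[OF vspace_U lin_lift_comult[OF vspace_U l] lin_id _ h])
  have "tensor_lift U (\<lambda>a b. \<epsilon> b \<odot>\<^bsub>U\<^esub> a) (\<Delta> (u c)) = u c" for c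
  proof -
    have i: "(c, \<lambda>_. 0) \<in> splits c"
      by (simp add: splits_def)
    have z: "\<epsilon> (u (snd p)) \<odot>\<^bsub>U\<^esub> u (fst p) = \<zero>\<^bsub>U\<^esub>" if "p \<in> splits c" "p \<noteq> (c, \<lambda>_. 0)" for p
    proof -
      have "snd p \<noteq> (\<lambda>_. 0)"
        using that by (auto simp: splits_def)
      then show ?thesis
        by (simp add: counit_u)
    qed
    show ?thesis
      unfolding lift_comult_u[OF vspace_U r]
      by (subst vs_finsum_single[OF vspace_U finite_splits i _ z]) (simp_all add: counit_u)
  qed
  then show "tensor_lift U (\<lambda>a b. \<epsilon> b \<odot>\<^bsub>U\<^esub> a) (\<Delta> h) = h"
    by (rule u_hom_eqI[OF vspace_U lin_lift_comult[OF vspace_U r] lin_id _ h])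
qed

lemma bilin_antipode_mult:
  "bilin U U U (\<lambda>a b. S a \<otimes>\<^bsub>U\<^esub> b)" "bilin U U U (\<lambda>a b. a \<otimes>\<^bsub>U\<^esub> S b)"
  by (rule bilinI;
      auto intro: alg_lin_left[OF assoc_algebra_U] alg_lin_right[OF assoc_algebra_U]
        lin_comp[OF antipode_lin alg_lin_left[OF assoc_algebra_U]]
        lin_comp[OF antipode_lin alg_lin_right[OF assoc_algebra_U]])+

text \<open>After left multiplication by the primitive element of y, any tensor of b and c
  contributes S b (-y) c + S b y c = 0. The value on x_i a is therefore zero whatever the coproduct
  of a is, in agreement with the counit.\<close>

lemma antipode_left: "h \<in> carrier U \<Longrightarrow> tensor_lift U (\<lambda>a b. S a \<otimes>\<^bsub>U\<^esub> b) (\<Delta> h) = \<epsilon> h \<odot>\<^bsub>U\<^esub> \<one>\<^bsub>U\<^esub>"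
proof (induction h rule: U_induct)
  let ?L = "tensor_lift U (\<lambda>a b. S a \<otimes>\<^bsub>U\<^esub> b)"
  note lin = lin_tensor_lift[OF vspace_U vspace_U vspace_U bilin_antipode_mult(1)]
    and tens = tensor_lift_tensor[OF vspace_U vspace_U vspace_U bilin_antipode_mult(1)]
  {
    case one
    then show ?case
      by (simp add: tens)
  next
    case (add a b)
    then show ?case
      by (simp add: lin_add[OF comult_lin] lin_add[OF lin] lin_add[OF counit_lin] vs_add_smult)
  next
    case (smult c a)
    then show ?case
      by (simp add: lin_smult[OF comult_lin] lin_smult[OF lin] lin_smult[OF counit_lin])
  next
    case (gen i a)
    have z: "?L (primitive y \<otimes>\<^bsub>UU\<^esub> (b \<otimes>\<otimes> c)) = \<zero>\<^bsub>U\<^esub>" if "b \<in> carrier U" "c \<in> carrier U" for y b c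
    proof -
      have "?L (primitive y \<otimes>\<^bsub>UU\<^esub> (b \<otimes>\<otimes> c)) = (S b \<otimes>\<^bsub>U\<^esub> \<iota> (- y)) \<otimes>\<^bsub>U\<^esub> c \<oplus>\<^bsub>U\<^esub> S b \<otimes>\<^bsub>U\<^esub> (\<iota> y \<otimes>\<^bsub>U\<^esub> c)"
        using that by (simp add: primitive_mult_tens lin_add[OF lin] tens antipode_mult antipode_gen)
      also have "\<dots> = (-1) \<odot>\<^bsub>U\<^esub> (S b \<otimes>\<^bsub>U\<^esub> (\<iota> y \<otimes>\<^bsub>U\<^esub> c)) \<oplus>\<^bsub>U\<^esub> S b \<otimes>\<^bsub>U\<^esub> (\<iota> y \<otimes>\<^bsub>U\<^esub> c)"
        using that by (simp add: \<iota>_minus alg_assoc lin_smult[OF alg_lin_left[OF assoc_algebra_U]]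
            lin_smult[OF alg_lin_right[OF assoc_algebra_U]])
      finally show ?thesis
        using that by (simp add: vs_cancel_left)
    qed
    have "?L (primitive (x i) \<otimes>\<^bsub>UU\<^esub> \<Delta> a) = \<zero>\<^bsub>U\<^esub>"
      by (rule tensor_hom_eqI[OF vspace_U vspace_U vspace_U
            lin_comp[OF UU_lin_right[OF primitive_closed] lin] lin_const_zero[OF vspace_U] z])
        (use gen in simp_all)
    then show ?case
      using gen by (simp add: comult_mult comult_gen counit_mult counit_gen)
  }
qed

text \<open>Mirror image of the preceding argument: a generator multiplied on the right ends up
  between b and S c with both signs, hence the induction that appends letters on the right.\<close>

lemma antipode_right: "h \<in> carrier U \<Longrightarrow> tensor_lift U (\<lambda>a b. a \<otimes>\<^bsub>U\<^esub> S b) (\<Delta> h) = \<epsilon> h \<odot>\<^bsub>U\<^esub> \<one>\<^bsub>U\<^esub>"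
proof (induction h rule: U_induct_right)
  let ?L = "tensor_lift U (\<lambda>a b. a \<otimes>\<^bsub>U\<^esub> S b)"
  note lin = lin_tensor_lift[OF vspace_U vspace_U vspace_U bilin_antipode_mult(2)]
    and tens = tensor_lift_tensor[OF vspace_U vspace_U vspace_U bilin_antipode_mult(2)]
  {
    case one
    then show ?case
      by (simp add: tens)
  next
    case (add a b)
    then show ?case
      by (simp add: lin_add[OF comult_lin] lin_add[OF lin] lin_add[OF counit_lin] vs_add_smult)
  next
    case (smult c a)
    then show ?case
      by (simp add: lin_smult[OF comult_lin] lin_smult[OF lin] lin_smult[OF counit_lin])
  next
    case (gen i a)
    have z: "?L ((b \<otimes>\<otimes> c) \<otimes>\<^bsub>UU\<^esub> primitive y) = \<zero>\<^bsub>U\<^esub>" if "b \<in> carrier U" "c \<in> carrier U" for y b c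
    proof -
      have "?L ((b \<otimes>\<otimes> c) \<otimes>\<^bsub>UU\<^esub> primitive y) = (b \<otimes>\<^bsub>U\<^esub> \<iota> y) \<otimes>\<^bsub>U\<^esub> S c \<oplus>\<^bsub>U\<^esub> b \<otimes>\<^bsub>U\<^esub> (\<iota> (- y) \<otimes>\<^bsub>U\<^esub> S c)"
        using that by (simp add: primitive_mult_tens lin_add[OF lin] tens antipode_mult antipode_gen)
      also have "\<dots> = b \<otimes>\<^bsub>U\<^esub> (\<iota> y \<otimes>\<^bsub>U\<^esub> S c) \<oplus>\<^bsub>U\<^esub> (-1) \<odot>\<^bsub>U\<^esub> (b \<otimes>\<^bsub>U\<^esub> (\<iota> y \<otimes>\<^bsub>U\<^esub> S c))"
        using that by (simp add: \<iota>_minus alg_assoc lin_smult[OF alg_lin_left[OF assoc_algebra_U]]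
            lin_smult[OF alg_lin_right[OF assoc_algebra_U]])
      finally show ?thesis
        using that by simp
    qed
    have "?L (\<Delta> a \<otimes>\<^bsub>UU\<^esub> primitive (x i)) = \<zero>\<^bsub>U\<^esub>"
      by (rule tensor_hom_eqI[OF vspace_U vspace_U vspace_U
            lin_comp[OF UU_lin_left[OF primitive_closed] lin] lin_const_zero[OF vspace_U] z])
        (use gen in simp_all)
    then show ?case
      using gen by (simp add: comult_mult comult_gen counit_mult counit_gen)
  }
qed

lemma hopf_algebra_U: "hopf_algebra U"
  unfolding hopf_algebra_def Let_def
  using comult_hom counit_hom antipode_lin comult_coassoc comult_counit antipode_left antipode_right
  by simp

section \<open>The deformed coproduct\<close>

definition cop :: "('n, 'k) mvps \<Rightarrow> ('n + 'n, 'k) mvps" where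
  "cop P = Mvps (\<lambda>m. pr (u (m \<circ> Inl) \<otimes>\<^bsub>U\<^esub> u (m \<circ> Inr)) P)"

lemma coeff_cop: "coeff (cop P) m = pr (u (m \<circ> Inl) \<otimes>\<^bsub>U\<^esub> u (m \<circ> Inr)) P"
  by (simp add: cop_def)

lemma comp_Inl_Inr: "case_sum a b \<circ> Inl = a" "case_sum a b \<circ> Inr = b"
  by (auto simp: fun_eq_iff)

lemma coeff_cop_case_sum: "coeff (cop P) (case_sum a b) = pr (u a \<otimes>\<^bsub>U\<^esub> u b) P"
  by (simp add: coeff_cop comp_Inl_Inr)

text \<open>Pairing \<open>u a\<close> times \<open>u b\<close> with P first applies
  \<open>\<psi> (u a)\<close> to P, and the pairing with \<open>u b\<close> then reads off the
  coefficient at b.\<close>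

lemma slice_cop: "mvps_slice (cop P) a = \<psi> (u a) P"
  by (rule mvps_eqI) (simp add: mvps_slice_def coeff_cop_case_sum pr_mult pr_u)

lemma in_supp_iff: "a \<in> supp v \<longleftrightarrow> pr v (mvps_monom a) \<noteq> 0"
  by (simp add: supp_def)

lemma pr_mult_expansion:
  assumes v: "v \<in> carrier U" and w: "w \<in> carrier U"
  shows "pr (v \<otimes>\<^bsub>U\<^esub> w) P = (\<Sum>a\<in>supp v. \<Sum>b\<in>supp w. coeff (cop P) (case_sum a b) * (pr v (mvps_monom a) * pr w (mvps_monom b)))"
proof -
  have "pr (v \<otimes>\<^bsub>U\<^esub> w) P = pr (expand v \<otimes>\<^bsub>U\<^esub> expand w) P"
    using v w by (simp add: expand_id)
  also have "\<dots> = (\<Sum>a\<in>supp v. pr v (mvps_monom a) * pr (u a \<otimes>\<^bsub>U\<^esub> expand w) P)"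
    unfolding expand_def[of v] using w
    by (subst lin_finsum[OF vspace_U vspace_scalars lin_comp[OF alg_lin_left[OF assoc_algebra_U] pr_lin_left]])
      (simp_all add: expand_id lin_smult[OF alg_lin_left[OF assoc_algebra_U]] pr_smult_left)
  also have "\<dots> = (\<Sum>a\<in>supp v. pr v (mvps_monom a) * (\<Sum>b\<in>supp w. pr w (mvps_monom b) * pr (u a \<otimes>\<^bsub>U\<^esub> u b) P))"
    unfolding expand_def[of w] using v
    by (subst lin_finsum[OF vspace_U vspace_scalars lin_comp[OF alg_lin_right[OF assoc_algebra_U u_closed] pr_lin_left]])
      (simp_all add: lin_smult[OF alg_lin_right[OF assoc_algebra_U]] pr_smult_left)
  finally show ?thesis
    by (simp add: coeff_cop_case_sum sum_distrib_left mult_ac)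
qed

lemma Sum_any_cop:
  assumes v: "v \<in> carrier U" and w: "w \<in> carrier U"
  shows "Sum_any (\<lambda>(a, b). coeff (cop P) (case_sum a b) * (pr v (mvps_monom a) * pr w (mvps_monom b))) = pr (v \<otimes>\<^bsub>U\<^esub> w) P"
proof -
  have "Sum_any (\<lambda>(a, b). coeff (cop P) (case_sum a b) * (pr v (mvps_monom a) * pr w (mvps_monom b))) =
      (\<Sum>(a, b)\<in>supp v \<times> supp w. coeff (cop P) (case_sum a b) * (pr v (mvps_monom a) * pr w (mvps_monom b)))"
    by (rule Sum_any.expand_superset) (use v w in \<open>auto simp: in_supp_iff\<close>)
  then show ?thesis
    using v w by (simp add: pr_mult_expansion sum.cartesian_product)
qed

text \<open>The coproduct, the identity and the dual antipode all have pairings with fixed elements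
  of U as their coefficients. Hence every map needed in the coassociativity and antipode laws is
  evaluated by this one formula, as a pairing with a product in U.\<close>

lemma tensor_map_cop:
  assumes v: "v \<in> carrier U" and w: "w \<in> carrier U"
    and f: "\<And>a. coeff (f (mvps_monom a)) (m \<circ> Inl) = pr v (mvps_monom a)"
    and g: "\<And>b. coeff (g (mvps_monom b)) (m \<circ> Inr) = pr w (mvps_monom b)"
  shows "coeff (tensor_map f g (cop P)) m = pr (v \<otimes>\<^bsub>U\<^esub> w) P"
  using Sum_any_cop[OF v w, of P] by (simp add: tensor_map_def f g mult.assoc)

text \<open>The transpose of the antipode of U with respect to the pairing.\<close>

definition dual_antipode :: "('n, 'k) mvps \<Rightarrow> ('n, 'k) mvps" where
  "dual_antipode P = Mvps (\<lambda>a. pr (S (u a)) P)"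

lemma lift_finsum_u:
  "vspace Z \<Longrightarrow> bilin U U Z f \<Longrightarrow> h \<in> linear_hom Z scalars \<Longrightarrow>
    h (tensor_lift Z f (\<Delta> (u m))) = (\<Sum>p\<in>splits m. h (f (u (fst p)) (u (snd p))))"
  by (simp add: lift_comult_u lin_finsum[OF _ vspace_scalars] bilin_closed)

lemma comult_u_mult: "\<Delta> (u a \<otimes>\<^bsub>U\<^esub> u b) = (\<Oplus>\<^bsub>tensor_space U U\<^esub>p\<in>splits a. \<Oplus>\<^bsub>tensor_space U U\<^esub>q\<in>splits b.
    (u (fst p) \<otimes>\<^bsub>U\<^esub> u (fst q)) \<otimes>\<otimes> (u (snd p) \<otimes>\<^bsub>U\<^esub> u (snd q)))"
proof -
  have "\<Delta> (u a \<otimes>\<^bsub>U\<^esub> u b) = (\<Oplus>\<^bsub>tensor_space U U\<^esub>p\<in>splits a. (u (fst p) \<otimes>\<otimes> u (snd p)) \<otimes>\<^bsub>UU\<^esub> \<Delta> (u b))"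
    unfolding comult_mult[OF u_closed u_closed] comult_u[of a]
    by (rule lin_finsum[OF vspace_UU(2) vspace_UU(2) UU_lin_left]) simp_all
  also have "\<dots> = (\<Oplus>\<^bsub>tensor_space U U\<^esub>p\<in>splits a. \<Oplus>\<^bsub>tensor_space U U\<^esub>q\<in>splits b.
      (u (fst p) \<otimes>\<otimes> u (snd p)) \<otimes>\<^bsub>UU\<^esub> (u (fst q) \<otimes>\<otimes> u (snd q)))"
    unfolding comult_u[of b]
    by (rule vs_finsum_cong) (simp_all add: lin_finsum[OF vspace_UU(2) vspace_UU(2) UU_lin_right])
  finally show ?thesis
    by simp
qed

text \<open>Pairing a product of dual basis elements with P Q amounts to pairing its coproduct with
  P \<otimes> Q. This is a sum over the splittings of both exponents, which is how power series in
  the doubled set of variables are multiplied.\<close>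

lemma cop_mult: "cop (P * Q) = cop P * cop Q"
proof (rule mvps_eqI)
  fix m :: "'n + 'n \<Rightarrow> nat"
  let ?a = "m \<circ> Inl" and ?b = "m \<circ> Inr"
  have "coeff (cop (P * Q)) m = pr2 P Q (\<Delta> (u ?a \<otimes>\<^bsub>U\<^esub> u ?b))"
    by (simp add: coeff_cop pr_times)
  also have "\<dots> = (\<Sum>p\<in>splits ?a. \<Sum>q\<in>splits ?b.
      pr (u (fst p) \<otimes>\<^bsub>U\<^esub> u (fst q)) P * pr (u (snd p) \<otimes>\<^bsub>U\<^esub> u (snd q)) Q)"
    unfolding comult_u_mult by (simp add: lin_finsum[OF vspace_UU(2) vspace_scalars pr2_lin] pr2_tens)
  also have "\<dots> = coeff (cop P * cop Q) (case_sum ?a ?b)"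
    by (simp add: coeff_times_case_sum coeff_cop_case_sum case_prod_unfold)
  finally show "coeff (cop (P * Q)) m = coeff (cop P * cop Q) m"
    by (simp add: case_sum_Inl_Inr)
qed

lemma cop_one: "cop 1 = 1"
proof (rule mvps_eqI)
  fix m :: "'n + 'n \<Rightarrow> nat"
  show "coeff (cop 1) m = coeff 1 m"
    using case_sum_zero_iff[of "m \<circ> Inl" "m \<circ> Inr"]
    by (simp add: coeff_cop pr_unit counit_mult counit_u coeff_one case_sum_Inl_Inr)
qed

lemma topological_hopf_algebra_cop: "topological_hopf_algebra cop"
  unfolding topological_hopf_algebra_def
proof (intro conjI allI)
  show "continuous_linear cop"
    by (simp add: continuous_linear_def coeff_cop pr_continuous)
  show "cop 1 = 1"
    by (rule cop_one)
  show "cop (P * Q) = cop P * cop Q" for P Q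
    by (rule cop_mult)
  show "reassoc (tensor_map cop id (cop P)) = tensor_map id cop (cop P)" for P
  proof (rule mvps_eqI)
    fix m :: "'n + ('n + 'n) \<Rightarrow> nat"
    let ?i = "m \<circ> Inl" and ?j = "m \<circ> Inr \<circ> Inl" and ?l = "m \<circ> Inr \<circ> Inr"
    have "coeff (reassoc (tensor_map cop id (cop P))) m = coeff (tensor_map cop id (cop P)) (case_sum (case_sum ?i ?j) ?l)"
      by (simp add: reassoc_def)
    also have "\<dots> = pr ((u ?i \<otimes>\<^bsub>U\<^esub> u ?j) \<otimes>\<^bsub>U\<^esub> u ?l) P"
      by (rule tensor_map_cop) (simp_all add: comp_Inl_Inr coeff_cop_case_sum pr_u)
    also have "\<dots> = pr (u ?i \<otimes>\<^bsub>U\<^esub> (u ?j \<otimes>\<^bsub>U\<^esub> u ?l)) P"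
      by (simp add: alg_assoc)
    also have "\<dots> = coeff (tensor_map id cop (cop P)) m"
      by (rule tensor_map_cop[symmetric]) (simp_all add: coeff_cop pr_u)
    finally show "coeff (reassoc (tensor_map cop id (cop P))) m = coeff (tensor_map id cop (cop P)) m" .
  qed
  show "coeff (cop P) (case_sum (\<lambda>_. 0) m) = coeff P m" for P m
    by (simp add: coeff_cop_case_sum u_zero pr_u)
  show "coeff (cop P) (case_sum m (\<lambda>_. 0)) = coeff P m" for P m
    by (simp add: coeff_cop_case_sum u_zero pr_u)
  have e: "pr (\<epsilon> (u m) \<odot>\<^bsub>U\<^esub> \<one>\<^bsub>U\<^esub>) P = coeff (mvps_scale (const_term P) 1) m" for P m
    by (simp add: pr_smult_left counit_u coeff_one)
  have l: "coeff (tensor_map dual_antipode id (cop P)) (case_sum a b) = pr (S (u a) \<otimes>\<^bsub>U\<^esub> u b) P" for P a b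
    by (rule tensor_map_cop) (simp_all add: comp_Inl_Inr dual_antipode_def pr_u)
  have r: "coeff (tensor_map id dual_antipode (cop P)) (case_sum a b) = pr (u a \<otimes>\<^bsub>U\<^esub> S (u b)) P" for P a b
    by (rule tensor_map_cop) (simp_all add: comp_Inl_Inr dual_antipode_def pr_u)
  show "\<exists>S. continuous_linear S \<and>
      (\<forall>P. mvps_fold (tensor_map S id (cop P)) = mvps_scale (const_term P) 1) \<and>
      (\<forall>P. mvps_fold (tensor_map id S (cop P)) = mvps_scale (const_term P) 1)"
  proof (intro exI[of _ dual_antipode] conjI allI)
    show "continuous_linear dual_antipode"
      by (simp add: continuous_linear_def dual_antipode_def pr_continuous)
    show "mvps_fold (tensor_map dual_antipode id (cop P)) = mvps_scale (const_term P) 1" for P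
      using lift_finsum_u[OF vspace_U bilin_antipode_mult(1) pr_lin_left[of P]]
      by (intro mvps_eqI) (simp add: mvps_fold_def l case_prod_unfold antipode_left e)
    show "mvps_fold (tensor_map id dual_antipode (cop P)) = mvps_scale (const_term P) 1" for P
      using lift_finsum_u[OF vspace_U bilin_antipode_mult(2) pr_lin_left[of P]]
      by (intro mvps_eqI) (simp add: mvps_fold_def r case_prod_unfold antipode_right e)
  qed
qed

lemma hopf_pairing_pr: "hopf_pairing U cop pr"
  unfolding hopf_pairing_def
  using pr_lin_left pr_continuous pr_times Sum_any_cop pr_unit pr_one
  by (simp add: pr2_def)

lemma heisenberg_data_pr: "heisenberg_data U cop pr"
  unfolding heisenberg_data_def
  using hopf_algebra_U topological_hopf_algebra_cop hopf_pairing_pr by simp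

end

section \<open>Free products\<close>

context
  fixes A :: "('k::field, 'a, 'x) module_scheme" and j :: "'a \<Rightarrow> 's" and X :: "'s set"
  assumes A: "assoc_algebra A" and j: "\<And>a. a \<in> carrier A \<Longrightarrow> j a \<in> X"
begin

private lemma A_vspace: "vspace A"
  using A by (rule assoc_algebra_vspace)

private lemma free_closed:
  fixes r s :: "'s free_monoid \<Rightarrow>\<^sub>0 'k"
  assumes "r \<in> carrier (free_algebra X)" "s \<in> carrier (free_algebra X)"
  shows "r + s \<in> carrier (free_algebra X)" "r - s \<in> carrier (free_algebra X)"
    "r * s \<in> carrier (free_algebra X)"
proof -
  note FA = assoc_algebra_free_algebra[of X] and V = assoc_algebra_vspace[OF assoc_algebra_free_algebra[of X]]
  show "r + s \<in> carrier (free_algebra X)"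
    using vs_add[OF V assms] by simp
  show "r * s \<in> carrier (free_algebra X)"
    using alg_mult[OF FA assms] by simp
  show "r - s \<in> carrier (free_algebra X)"
    using vs_add[OF V assms(1) vs_smult[OF V assms(2), of "-1"]] by (simp add: scale_pm_minus)
qed

private lemma scale_closed: "r \<in> carrier (free_algebra X) \<Longrightarrow> scale_pm c r \<in> carrier (free_algebra X)"
  for r :: "'s free_monoid \<Rightarrow>\<^sub>0 'k"
  using vs_smult[OF assoc_algebra_vspace[OF assoc_algebra_free_algebra[of X]], of r c] by simp

private lemma gen_closed: "a \<in> carrier A \<Longrightarrow> (gen (j a) :: _ \<Rightarrow>\<^sub>0 'k) \<in> carrier (free_algebra X)"
  using j by (rule gen_in_free_algebra)

private lemma hom_relations_cases:
  assumes "r \<in> hom_relations A j"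
  obtains (add) a b where "a \<in> carrier A" "b \<in> carrier A" "r = gen (j (a \<oplus>\<^bsub>A\<^esub> b)) - (gen (j a) + gen (j b))"
    | (scale) c a where "a \<in> carrier A" "r = gen (j (c \<odot>\<^bsub>A\<^esub> a)) - scale_pm c (gen (j a))"
    | (mult) a b where "a \<in> carrier A" "b \<in> carrier A" "r = gen (j (a \<otimes>\<^bsub>A\<^esub> b)) - gen (j a) * gen (j b)"
    | (one) "r = gen (j \<one>\<^bsub>A\<^esub>) - 1"
  using assms unfolding hom_relations_def by blast

private lemma hom_relations_mem:
  "a \<in> carrier A \<Longrightarrow> b \<in> carrier A \<Longrightarrow> gen (j (a \<oplus>\<^bsub>A\<^esub> b)) - (gen (j a) + gen (j b)) \<in> hom_relations A j"
  "a \<in> carrier A \<Longrightarrow> gen (j (c \<odot>\<^bsub>A\<^esub> a)) - scale_pm c (gen (j a)) \<in> hom_relations A j"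
  "a \<in> carrier A \<Longrightarrow> b \<in> carrier A \<Longrightarrow> gen (j (a \<otimes>\<^bsub>A\<^esub> b)) - gen (j a) * gen (j b) \<in> hom_relations A j"
  "gen (j \<one>\<^bsub>A\<^esub>) - 1 \<in> hom_relations A j"
  unfolding hom_relations_def by blast+

private lemma one_closed: "(1 :: 's free_monoid \<Rightarrow>\<^sub>0 'k) \<in> carrier (free_algebra X)"
  using alg_one[OF assoc_algebra_free_algebra, of X] by simp

lemma hom_relations_closed: "hom_relations A j \<subseteq> carrier (free_algebra X)"
proof
  show "r \<in> carrier (free_algebra X)" if "r \<in> hom_relations A j" for r
    using that
    by (cases rule: hom_relations_cases; hypsubst; intro free_closed scale_closed gen_closed one_closed)
      (use A A_vspace in simp_all)
qed

lemma hom_relations_hom: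
  assumes R: "R \<subseteq> carrier (free_algebra X)" and sub: "hom_relations A j \<subseteq> R"
  shows "(\<lambda>a. pres_gen X R (j a)) \<in> algebra_hom A (presented_algebra X R)"
proof -
  let ?F = "free_algebra X :: ('k, _) module"
  let ?Q = "presented_algebra X R"
  define q where "q r = (Idl\<^bsub>?F\<^esub> R) +>\<^bsub>?F\<^esub> r" for r
  have "(\<lambda>r. q r) \<in> algebra_hom ?F ?Q"
    using pres_coset_hom[OF R] unfolding q_def .
  then have q: "q \<in> algebra_hom ?F ?Q"
    by simp
  note L = alg_hom_lin[OF q] and V = assoc_algebra_vspace[OF assoc_algebra_presented_algebra[OF R]]
  have q_add: "q (r + s) = q r \<oplus>\<^bsub>?Q\<^esub> q s" if "r \<in> carrier ?F" "s \<in> carrier ?F" for r s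
    using lin_add[OF L that] by simp
  have q_scale: "q (scale_pm c r) = c \<odot>\<^bsub>?Q\<^esub> q r" if "r \<in> carrier ?F" for c r
    using lin_smult[OF L that] by simp
  have q_mult: "q (r * s) = q r \<otimes>\<^bsub>?Q\<^esub> q s" if "r \<in> carrier ?F" "s \<in> carrier ?F" for r s
    using alg_hom_mult[OF q that] by simp
  have eq: "q r = q s" if "r - s \<in> hom_relations A j" "r \<in> carrier ?F" "s \<in> carrier ?F" for r s
  proof (rule vs_eqI[OF V lin_closed[OF L that(2)] lin_closed[OF L that(3)]])
    have "q (r - s) = \<zero>\<^bsub>?Q\<^esub>"
      using pres_relation[OF R] that(1) sub by (auto simp: q_def)
    then show "q r \<oplus>\<^bsub>?Q\<^esub> (-1) \<odot>\<^bsub>?Q\<^esub> q s = \<zero>\<^bsub>?Q\<^esub>"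
      using that(2,3) scale_closed[OF that(3), of "-1"]
      by (simp add: q_add[symmetric] q_scale[symmetric] scale_pm_minus del: free_algebra_simps(1))
  qed
  have gen: "pres_gen X R (j a) = q (gen (j a))" for a
    by (simp add: pres_gen_def q_def)
  note cl = gen_closed free_closed scale_closed
  show ?thesis
    unfolding gen
  proof (intro algebra_homI linear_homI)
    show "q (gen (j a)) \<in> carrier ?Q" if "a \<in> carrier A" for a
      by (rule lin_closed[OF L gen_closed[OF that]])
    show "q (gen (j (a \<oplus>\<^bsub>A\<^esub> b))) = q (gen (j a)) \<oplus>\<^bsub>?Q\<^esub> q (gen (j b))" if "a \<in> carrier A" "b \<in> carrier A" for a b
      unfolding q_add[OF gen_closed[OF that(1)] gen_closed[OF that(2)], symmetric] using that A_vspace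
      by (intro eq cl hom_relations_mem) simp_all
    show "q (gen (j (c \<odot>\<^bsub>A\<^esub> a))) = c \<odot>\<^bsub>?Q\<^esub> q (gen (j a))" if "a \<in> carrier A" for c a
      unfolding q_scale[OF gen_closed[OF that], symmetric] using that A_vspace
      by (intro eq cl hom_relations_mem) simp_all
    show "q (gen (j (a \<otimes>\<^bsub>A\<^esub> b))) = q (gen (j a)) \<otimes>\<^bsub>?Q\<^esub> q (gen (j b))" if "a \<in> carrier A" "b \<in> carrier A" for a b
      unfolding q_mult[OF gen_closed[OF that(1)] gen_closed[OF that(2)], symmetric] using that A
      by (intro eq cl hom_relations_mem) simp_all
    have "q (gen (j \<one>\<^bsub>A\<^esub>)) = q 1"
      using A alg_one[OF assoc_algebra_free_algebra, of X] by (intro eq cl one_closed hom_relations_mem) simp_all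
    then show "q (gen (j \<one>\<^bsub>A\<^esub>)) = \<one>\<^bsub>?Q\<^esub>"
      using alg_hom_one[OF q] by simp
  qed
qed

text \<open>Applied once for each factor of a free product, so X may contain more generators than
  the image of j, and f has to come from a homomorphism only along j.\<close>

lemma free_lift_hom_relations:
  assumes B: "assoc_algebra B" and f: "\<And>x. x \<in> X \<Longrightarrow> f x \<in> carrier B"
    and h: "h \<in> algebra_hom A B" and fj: "\<And>a. a \<in> carrier A \<Longrightarrow> f (j a) = h a"
    and r: "r \<in> hom_relations A j"
  shows "free_lift B f r = \<zero>\<^bsub>B\<^esub>"
proof -
  let ?F = "free_algebra X :: ('k, _) module"
  have vB: "vspace B"
    using B by (rule assoc_algebra_vspace)
  have L: "free_lift B f \<in> linear_hom ?F B"
    using B f by (rule lin_free_lift)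
  have H: "free_lift B f \<in> algebra_hom ?F B"
    using B f by (rule free_lift_hom)
  have gen: "free_lift B f (gen (j a)) = h a" if "a \<in> carrier A" for a
    using free_lift_gen[OF B f j[OF that]] fj[OF that] by simp
  have diff: "free_lift B f (r - s) = \<zero>\<^bsub>B\<^esub>"
    if "r \<in> carrier ?F" "s \<in> carrier ?F" "free_lift B f r = free_lift B f s" for r s
  proof -
    have "free_lift B f (r - s) = free_lift B f r \<oplus>\<^bsub>B\<^esub> (-1) \<odot>\<^bsub>B\<^esub> free_lift B f s"
      by (rule free_lift_diff[OF B f that(1,2)])
    then show ?thesis
      using vB lin_closed[OF L that(2)] by (simp add: that(3))
  qed
  note cl = gen_closed free_closed scale_closed
  from r show ?thesis
  proof (cases rule: hom_relations_cases)
    case (add a b)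
    have "free_lift B f (gen (j a) + gen (j b)) = h a \<oplus>\<^bsub>B\<^esub> h b"
      using lin_add[OF L gen_closed[OF add(1)] gen_closed[OF add(2)]] add by (simp add: gen)
    then show ?thesis
      unfolding add(3) using add A_vspace by (intro diff cl) (simp_all add: gen lin_add[OF alg_hom_lin[OF h]])
  next
    case (scale c a)
    have "free_lift B f (scale_pm c (gen (j a))) = c \<odot>\<^bsub>B\<^esub> h a"
      using lin_smult[OF L gen_closed[OF scale(1)]] scale by (simp add: gen)
    then show ?thesis
      unfolding scale(2) using scale A_vspace by (intro diff cl) (simp_all add: gen lin_smult[OF alg_hom_lin[OF h]])
  next
    case (mult a b)
    have "free_lift B f (gen (j a) * gen (j b)) = h a \<otimes>\<^bsub>B\<^esub> h b"
      using alg_hom_mult[OF H gen_closed[OF mult(1)] gen_closed[OF mult(2)]] mult by (simp add: gen)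
    then show ?thesis
      unfolding mult(3) using mult A by (intro diff cl) (simp_all add: gen alg_hom_mult[OF h])
  next
    case one
    have "free_lift B f 1 = \<one>\<^bsub>B\<^esub>"
      using alg_hom_one[OF H] by simp
    then show ?thesis
      unfolding one using A alg_one[OF assoc_algebra_free_algebra, of X]
      by (intro diff cl) (simp_all add: gen alg_hom_one[OF h])
  qed
qed

end

context
  fixes A :: "('k::field, 'a, 'x) module_scheme" and B :: "('k, 'b, 'y) module_scheme"
  assumes A: "assoc_algebra A" and B: "assoc_algebra B"
begin

lemma free_product_relations_closed:
  "hom_relations A Inl \<union> hom_relations B Inr \<subseteq> carrier (free_algebra (carrier A <+> carrier B))"
  using hom_relations_closed[OF A, of Inl "carrier A <+> carrier B"]
    hom_relations_closed[OF B, of Inr "carrier A <+> carrier B"] by blast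

lemma assoc_algebra_free_product: "assoc_algebra (free_product A B)"
  unfolding free_product_def by (rule assoc_algebra_presented_algebra[OF free_product_relations_closed])

lemma free_product_Inl: "(\<lambda>a. free_product_gen A B (Inl a)) \<in> algebra_hom A (free_product A B)"
  unfolding free_product_def free_product_gen_def
  by (rule hom_relations_hom[OF A _ free_product_relations_closed]) auto

lemma free_product_Inr: "(\<lambda>b. free_product_gen A B (Inr b)) \<in> algebra_hom B (free_product A B)"
  unfolding free_product_def free_product_gen_def
  by (rule hom_relations_hom[OF B _ free_product_relations_closed]) auto

lemma free_product_lift:
  assumes C: "assoc_algebra C" and f: "f \<in> algebra_hom A C" and g: "g \<in> algebra_hom B C"
  shows "pres_lift C (case_sum f g) \<in> algebra_hom (free_product A B) C"
    and "a \<in> carrier A \<Longrightarrow> pres_lift C (case_sum f g) (free_product_gen A B (Inl a)) = f a"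
    and "b \<in> carrier B \<Longrightarrow> pres_lift C (case_sum f g) (free_product_gen A B (Inr b)) = g b"
proof -
  have c: "case_sum f g y \<in> carrier C" if "y \<in> carrier A <+> carrier B" for y
    using that lin_closed[OF alg_hom_lin[OF f]] lin_closed[OF alg_hom_lin[OF g]] by auto
  have k: "free_lift C (case_sum f g) r = \<zero>\<^bsub>C\<^esub>" if "r \<in> hom_relations A Inl \<union> hom_relations B Inr" for r
    using that
  proof
    assume "r \<in> hom_relations A Inl"
    then show ?thesis
      by (rule free_lift_hom_relations[OF A _ C c f, rotated 3]) auto
  next
    assume "r \<in> hom_relations B Inr"
    then show ?thesis
      by (rule free_lift_hom_relations[OF B _ C c g, rotated 3]) auto
  qed
  have gen: "pres_lift C (case_sum f g) (pres_gen (carrier A <+> carrier B) (hom_relations A Inl \<union> hom_relations B Inr) y)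
      = case_sum f g y" if "y \<in> carrier A <+> carrier B" for y
    by (rule pres_lift_gen[OF free_product_relations_closed C c k that])
  show "pres_lift C (case_sum f g) \<in> algebra_hom (free_product A B) C"
    unfolding free_product_def by (rule pres_lift_hom[OF free_product_relations_closed C c k])
  show "a \<in> carrier A \<Longrightarrow> pres_lift C (case_sum f g) (free_product_gen A B (Inl a)) = f a"
    unfolding free_product_gen_def using gen[OF InlI, of a] by simp
  show "b \<in> carrier B \<Longrightarrow> pres_lift C (case_sum f g) (free_product_gen A B (Inr b)) = g b"
    unfolding free_product_gen_def using gen[OF InrI, of b] by simp
qed

lemma free_product_induct [case_names one add smult left right]:
  assumes y: "y \<in> carrier (free_product A B)" and one: "P \<one>\<^bsub>free_product A B\<^esub>"
    and add: "\<And>y z. y \<in> carrier (free_product A B) \<Longrightarrow> z \<in> carrier (free_product A B) \<Longrightarrow> P y \<Longrightarrow> P z \<Longrightarrow>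
      P (y \<oplus>\<^bsub>free_product A B\<^esub> z)"
    and smult: "\<And>c y. y \<in> carrier (free_product A B) \<Longrightarrow> P y \<Longrightarrow> P (c \<odot>\<^bsub>free_product A B\<^esub> y)"
    and left: "\<And>a y. a \<in> carrier A \<Longrightarrow> y \<in> carrier (free_product A B) \<Longrightarrow> P y \<Longrightarrow>
      P (free_product_gen A B (Inl a) \<otimes>\<^bsub>free_product A B\<^esub> y)"
    and right: "\<And>b y. b \<in> carrier B \<Longrightarrow> y \<in> carrier (free_product A B) \<Longrightarrow> P y \<Longrightarrow>
      P (free_product_gen A B (Inr b) \<otimes>\<^bsub>free_product A B\<^esub> y)"
  shows "P y"
  by (rule presented_algebra_induct[OF free_product_relations_closed y[unfolded free_product_def]])
    (use one add smult left right in \<open>auto simp: free_product_def free_product_gen_def\<close>)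

end

lemma vs_finsum_swap:
  assumes V: "vspace V" and fin: "finite I" "finite J" and f: "\<And>i j. i \<in> I \<Longrightarrow> j \<in> J \<Longrightarrow> f i j \<in> carrier V"
  shows "(\<Oplus>\<^bsub>V\<^esub>i\<in>I. \<Oplus>\<^bsub>V\<^esub>j\<in>J. f i j) = (\<Oplus>\<^bsub>V\<^esub>j\<in>J. \<Oplus>\<^bsub>V\<^esub>i\<in>I. f i j)"
proof -
  have "(\<Oplus>\<^bsub>V\<^esub>i\<in>I. \<Oplus>\<^bsub>V\<^esub>j\<in>J. f i j) = (\<Oplus>\<^bsub>V\<^esub>p\<in>prod.swap ` (J \<times> I). f (fst p) (snd p))"
    using fin f by (simp add: vs_finsum_Sigma[OF V] product_swap)
  also have "\<dots> = (\<Oplus>\<^bsub>V\<^esub>p\<in>J \<times> I. f (snd p) (fst p))"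
    by (subst vs_finsum_reindex[OF V]) (use f in \<open>auto simp: inj_on_def\<close>)
  also have "\<dots> = (\<Oplus>\<^bsub>V\<^esub>j\<in>J. \<Oplus>\<^bsub>V\<^esub>i\<in>I. f i j)"
    using fin f by (subst vs_finsum_Sigma[OF V]) simp_all
  finally show ?thesis .
qed

context leading_delta_action
begin

section \<open>The twisted Weyl algebra\<close>

abbreviation Sf :: "('k, ('n, 'k) mvps) module" where "Sf \<equiv> mvps_algebra"
abbreviation T :: "('k, _) module" where "T \<equiv> tensor_space U Sf"
abbreviation tw where "tw a P \<equiv> tensor U Sf a P"
abbreviation W :: "('k, _) module" where "W \<equiv> twisted_weyl_algebra U \<phi>"

lemma vspace_T [simp]: "vspace T"
  by (rule vspace_tensor_space) (simp_all add: vspace_mvps)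

lemma bilin_tw: "bilin U Sf T tw"
  by (rule bilin_tensor) (simp_all add: vspace_mvps)

lemma tw_closed [simp]: "a \<in> carrier U \<Longrightarrow> tw a P \<in> carrier T"
  by (rule bilin_closed[OF bilin_tw]) simp_all

lemma tw_lin: "(\<lambda>a. tw a P) \<in> linear_hom U T" "a \<in> carrier U \<Longrightarrow> (\<lambda>P. tw a P) \<in> linear_hom Sf T"
  using bilin_left[OF bilin_tw] bilin_right[OF bilin_tw] by simp_all

lemma times_lin: "(\<lambda>P. P * Q) \<in> linear_hom Sf Sf" "(\<lambda>P. Q * P) \<in> linear_hom Sf Sf"
  using alg_lin_left[OF assoc_algebra_mvps, of Q] alg_lin_right[OF assoc_algebra_mvps, of Q] by simp_all

text \<open>The summand of the smash product of a \<otimes> P with b \<otimes> Q that belongs to the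
  components b1 and b2 of the coproduct of b.\<close>

definition wt where "wt a P Q b1 b2 = tw (a \<otimes>\<^bsub>U\<^esub> b1) (\<psi> b2 P * Q)"

lemma wt_lin:
  "a \<in> carrier U \<Longrightarrow> b2 \<in> carrier U \<Longrightarrow> (\<lambda>b1. wt a P Q b1 b2) \<in> linear_hom U T"
  "a \<in> carrier U \<Longrightarrow> b1 \<in> carrier U \<Longrightarrow> (\<lambda>b2. wt a P Q b1 b2) \<in> linear_hom U T"
  "b1 \<in> carrier U \<Longrightarrow> b2 \<in> carrier U \<Longrightarrow> (\<lambda>a. wt a P Q b1 b2) \<in> linear_hom U T"
  "a \<in> carrier U \<Longrightarrow> b1 \<in> carrier U \<Longrightarrow> b2 \<in> carrier U \<Longrightarrow> (\<lambda>P. wt a P Q b1 b2) \<in> linear_hom Sf T"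
  "a \<in> carrier U \<Longrightarrow> b1 \<in> carrier U \<Longrightarrow> b2 \<in> carrier U \<Longrightarrow> (\<lambda>Q. wt a P Q b1 b2) \<in> linear_hom Sf T"
  unfolding wt_def
  by (rule lin_comp[OF alg_lin_right[OF assoc_algebra_U] tw_lin(1)], simp,
      rule lin_comp[OF lin_comp[OF \<psi>_lin_left times_lin(1)] tw_lin(2)], simp,
      rule lin_comp[OF alg_lin_left[OF assoc_algebra_U] tw_lin(1)], simp,
      rule lin_comp[OF lin_comp[OF \<psi>_lin times_lin(1)] tw_lin(2)], simp_all,
      rule lin_comp[OF times_lin(2) tw_lin(2)], simp)

lemma bilin_wt: "a \<in> carrier U \<Longrightarrow> bilin U U T (wt a P Q)"
  by (rule bilinI) (simp_all add: wt_lin)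

definition wm where "wm a P b Q = tensor_lift T (wt a P Q) (\<Delta> b)"

lemma bilin_wm:
  "a \<in> carrier U \<Longrightarrow> bilin U Sf T (wm a P)"
  "b \<in> carrier U \<Longrightarrow> bilin U Sf T (\<lambda>a P. wm a P b Q)"
proof -
  show "bilin U Sf T (wm a P)" if "a \<in> carrier U"
    unfolding wm_def[abs_def]
  proof (rule bilinI)
    show "(\<lambda>Q. tensor_lift T (wt a P Q) (\<Delta> b)) \<in> linear_hom Sf T" if "b \<in> carrier U" for b
      by (rule tensor_lift_param[OF vspace_U vspace_U vspace_T vspace_mvps bilin_wt wt_lin(5)])
        (use \<open>a \<in> carrier U\<close> that in simp_all)
  qed (rule lin_lift_comult[OF vspace_T bilin_wt[OF that]])
  show "bilin U Sf T (\<lambda>a P. wm a P b Q)" if b: "b \<in> carrier U"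
    unfolding wm_def
  proof (rule bilinI)
    show "(\<lambda>P. tensor_lift T (wt a P Q) (\<Delta> b)) \<in> linear_hom Sf T" if "a \<in> carrier U" for a
      by (rule tensor_lift_param[OF vspace_U vspace_U vspace_T vspace_mvps bilin_wt wt_lin(4)])
        (use that b in simp_all)
    show "(\<lambda>a. tensor_lift T (wt a P Q) (\<Delta> b)) \<in> linear_hom U T" for P
      by (rule tensor_lift_param[OF vspace_U vspace_U vspace_T vspace_U bilin_wt wt_lin(3)])
        (use b in simp_all)
  qed
qed

lemma wm_closed [simp]: "a \<in> carrier U \<Longrightarrow> b \<in> carrier U \<Longrightarrow> wm a P b Q \<in> carrier T"
  by (rule bilin_closed[OF bilin_wm(1)]) simp_all

lemma W_simps [simp]:
  "carrier W = carrier T" "add W = add T" "zero W = zero T" "smult W = smult T" "one W = tw \<one>\<^bsub>U\<^esub> 1"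
  by (simp_all add: twisted_weyl_algebra_def smash_product_def Let_def)

lemma W_mult: "Y \<otimes>\<^bsub>W\<^esub> Z = tensor_lift T (\<lambda>a P. tensor_lift T (wm a P) Z) Y"
  by (simp add: twisted_weyl_algebra_def smash_product_def Let_def wm_def[abs_def] wt_def[abs_def] \<psi>_def)

lemma bilin_W_mult: "bilin T T T (mult W)"
  using tensor_lift2(1)[OF vspace_U vspace_mvps vspace_U vspace_mvps vspace_T bilin_wm]
  by (simp add: W_mult[abs_def])

lemma W_mult_tw: "a \<in> carrier U \<Longrightarrow> b \<in> carrier U \<Longrightarrow> tw a P \<otimes>\<^bsub>W\<^esub> tw b Q = wm a P b Q"
  unfolding W_mult
  by (rule tensor_lift2(3)[OF vspace_U vspace_mvps vspace_U vspace_mvps vspace_T bilin_wm]) simp_all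

lemma W_closed [simp]: "Y \<in> carrier T \<Longrightarrow> Z \<in> carrier T \<Longrightarrow> Y \<otimes>\<^bsub>W\<^esub> Z \<in> carrier T"
  by (rule bilin_closed[OF bilin_W_mult])

lemma W_lin_left: "Z \<in> carrier T \<Longrightarrow> (\<lambda>Y. Y \<otimes>\<^bsub>W\<^esub> Z) \<in> linear_hom T T"
  by (rule bilin_left[OF bilin_W_mult])

lemma W_lin_right: "Y \<in> carrier T \<Longrightarrow> (\<lambda>Z. Y \<otimes>\<^bsub>W\<^esub> Z) \<in> linear_hom T T"
  by (rule bilin_right[OF bilin_W_mult])

lemma wm_one: "a \<in> carrier U \<Longrightarrow> wm a P \<one>\<^bsub>U\<^esub> Q = tw a (P * Q)"
  unfolding wm_def by (simp add: tensor_lift_tensor[OF vspace_U vspace_U vspace_T bilin_wt]) (simp add: wt_def)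

lemma wm_u: "a \<in> carrier U \<Longrightarrow> wm a P (u c) Q = (\<Oplus>\<^bsub>T\<^esub>p\<in>splits c. wt a P Q (u (fst p)) (u (snd p)))"
  unfolding wm_def by (rule lift_comult_u[OF vspace_T bilin_wt])

lemma wt_closed [simp]: "a \<in> carrier U \<Longrightarrow> b \<in> carrier U \<Longrightarrow> wt a P Q b c \<in> carrier T"
  by (simp add: wt_def)

lemma \<psi>_u_times: "\<psi> (u c) (P * Q) = (\<Sum>p\<in>splits c. \<psi> (u (fst p)) P * \<psi> (u (snd p)) Q)"
  using \<psi>_times[of "u c" P Q] lift_comult_u[OF vspace_mvps bilin_\<psi>_product, of P Q c] by simp

lemma \<psi>_times_unit:
  assumes "a \<in> carrier U"
  shows "\<psi> a 1 = mvps_scale (\<epsilon> a) 1"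
  using assms
proof (induction a rule: U_induct)
  case (gen i a)
  then show ?case
    using lin_zero[OF vspace_mvps vspace_mvps \<psi>_lin[OF gen(1)]]
    by (simp add: \<psi>_mult derivation_one[OF \<psi>_derivation] counit_mult counit_gen mvps_scale_simps)
qed (simp_all add: mvps_scale_simps lin_add[OF \<psi>_lin_left] lin_smult[OF \<psi>_lin_left]
    lin_add[OF counit_lin] lin_smult[OF counit_lin])

text \<open>The unit series is multiplied by the counit of the second component, so the sum
  collapses by the counit law.\<close>

lemma wm_unit:
  assumes a: "a \<in> carrier U" and b: "b \<in> carrier U"
  shows "wm a 1 b Q = tw (a \<otimes>\<^bsub>U\<^esub> b) Q"
proof -
  have "wm a 1 b Q = tensor_lift T (\<lambda>b1 b2. tw (a \<otimes>\<^bsub>U\<^esub> (\<epsilon> b2 \<odot>\<^bsub>U\<^esub> b1)) Q) (\<Delta> b)"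
    unfolding wm_def
  proof (rule tensor_lift_cong[OF vspace_U vspace_U vspace_T])
    show "wt a 1 Q b1 b2 = tw (a \<otimes>\<^bsub>U\<^esub> (\<epsilon> b2 \<odot>\<^bsub>U\<^esub> b1)) Q" if "b1 \<in> carrier U" "b2 \<in> carrier U" for b1 b2
      using that a lin_smult[OF tw_lin(1), of "a \<otimes>\<^bsub>U\<^esub> b1" "\<epsilon> b2" Q] lin_smult[OF tw_lin(2)[of "a \<otimes>\<^bsub>U\<^esub> b1"], of Q "\<epsilon> b2"]
      by (simp add: wt_def \<psi>_times_unit mvps_scale_mult lin_smult[OF alg_lin_right[OF assoc_algebra_U]])
  qed (use a b in simp_all)
  also have "\<dots> = tw (a \<otimes>\<^bsub>U\<^esub> tensor_lift U (\<lambda>b1 b2. \<epsilon> b2 \<odot>\<^bsub>U\<^esub> b1) (\<Delta> b)) Q"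
    by (rule lin_tensor_lift_comp[OF vspace_U vspace_U vspace_U vspace_T bilin_smult_right[OF counit_lin]
          lin_comp[OF alg_lin_right[OF assoc_algebra_U a] tw_lin(1)], symmetric])
      (use b in simp)
  finally show ?thesis
    using b by (simp add: comult_counit)
qed

text \<open>With the left factor on the right-hand end expanded in the dual basis, the module
  algebra law splits one part of d, while multiplicativity of the coproduct splits the other. Both
  bracketings become sums over decompositions of c into two and of d into three exponents.\<close>

lemma W_assoc_u:
  assumes a: "a \<in> carrier U"
  shows "(tw a P \<otimes>\<^bsub>W\<^esub> tw (u c) Q) \<otimes>\<^bsub>W\<^esub> tw (u d) R = tw a P \<otimes>\<^bsub>W\<^esub> (tw (u c) Q \<otimes>\<^bsub>W\<^esub> tw (u d) R)"
proof -
  \<comment> \<open>The common summand: p splits c, and d = e + y + z, where \<open>u e\<close>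
    joins the left factor, \<open>u y\<close> acts on the series coming from P, and
    \<open>u z\<close> acts on Q.\<close>
  define t where "t p e y z = tw (a \<otimes>\<^bsub>U\<^esub> (u (fst p) \<otimes>\<^bsub>U\<^esub> u e)) (\<psi> (u y) (\<psi> (u (snd p)) P) * \<psi> (u z) Q * R)"
    for p :: "('n \<Rightarrow> nat) \<times> ('n \<Rightarrow> nat)" and e y z :: "'n \<Rightarrow> nat"
  have t: "t p e y z \<in> carrier T" for p e y z
    using a by (simp add: t_def)
  have 1: "wt a P Q (u (fst p)) (u (snd p)) \<otimes>\<^bsub>W\<^esub> tw (u d) R =
      (\<Oplus>\<^bsub>T\<^esub>q\<in>splits d. \<Oplus>\<^bsub>T\<^esub>r\<in>splits (snd q). t p (fst q) (fst r) (snd r))" for p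
  proof -
    have "wt a P Q (u (fst p)) (u (snd p)) \<otimes>\<^bsub>W\<^esub> tw (u d) R =
        (\<Oplus>\<^bsub>T\<^esub>q\<in>splits d. wt (a \<otimes>\<^bsub>U\<^esub> u (fst p)) (\<psi> (u (snd p)) P * Q) R (u (fst q)) (u (snd q)))"
      using a by (simp add: wt_def[of a] W_mult_tw wm_u)
    also have "\<dots> = (\<Oplus>\<^bsub>T\<^esub>q\<in>splits d. \<Oplus>\<^bsub>T\<^esub>r\<in>splits (snd q). t p (fst q) (fst r) (snd r))"
    proof (rule vs_finsum_cong[OF vspace_T refl])
      fix q
      have "wt (a \<otimes>\<^bsub>U\<^esub> u (fst p)) (\<psi> (u (snd p)) P * Q) R (u (fst q)) (u (snd q)) =
          tw (a \<otimes>\<^bsub>U\<^esub> (u (fst p) \<otimes>\<^bsub>U\<^esub> u (fst q)))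
            (finsum Sf (\<lambda>r. \<psi> (u (fst r)) (\<psi> (u (snd p)) P) * \<psi> (u (snd r)) Q * R) (splits (snd q)))"
        using a by (simp add: wt_def \<psi>_u_times sum_distrib_right alg_assoc)
      also have "\<dots> = (\<Oplus>\<^bsub>T\<^esub>r\<in>splits (snd q). t p (fst q) (fst r) (snd r))"
        unfolding t_def by (rule lin_finsum[OF vspace_mvps vspace_T tw_lin(2)]) (use a in simp_all)
      finally show "wt (a \<otimes>\<^bsub>U\<^esub> u (fst p)) (\<psi> (u (snd p)) P * Q) R (u (fst q)) (u (snd q)) =
          (\<Oplus>\<^bsub>T\<^esub>r\<in>splits (snd q). t p (fst q) (fst r) (snd r))" .
    qed (use t in simp)
    finally show ?thesis .
  qed
  have 2: "tw a P \<otimes>\<^bsub>W\<^esub> wt (u c) Q R (u (fst q)) (u (snd q)) =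
      (\<Oplus>\<^bsub>T\<^esub>p\<in>splits c. \<Oplus>\<^bsub>T\<^esub>s\<in>splits (fst q). t p (fst s) (snd s) (snd q))" for q
  proof -
    let ?f = "wt a P (\<psi> (u (snd q)) Q * R)"
    note L = lin_tensor_lift[OF vspace_U vspace_U vspace_T bilin_wt[OF a]]
    have "tw a P \<otimes>\<^bsub>W\<^esub> wt (u c) Q R (u (fst q)) (u (snd q)) = tensor_lift T ?f (\<Delta> (u c \<otimes>\<^bsub>U\<^esub> u (fst q)))"
      using a by (simp add: wt_def[of "u c"] W_mult_tw wm_def)
    also have "\<dots> = (\<Oplus>\<^bsub>T\<^esub>p\<in>splits c. \<Oplus>\<^bsub>T\<^esub>s\<in>splits (fst q).
        ?f (u (fst p) \<otimes>\<^bsub>U\<^esub> u (fst s)) (u (snd p) \<otimes>\<^bsub>U\<^esub> u (snd s)))"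
      unfolding comult_u_mult using a
      by (simp add: lin_finsum[OF vspace_UU(2) vspace_T L] tensor_lift_tensor[OF vspace_U vspace_U vspace_T bilin_wt])
    also have "\<dots> = (\<Oplus>\<^bsub>T\<^esub>p\<in>splits c. \<Oplus>\<^bsub>T\<^esub>s\<in>splits (fst q). t p (fst s) (snd s) (snd q))"
      by (simp add: wt_def t_def \<psi>_mult mult.assoc)
    finally show ?thesis .
  qed
  have "(tw a P \<otimes>\<^bsub>W\<^esub> tw (u c) Q) \<otimes>\<^bsub>W\<^esub> tw (u d) R =
      (\<Oplus>\<^bsub>T\<^esub>p\<in>splits c. wt a P Q (u (fst p)) (u (snd p)) \<otimes>\<^bsub>W\<^esub> tw (u d) R)"
    using a by (simp add: W_mult_tw[of a "u c"] wm_u lin_finsum[OF vspace_T vspace_T W_lin_left])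
  also have "\<dots> = (\<Oplus>\<^bsub>T\<^esub>p\<in>splits c. \<Oplus>\<^bsub>T\<^esub>q\<in>splits d. \<Oplus>\<^bsub>T\<^esub>r\<in>splits (snd q). t p (fst q) (fst r) (snd r))"
    by (simp only: 1)
  also have "\<dots> = (\<Oplus>\<^bsub>T\<^esub>p\<in>splits c. \<Oplus>\<^bsub>T\<^esub>q\<in>splits d. \<Oplus>\<^bsub>T\<^esub>s\<in>splits (fst q). t p (fst s) (snd s) (snd q))"
    using t by (simp add: finsum_splits_assoc[OF vspace_T])
  also have "\<dots> = (\<Oplus>\<^bsub>T\<^esub>q\<in>splits d. \<Oplus>\<^bsub>T\<^esub>p\<in>splits c. \<Oplus>\<^bsub>T\<^esub>s\<in>splits (fst q). t p (fst s) (snd s) (snd q))"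
    using t by (intro vs_finsum_swap[OF vspace_T]) simp_all
  also have "\<dots> = (\<Oplus>\<^bsub>T\<^esub>q\<in>splits d. tw a P \<otimes>\<^bsub>W\<^esub> wt (u c) Q R (u (fst q)) (u (snd q)))"
    by (simp only: 2)
  also have "\<dots> = tw a P \<otimes>\<^bsub>W\<^esub> (tw (u c) Q \<otimes>\<^bsub>W\<^esub> tw (u d) R)"
    using a by (simp add: W_mult_tw[of "u c" "u d"] wm_u lin_finsum[OF vspace_T vspace_T W_lin_right])
  finally show ?thesis .
qed

text \<open>Associativity is known with dual basis elements in the second and third left factors and
  is extended linearly, in the third and then in the second.\<close>

lemma assoc_algebra_W: "assoc_algebra W"
proof (rule tensor_assoc_algebraI[OF vspace_U vspace_mvps])
  fix a P b Q c R
  assume a: "a \<in> carrier U" and b: "b \<in> carrier U" and c: "c \<in> carrier U"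
  have 1: "(tw a P \<otimes>\<^bsub>W\<^esub> tw (u d) Q) \<otimes>\<^bsub>W\<^esub> tw c R = tw a P \<otimes>\<^bsub>W\<^esub> (tw (u d) Q \<otimes>\<^bsub>W\<^esub> tw c R)" for d
    by (rule u_hom_eqI[OF vspace_T lin_comp[OF tw_lin(1) W_lin_right]
          lin_comp[OF lin_comp[OF tw_lin(1) W_lin_right] W_lin_right] W_assoc_u[OF a] c])
      (use a in simp_all)
  show "(tw a P \<otimes>\<^bsub>W\<^esub> tw b Q) \<otimes>\<^bsub>W\<^esub> tw c R = tw a P \<otimes>\<^bsub>W\<^esub> (tw b Q \<otimes>\<^bsub>W\<^esub> tw c R)"
    by (rule u_hom_eqI[OF vspace_T lin_comp[OF lin_comp[OF tw_lin(1) W_lin_right] W_lin_left]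
          lin_comp[OF lin_comp[OF tw_lin(1) W_lin_left] W_lin_right] 1 b])
      (use a c in simp_all)
qed (use bilin_W_mult in \<open>simp_all add: W_mult_tw wm_unit wm_one\<close>)

section \<open>The black action and the Heisenberg double\<close>

abbreviation bact where "bact \<equiv> coregular_action U pr"

lemma bact_eq: "bact P v = tensor_lift U (\<lambda>a b. pr b P \<odot>\<^bsub>U\<^esub> a) (\<Delta> v)"
  by (simp add: coregular_action_def)

lemma bact_monom: "bact (mvps_monom e) v = contract e (\<Delta> v)"
  by (simp add: bact_eq contract_def)

text \<open>In the product of 1 \<otimes> P with v \<otimes> 1 the power series factors are the
  \<open>\<psi> v2 P\<close>, whose constant terms are by definition the pairings of v2 with
  P.\<close>

lemma ps_black_action_eq:
  assumes v: "v \<in> carrier U"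
  shows "ps_black_action U \<phi> P v = bact P v"
proof -
  have b: "bilin U Sf U (\<lambda>v Q. const_term Q \<odot>\<^bsub>U\<^esub> v)"
    by (intro bilinI linear_homI) (simp_all add: vs_smult_add vs_add_smult mult.commute)
  have "ps_black_action U \<phi> P v = tensor_lift U (\<lambda>v Q. const_term Q \<odot>\<^bsub>U\<^esub> v) (tensor_lift T (wt \<one>\<^bsub>U\<^esub> P 1) (\<Delta> v))"
    using v by (simp add: ps_black_action_def black_action_def W_mult_tw wm_def)
  also have "\<dots> = tensor_lift U (\<lambda>b1 b2. tensor_lift U (\<lambda>v Q. const_term Q \<odot>\<^bsub>U\<^esub> v) (wt \<one>\<^bsub>U\<^esub> P 1 b1 b2)) (\<Delta> v)"
    by (rule lin_tensor_lift_comp[OF vspace_U vspace_U vspace_T vspace_U bilin_wt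
          lin_tensor_lift[OF vspace_U vspace_mvps vspace_U b]]) (use v in simp_all)
  also have "\<dots> = bact P v"
    unfolding bact_eq
    by (rule tensor_lift_cong[OF vspace_U vspace_U vspace_U])
      (use v in \<open>simp_all add: wt_def tensor_lift_tensor[OF vspace_U vspace_mvps vspace_U b] pr_def\<close>)
  finally show ?thesis .
qed

section \<open>Coproducts expanded by the black action of monomials\<close>

definition csupp where "csupp v = {e. bact (mvps_monom e) v \<noteq> \<zero>\<^bsub>U\<^esub>}"

lemma bact_closed [simp]: "v \<in> carrier U \<Longrightarrow> bact P v \<in> carrier U"
  unfolding bact_eq
  by (rule lin_closed[OF lin_tensor_lift[OF vspace_U vspace_U vspace_U bilin_smult_right[OF pr_lin_left]]]) simp

text \<open>The left coefficient of u_e in the coproduct of v is the monomial e acting on v. This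
  also gives the finiteness behind the sums in the Leibniz rule and in the product of the Heisenberg
  double.\<close>

lemma comult_expansion:
  assumes v: "v \<in> carrier U"
  shows "finite (csupp v)" and "\<Delta> v = (\<Oplus>\<^bsub>tensor_space U U\<^esub>e\<in>csupp v. bact (mvps_monom e) v \<otimes>\<otimes> u e)"
proof -
  have D: "\<Delta> v \<in> carrier (tensor_space U U)"
    using v by simp
  from UU_expansion[OF D] obtain A where
    A: "finite A \<and> (\<forall>B. finite B \<longrightarrow> A \<subseteq> B \<longrightarrow> \<Delta> v = (\<Oplus>\<^bsub>tensor_space U U\<^esub>b\<in>B. contract b (\<Delta> v) \<otimes>\<otimes> u b))" ..
  then have eq: "\<Delta> v = (\<Oplus>\<^bsub>tensor_space U U\<^esub>b\<in>A. bact (mvps_monom b) v \<otimes>\<otimes> u b)"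
    unfolding bact_monom by blast
  \<comment> \<open>Contracting the finite expansion with a monomial outside A gives zero by
    duality, so \<open>csupp v\<close> is contained in A.\<close>
  have z: "bact (mvps_monom e) v = \<zero>\<^bsub>U\<^esub>" if "e \<notin> A" for e
  proof -
    have "bact (mvps_monom e) v = contract e (\<Oplus>\<^bsub>tensor_space U U\<^esub>b\<in>A. bact (mvps_monom b) v \<otimes>\<otimes> u b)"
      using eq by (simp only: bact_monom[of e])
    also have "\<dots> = (\<Oplus>\<^bsub>U\<^esub>b\<in>A. contract e (bact (mvps_monom b) v \<otimes>\<otimes> u b))"
      by (rule lin_finsum[OF vspace_UU(2) vspace_U contract_lin]) (use v in simp)
    also have "\<dots> = \<zero>\<^bsub>U\<^esub>"
      by (rule vs_finsum_zero[OF vspace_U]) (use v that in \<open>auto simp: contract_tens pr_u_monom\<close>)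
    finally show ?thesis .
  qed
  then have sub: "csupp v \<subseteq> A"
    by (auto simp: csupp_def)
  then show "finite (csupp v)"
    using A finite_subset by blast
  have "(\<Oplus>\<^bsub>tensor_space U U\<^esub>e\<in>csupp v. bact (mvps_monom e) v \<otimes>\<otimes> u e) =
      (\<Oplus>\<^bsub>tensor_space U U\<^esub>e\<in>A. bact (mvps_monom e) v \<otimes>\<otimes> u e)"
  proof (rule vs_finsum_superset[OF vspace_UU(2) _ sub])
    show "bact (mvps_monom e) v \<otimes>\<otimes> u e = \<zero>\<^bsub>tensor_space U U\<^esub>" if "e \<in> A - csupp v" for e
      using that lin_zero[OF vspace_U vspace_UU(2) bilin_left[OF bilin_tens u_closed]] by (simp add: csupp_def)
  qed (use A v in simp_all)
  with eq show "\<Delta> v = (\<Oplus>\<^bsub>tensor_space U U\<^esub>e\<in>csupp v. bact (mvps_monom e) v \<otimes>\<otimes> u e)"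
    by simp
qed

lemma lift_comult_expansion:
  assumes v: "v \<in> carrier U" and Z: "vspace Z" and f: "f \<in> linear_hom (tensor_space U U) Z"
  shows "f (\<Delta> v) = (\<Oplus>\<^bsub>Z\<^esub>e\<in>csupp v. f (bact (mvps_monom e) v \<otimes>\<otimes> u e))"
  using arg_cong[where f = f, OF comult_expansion(2)[OF v]] v
  by (simp add: lin_finsum[OF vspace_UU(2) Z f])

text \<open>The coproduct of v w is the product of the coproducts. Expanding both along the dual
  basis leaves the pairings of P with products of dual basis elements, which are the coefficients of
  \<open>cop P\<close>.\<close>

lemma bact_mult:
  assumes v: "v \<in> carrier U" and w: "w \<in> carrier U"
  shows "bact P (v \<otimes>\<^bsub>U\<^esub> w) = (\<Oplus>\<^bsub>U\<^esub>p\<in>csupp v \<times> csupp w. coeff (cop P) (case_sum (fst p) (snd p)) \<odot>\<^bsub>U\<^esub>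
    (bact (mvps_monom (fst p)) v \<otimes>\<^bsub>U\<^esub> bact (mvps_monom (snd p)) w))"
proof -
  let ?L = "tensor_lift U (\<lambda>a b. pr b P \<odot>\<^bsub>U\<^esub> a)"
  note L = lin_tensor_lift[OF vspace_U vspace_U vspace_U bilin_smult_right[OF pr_lin_left]]
    and tens = tensor_lift_tensor[OF vspace_U vspace_U vspace_U bilin_smult_right[OF pr_lin_left]]
  have "bact P (v \<otimes>\<^bsub>U\<^esub> w) = ?L (\<Delta> v \<otimes>\<^bsub>UU\<^esub> \<Delta> w)"
    using v w by (simp add: bact_eq comult_mult)
  also have "\<dots> = (\<Oplus>\<^bsub>U\<^esub>e\<in>csupp v. ?L ((bact (mvps_monom e) v \<otimes>\<otimes> u e) \<otimes>\<^bsub>UU\<^esub> \<Delta> w))"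
    by (rule lift_comult_expansion[OF v vspace_U lin_comp[OF UU_lin_left L]]) (use w in simp)
  also have "\<dots> = (\<Oplus>\<^bsub>U\<^esub>e\<in>csupp v. \<Oplus>\<^bsub>U\<^esub>f\<in>csupp w. ?L ((bact (mvps_monom e) v \<otimes>\<otimes> u e) \<otimes>\<^bsub>UU\<^esub> (bact (mvps_monom f) w \<otimes>\<otimes> u f)))"
    by (rule vs_finsum_cong[OF vspace_U refl])
      (use v w in \<open>simp_all add: lift_comult_expansion[OF w vspace_U lin_comp[OF UU_lin_right L]] lin_closed[OF L]\<close>)
  also have "\<dots> = (\<Oplus>\<^bsub>U\<^esub>e\<in>csupp v. \<Oplus>\<^bsub>U\<^esub>f\<in>csupp w. coeff (cop P) (case_sum e f) \<odot>\<^bsub>U\<^esub>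
      (bact (mvps_monom e) v \<otimes>\<^bsub>U\<^esub> bact (mvps_monom f) w))"
    using v w by (simp add: tens coeff_cop_case_sum)
  also have "\<dots> = (\<Oplus>\<^bsub>U\<^esub>p\<in>csupp v \<times> csupp w. coeff (cop P) (case_sum (fst p) (snd p)) \<odot>\<^bsub>U\<^esub>
      (bact (mvps_monom (fst p)) v \<otimes>\<^bsub>U\<^esub> bact (mvps_monom (snd p)) w))"
    using v w by (intro vs_finsum_Sigma[OF vspace_U]) (simp_all add: comult_expansion(1))
  finally show ?thesis .
qed

lemma leibniz_rule_iff: "leibniz_rule U \<phi> D \<longleftrightarrow> (\<forall>P. \<forall>v\<in>carrier U. \<forall>w\<in>carrier U.
    bact P (v \<otimes>\<^bsub>U\<^esub> w) = (\<Oplus>\<^bsub>U\<^esub>p\<in>csupp v \<times> csupp w. coeff (D P) (case_sum (fst p) (snd p)) \<odot>\<^bsub>U\<^esub>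
    (bact (mvps_monom (fst p)) v \<otimes>\<^bsub>U\<^esub> bact (mvps_monom (snd p)) w)))"
  unfolding leibniz_rule_def Let_def by (simp add: ps_black_action_eq csupp_def cong: ball_cong)

text \<open>By the definition of the pairing on the unit series, the counit is pairing with 1. It
  thus pairs the coproduct of v with 1 \<otimes> P, that is, v with P.\<close>

lemma counit_bact: "v \<in> carrier U \<Longrightarrow> \<epsilon> (bact P v) = pr v P"
proof -
  assume v: "v \<in> carrier U"
  have "\<epsilon> (bact P v) = tensor_lift scalars (\<lambda>a b. \<epsilon> (pr b P \<odot>\<^bsub>U\<^esub> a)) (\<Delta> v)"
    unfolding bact_eq
    by (rule lin_tensor_lift_comp[OF vspace_U vspace_U vspace_U vspace_scalars bilin_smult_right[OF pr_lin_left] counit_lin])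
      (use v in simp)
  also have "\<dots> = pr2 1 P (\<Delta> v)"
    unfolding pr2_def
    by (rule tensor_lift_cong[OF vspace_U vspace_U vspace_scalars])
      (use v in \<open>simp_all add: lin_smult[OF counit_lin] pr_unit mult.commute\<close>)
  finally show ?thesis
    using v by (simp add: pr_times)
qed

text \<open>The counit turns the Leibniz rule into an identity of scalars. For two dual basis
  elements all pairings in it are Kronecker deltas, so the rule reads off one coefficient of D
  P.\<close>

lemma leibniz_rule_unique:
  assumes "leibniz_rule U \<phi> D"
  shows "D = cop"
proof (rule ext, rule mvps_eqI)
  fix P and m :: "'n + 'n \<Rightarrow> nat"
  let ?a = "m \<circ> Inl" and ?b = "m \<circ> Inr"
  \<comment> \<open>Ensures that the surviving term occurs in the sum: the monomial a does not
    annihilate \<open>u a\<close>, because the counit of the result is 1.\<close>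
  have mem: "a \<in> csupp (u a)" for a
    using counit_bact[of "u a" "mvps_monom a"] lin_zero[OF vspace_U vspace_scalars counit_lin]
    by (auto simp: csupp_def pr_u_monom)
  have "bact P (u ?a \<otimes>\<^bsub>U\<^esub> u ?b) = (\<Oplus>\<^bsub>U\<^esub>p\<in>csupp (u ?a) \<times> csupp (u ?b). coeff (D P) (case_sum (fst p) (snd p)) \<odot>\<^bsub>U\<^esub>
      (bact (mvps_monom (fst p)) (u ?a) \<otimes>\<^bsub>U\<^esub> bact (mvps_monom (snd p)) (u ?b)))"
    using assms unfolding leibniz_rule_iff by simp
  then have "pr (u ?a \<otimes>\<^bsub>U\<^esub> u ?b) P = \<epsilon> (\<Oplus>\<^bsub>U\<^esub>p\<in>csupp (u ?a) \<times> csupp (u ?b). coeff (D P) (case_sum (fst p) (snd p)) \<odot>\<^bsub>U\<^esub>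
      (bact (mvps_monom (fst p)) (u ?a) \<otimes>\<^bsub>U\<^esub> bact (mvps_monom (snd p)) (u ?b)))"
    by (simp flip: counit_bact)
  also have "\<dots> = (\<Sum>p\<in>csupp (u ?a) \<times> csupp (u ?b). coeff (D P) (case_sum (fst p) (snd p)) *
      (pr (u ?a) (mvps_monom (fst p)) * pr (u ?b) (mvps_monom (snd p))))"
    by (simp add: lin_finsum[OF vspace_U vspace_scalars counit_lin] lin_smult[OF counit_lin] counit_mult counit_bact)
  also have "\<dots> = (\<Sum>p\<in>csupp (u ?a) \<times> csupp (u ?b). if p = (?a, ?b) then coeff (D P) m else 0)"
    by (rule sum.cong) (auto simp: pr_u_monom case_sum_Inl_Inr)
  also have "\<dots> = coeff (D P) m"
    using mem by (simp add: comult_expansion(1))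
  finally show "coeff (D P) m = coeff (cop P) m"
    by (simp add: coeff_cop)
qed

lemma leibniz_rule_cop: "leibniz_rule U \<phi> cop"
  unfolding leibniz_rule_iff using bact_mult by blast

lemma deformed_coproduct_eq: "deformed_coproduct U \<phi> = cop"
  unfolding deformed_coproduct_def using leibniz_rule_cop leibniz_rule_unique by (rule the_equality)

section \<open>Agreement of the two smash product multiplications\<close>

abbreviation HD where "HD \<equiv> heisenberg_double U cop pr"

lemma HD_simps [simp]:
  "carrier HD = carrier T" "add HD = add T" "zero HD = zero T" "smult HD = smult T" "one HD = tw \<one>\<^bsub>U\<^esub> 1"
  by (simp_all add: heisenberg_double_def Let_def)

text \<open>The left side arises from the smash product by expanding the coproduct of b along the
  dual basis in its second factor, since \<open>\<psi> (u e) P\<close> is the slice of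
  \<open>cop P\<close> at e.\<close>

lemma HD_product:
  assumes a: "a \<in> carrier U" and b: "b \<in> carrier U"
  shows "(\<Oplus>\<^bsub>T\<^esub>e\<in>{e. bact (mvps_monom e) b \<noteq> \<zero>\<^bsub>U\<^esub>}.
      tw (a \<otimes>\<^bsub>U\<^esub> bact (mvps_monom e) b) (mvps_slice (cop P) e * Q)) = wm a P b Q"
  unfolding wm_def
  using lift_comult_expansion[OF b vspace_T lin_tensor_lift[OF vspace_U vspace_U vspace_T bilin_wt[OF a]], of P Q] a b
  by (simp add: csupp_def tensor_lift_tensor[OF vspace_U vspace_U vspace_T bilin_wt] wt_def slice_cop)

lemma HD_mult:
  assumes Y: "Y \<in> carrier T" and Z: "Z \<in> carrier T"
  shows "Y \<otimes>\<^bsub>HD\<^esub> Z = Y \<otimes>\<^bsub>W\<^esub> Z"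
proof -
  let ?h = "\<lambda>a P b Q. \<Oplus>\<^bsub>T\<^esub>e\<in>{e. bact (mvps_monom e) b \<noteq> \<zero>\<^bsub>U\<^esub>}.
    tw (a \<otimes>\<^bsub>U\<^esub> bact (mvps_monom e) b) (mvps_slice (cop P) e * Q)"
  have "Y \<otimes>\<^bsub>HD\<^esub> Z = tensor_lift T (\<lambda>a P. tensor_lift T (?h a P) Z) Y"
    by (simp add: heisenberg_double_def Let_def)
  also have "\<dots> = tensor_lift T (\<lambda>a P. tensor_lift T (wm a P) Z) Y"
  proof (rule tensor_lift_cong[OF vspace_U vspace_mvps vspace_T _ _ Y])
    fix a P assume a: "a \<in> carrier U"
    show "tensor_lift T (wm a P) Z \<in> carrier T"
      by (rule lin_closed[OF lin_tensor_lift[OF vspace_U vspace_mvps vspace_T bilin_wm(1)[OF a]] Z])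
    show "tensor_lift T (?h a P) Z = tensor_lift T (wm a P) Z"
      by (rule tensor_lift_cong[OF vspace_U vspace_mvps vspace_T _ _ Z]) (use a HD_product in simp_all)
  qed
  also have "\<dots> = Y \<otimes>\<^bsub>W\<^esub> Z"
    by (rule W_mult[symmetric])
  finally show ?thesis .
qed

lemma assoc_algebra_HD: "assoc_algebra HD"
  by (rule assoc_algebra_cong[OF _ _ _ _ _ _ assoc_algebra_W]) (simp_all add: HD_mult)

lemma algebra_hom_HD: "algebra_hom B HD = algebra_hom B W"
proof -
  have "linear_hom B HD = linear_hom B W"
    by (simp add: linear_hom_def)
  moreover have "f \<in> ring_hom B HD \<longleftrightarrow> f \<in> ring_hom B W" for f
    by (auto simp: ring_hom_def Pi_iff HD_mult)
  ultimately show ?thesis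
    by (auto simp: algebra_hom_def)
qed

lemma W_isomorphic_HD: "isomorphic_algebras W HD"
proof -
  have "(\<lambda>Y. Y) \<in> algebra_hom W HD"
    unfolding algebra_hom_HD by (rule algebra_homI) (simp_all add: lin_id)
  then show ?thesis
    unfolding isomorphic_algebras_def using assoc_algebra_W assoc_algebra_HD
    by (auto intro!: bexI[of _ "\<lambda>Y. Y"] simp: bij_betw_def)
qed

end

context leading_delta_action
begin

section \<open>The phase space algebra\<close>

definition phim :: "'n \<Rightarrow> 'n \<Rightarrow> ('n, 'k) mvps" where
  "phim i l = \<phi> (\<ominus>\<^bsub>U\<^esub> xh i) (mvps_var l)"

abbreviation F :: "('k, _) module" where "F \<equiv> free_product U Sf"
abbreviation jl where "jl a \<equiv> free_product_gen U Sf (Inl a)"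
abbreviation jr where "jr P \<equiv> free_product_gen U Sf (Inr P)"
abbreviation Rel where "Rel \<equiv> phase_space_relations U xh phim"
abbreviation Ph where "Ph \<equiv> phase_space_algebra U xh phim"

lemma assoc_algebra_F [simp]: "assoc_algebra F"
  by (rule assoc_algebra_free_product) (simp_all add: assoc_algebra_mvps)

lemma vspace_F [simp]: "vspace F"
  by (rule assoc_algebra_vspace) simp

lemma jl_hom: "(\<lambda>a. jl a) \<in> algebra_hom U F" and jr_hom: "(\<lambda>P. jr P) \<in> algebra_hom Sf F"
  using free_product_Inl[OF assoc_algebra_U assoc_algebra_mvps] free_product_Inr[OF assoc_algebra_U assoc_algebra_mvps]
  by simp_all

lemma j_closed [simp]: "a \<in> carrier U \<Longrightarrow> jl a \<in> carrier F" "jr P \<in> carrier F"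
  using lin_closed[OF alg_hom_lin[OF jl_hom]] lin_closed[OF alg_hom_lin[OF jr_hom]] by simp_all

text \<open>Translates the formal extension of the commutation relations to arbitrary power series
  into the derivation attached to x_i.\<close>

lemma phim_chain_rule: "(\<Sum>l\<in>UNIV. mvps_pderiv l P * phim i l) = \<psi> (xh i) P"
proof -
  have "phim i l = \<psi> (xh i) (mvps_var l)" for l
    by (simp add: phim_def \<psi>_def antipode_gen \<iota>_minus vs_uminus)
  then show ?thesis
    by (simp add: derivation_chain_rule[OF \<psi>_derivation, of "x i" P])
qed

definition rel where
  "rel P i = (jr P \<otimes>\<^bsub>F\<^esub> jl (xh i) \<oplus>\<^bsub>F\<^esub> (-1) \<odot>\<^bsub>F\<^esub> (jl (xh i) \<otimes>\<^bsub>F\<^esub> jr P)) \<oplus>\<^bsub>F\<^esub> (-1) \<odot>\<^bsub>F\<^esub> jr (\<psi> (xh i) P)"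

lemma Rel_eq: "Rel = {rel P i | P i. True}"
  by (simp add: phase_space_relations_def Let_def phim_chain_rule rel_def vs_minus)

lemma Rel_closed: "Rel \<subseteq> carrier F"
  by (auto simp: Rel_eq rel_def)

lemma Ph_eq: "Ph = quotient F (Idl\<^bsub>F\<^esub> Rel)"
  by (simp add: phase_space_algebra_def Let_def)

lemma assoc_algebra_Ph [simp]: "assoc_algebra Ph"
  unfolding Ph_eq by (rule assoc_algebra_quot[OF assoc_algebra_F Rel_closed])

lemma vspace_Ph [simp]: "vspace Ph"
  by (rule assoc_algebra_vspace) simp

definition phase_coset where "phase_coset y = (Idl\<^bsub>F\<^esub> Rel) +>\<^bsub>F\<^esub> y"

lemma phase_coset_hom: "phase_coset \<in> algebra_hom F Ph"
  using quot_hom_coset[OF assoc_algebra_F Rel_closed] unfolding Ph_eq phase_coset_def[abs_def] .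

definition inU where "inU a = phase_coset (jl a)"
definition inS where "inS P = phase_coset (jr P)"

lemma inU_hom: "inU \<in> algebra_hom U Ph" and inS_hom: "inS \<in> algebra_hom Sf Ph"
  unfolding inU_def[abs_def] inS_def[abs_def]
  by (rule algebra_hom_comp[OF jl_hom phase_coset_hom], rule algebra_hom_comp[OF jr_hom phase_coset_hom])

lemmas inU_lin = alg_hom_lin[OF inU_hom] and inS_lin = alg_hom_lin[OF inS_hom]

lemma in_closed [simp]: "a \<in> carrier U \<Longrightarrow> inU a \<in> carrier Ph" "inS P \<in> carrier Ph"
  using lin_closed[OF inU_lin] lin_closed[OF inS_lin] by simp_all

lemma inS_inU_relation: "inS P \<otimes>\<^bsub>Ph\<^esub> inU (xh i) = inU (xh i) \<otimes>\<^bsub>Ph\<^esub> inS P \<oplus>\<^bsub>Ph\<^esub> inS (\<psi> (xh i) P)"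
proof (rule vs_eqI[OF vspace_Ph])
  note C = alg_hom_lin[OF phase_coset_hom]
  have "phase_coset (rel P i) = \<zero>\<^bsub>Ph\<^esub>"
    using quot_relation[OF assoc_algebra_F Rel_closed, of "rel P i"] unfolding Ph_eq phase_coset_def
    by (auto simp: Rel_eq)
  moreover have "phase_coset (rel P i) = (inS P \<otimes>\<^bsub>Ph\<^esub> inU (xh i) \<oplus>\<^bsub>Ph\<^esub> (-1) \<odot>\<^bsub>Ph\<^esub> (inU (xh i) \<otimes>\<^bsub>Ph\<^esub> inS P)) \<oplus>\<^bsub>Ph\<^esub> (-1) \<odot>\<^bsub>Ph\<^esub> inS (\<psi> (xh i) P)"
    by (simp add: rel_def lin_add[OF C] lin_smult[OF C] alg_hom_mult[OF phase_coset_hom] inU_def inS_def)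
  ultimately show "inS P \<otimes>\<^bsub>Ph\<^esub> inU (xh i) \<oplus>\<^bsub>Ph\<^esub> (-1) \<odot>\<^bsub>Ph\<^esub> (inU (xh i) \<otimes>\<^bsub>Ph\<^esub> inS P \<oplus>\<^bsub>Ph\<^esub> inS (\<psi> (xh i) P)) = \<zero>\<^bsub>Ph\<^esub>"
    by (simp add: vs_smult_add vs_assoc[OF vspace_Ph])
qed simp_all

text \<open>The summand in the normal ordering of P and a, for the components a1 and a2 of the
  coproduct of a.\<close>

definition lm where "lm P a1 a2 = inU a1 \<otimes>\<^bsub>Ph\<^esub> inS (\<psi> a2 P)"

lemma bilin_lm: "bilin U U Ph (lm P)"
  unfolding lm_def[abs_def]
  by (rule bilinI)
    (simp_all add: lin_comp[OF lin_comp[OF \<psi>_lin_left inS_lin] alg_lin_right[OF assoc_algebra_Ph]]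
      lin_comp[OF inU_lin alg_lin_left[OF assoc_algebra_Ph]])

lemmas lm_lin = lin_tensor_lift[OF vspace_U vspace_U vspace_Ph bilin_lm]
lemmas lm_tens = tensor_lift_tensor[OF vspace_U vspace_U vspace_Ph bilin_lm]

text \<open>Normal ordering. Moving P past one generator produces two terms, by the defining
  relation; they match the two terms by which the primitive element of that generator multiplies the
  coproduct.\<close>

lemma inS_inU_commute: "a \<in> carrier U \<Longrightarrow> inS P \<otimes>\<^bsub>Ph\<^esub> inU a = tensor_lift Ph (lm P) (\<Delta> a)"
proof (induction a arbitrary: P rule: U_induct)
  case one
  then show ?case
    by (simp add: lm_tens) (simp add: lm_def alg_hom_one[OF inU_hom])
next
  case (add a b)
  then show ?case
    by (simp add: lin_add[OF inU_lin] lin_add[OF comult_lin] lin_add[OF lm_lin] lin_add[OF alg_lin_right[OF assoc_algebra_Ph]])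
next
  case (smult c a)
  then show ?case
    by (simp add: lin_smult[OF inU_lin] lin_smult[OF comult_lin] lin_smult[OF lm_lin] lin_smult[OF alg_lin_right[OF assoc_algebra_Ph]])
next
  case (gen i a)
  let ?K = "\<lambda>P. tensor_lift Ph (lm P)"
  have "?K P (primitive (x i) \<otimes>\<^bsub>UU\<^esub> (b \<otimes>\<otimes> c)) = inU (xh i) \<otimes>\<^bsub>Ph\<^esub> ?K P (b \<otimes>\<otimes> c) \<oplus>\<^bsub>Ph\<^esub> ?K (\<psi> (xh i) P) (b \<otimes>\<otimes> c)"
    if "b \<in> carrier U" "c \<in> carrier U" for b c
    using that by (simp add: primitive_mult_tens lin_add[OF lm_lin] lm_tens)
      (simp add: lm_def alg_hom_mult[OF inU_hom] alg_assoc \<psi>_mult)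
  note * = tensor_hom_eqI[OF vspace_U vspace_U vspace_Ph
      lin_comp[OF UU_lin_right[OF primitive_closed] lm_lin]
      lin_plus[OF vspace_Ph lin_comp[OF lm_lin alg_lin_right[OF assoc_algebra_Ph in_closed(1)[OF \<iota>_closed]]] lm_lin] this]
  have "inS P \<otimes>\<^bsub>Ph\<^esub> inU (xh i \<otimes>\<^bsub>U\<^esub> a) = (inS P \<otimes>\<^bsub>Ph\<^esub> inU (xh i)) \<otimes>\<^bsub>Ph\<^esub> inU a"
    using gen by (simp add: alg_hom_mult[OF inU_hom] alg_assoc)
  also have "\<dots> = inU (xh i) \<otimes>\<^bsub>Ph\<^esub> (inS P \<otimes>\<^bsub>Ph\<^esub> inU a) \<oplus>\<^bsub>Ph\<^esub> inS (\<psi> (xh i) P) \<otimes>\<^bsub>Ph\<^esub> inU a"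
    unfolding inS_inU_relation using gen by (simp add: lin_add[OF alg_lin_left[OF assoc_algebra_Ph]] alg_assoc)
  also have "\<dots> = ?K P (primitive (x i) \<otimes>\<^bsub>UU\<^esub> \<Delta> a)"
    using gen by (simp add: *)
  finally show ?case
    using gen by (simp add: comult_mult comult_gen)
qed

text \<open>Introduced as a linear map. Surjectivity uses only its compatibility with left
  multiplication by elements of the two subalgebras, and multiplicativity of the isomorphism comes
  from \<open>to_weyl\<close>.\<close>

definition from_weyl where "from_weyl = tensor_lift Ph (\<lambda>a P. inU a \<otimes>\<^bsub>Ph\<^esub> inS P)"

lemma bilin_inU_inS: "bilin U Sf Ph (\<lambda>a P. inU a \<otimes>\<^bsub>Ph\<^esub> inS P)"
  by (rule bilinI)
    (simp_all add: lin_comp[OF inS_lin alg_lin_right[OF assoc_algebra_Ph]] lin_comp[OF inU_lin alg_lin_left[OF assoc_algebra_Ph]])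

lemma from_weyl_lin: "from_weyl \<in> linear_hom T Ph"
  unfolding from_weyl_def using lin_tensor_lift[OF vspace_U vspace_mvps vspace_Ph bilin_inU_inS] .

lemma from_weyl_tw: "a \<in> carrier U \<Longrightarrow> from_weyl (tw a P) = inU a \<otimes>\<^bsub>Ph\<^esub> inS P"
  unfolding from_weyl_def by (rule tensor_lift_tensor[OF vspace_U vspace_mvps vspace_Ph bilin_inU_inS]) simp_all

lemma from_weyl_mult_inU:
  assumes b: "b \<in> carrier U" and Y: "Y \<in> carrier T"
  shows "from_weyl (tw b 1 \<otimes>\<^bsub>W\<^esub> Y) = inU b \<otimes>\<^bsub>Ph\<^esub> from_weyl Y"
  by (rule tensor_hom_eqI[OF vspace_U vspace_mvps vspace_Ph lin_comp[OF W_lin_right from_weyl_lin]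
        lin_comp[OF from_weyl_lin alg_lin_right[OF assoc_algebra_Ph]] _ Y])
    (use b in \<open>simp_all add: W_mult_tw wm_unit from_weyl_tw alg_hom_mult[OF inU_hom] alg_assoc\<close>)

lemma from_weyl_mult_inS:
  assumes Y: "Y \<in> carrier T"
  shows "from_weyl (tw \<one>\<^bsub>U\<^esub> Q \<otimes>\<^bsub>W\<^esub> Y) = inS Q \<otimes>\<^bsub>Ph\<^esub> from_weyl Y"
proof (rule tensor_hom_eqI[OF vspace_U vspace_mvps vspace_Ph lin_comp[OF W_lin_right from_weyl_lin]
        lin_comp[OF from_weyl_lin alg_lin_right[OF assoc_algebra_Ph]] _ Y])
  fix a P assume a: "a \<in> carrier U"
  have inS_mult: "inS (P * Q) = inS P \<otimes>\<^bsub>Ph\<^esub> inS Q" for P Q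
    using alg_hom_mult[OF inS_hom, of P Q] by simp
  have "from_weyl (tw \<one>\<^bsub>U\<^esub> Q \<otimes>\<^bsub>W\<^esub> tw a P) = tensor_lift Ph (\<lambda>a1 a2. from_weyl (wt \<one>\<^bsub>U\<^esub> Q P a1 a2)) (\<Delta> a)"
    using a by (simp add: W_mult_tw wm_def lin_tensor_lift_comp[OF vspace_U vspace_U vspace_T vspace_Ph bilin_wt from_weyl_lin])
  also have "\<dots> = tensor_lift Ph (\<lambda>a1 a2. lm Q a1 a2 \<otimes>\<^bsub>Ph\<^esub> inS P) (\<Delta> a)"
    by (rule tensor_lift_cong[OF vspace_U vspace_U vspace_Ph])
      (use a in \<open>simp_all add: lm_def wt_def from_weyl_tw inS_mult alg_assoc\<close>)
  also have "\<dots> = tensor_lift Ph (lm Q) (\<Delta> a) \<otimes>\<^bsub>Ph\<^esub> inS P"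
    using lin_tensor_lift_comp[OF vspace_U vspace_U vspace_Ph vspace_Ph bilin_lm alg_lin_left[OF assoc_algebra_Ph in_closed(2)], of "\<Delta> a" Q P] a
    by simp
  also have "\<dots> = (inS Q \<otimes>\<^bsub>Ph\<^esub> inU a) \<otimes>\<^bsub>Ph\<^esub> inS P"
    using a by (simp add: inS_inU_commute)
  also have "\<dots> = inS Q \<otimes>\<^bsub>Ph\<^esub> from_weyl (tw a P)"
    using a by (simp add: from_weyl_tw alg_assoc)
  finally show "from_weyl (tw \<one>\<^bsub>U\<^esub> Q \<otimes>\<^bsub>W\<^esub> tw a P) = inS Q \<otimes>\<^bsub>Ph\<^esub> from_weyl (tw a P)" .
qed simp_all

text \<open>The image contains 1 and is stable under left multiplication by both kinds of
  generators, hence it contains the image of every element of the free product.\<close>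

lemma from_weyl_surj:
  assumes "z \<in> carrier Ph"
  shows "\<exists>Y\<in>carrier T. z = from_weyl Y"
proof -
  have "\<exists>Y\<in>carrier T. phase_coset y = from_weyl Y" if "y \<in> carrier F" for y
    using that
  proof (induction y rule: free_product_induct[OF assoc_algebra_U assoc_algebra_mvps, consumes 1, case_names one add smult left right])
    case one
    then show ?case
      by (intro bexI[of _ "tw \<one>\<^bsub>U\<^esub> 1"])
        (use alg_hom_one[OF inS_hom] in \<open>simp_all add: from_weyl_tw alg_hom_one[OF phase_coset_hom] alg_hom_one[OF inU_hom]\<close>)
  next
    case (add y z)
    then obtain Y Z where "Y \<in> carrier T" "phase_coset y = from_weyl Y" "Z \<in> carrier T" "phase_coset z = from_weyl Z"
      by blast
    with add show ?case
      by (intro bexI[of _ "Y \<oplus>\<^bsub>T\<^esub> Z"]) (simp_all add: lin_add[OF from_weyl_lin] lin_add[OF alg_hom_lin[OF phase_coset_hom]])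
  next
    case (smult c y)
    then obtain Y where "Y \<in> carrier T" "phase_coset y = from_weyl Y"
      by blast
    with smult show ?case
      by (intro bexI[of _ "c \<odot>\<^bsub>T\<^esub> Y"]) (simp_all add: lin_smult[OF from_weyl_lin] lin_smult[OF alg_hom_lin[OF phase_coset_hom]])
  next
    case (left a y)
    then obtain Y where "Y \<in> carrier T" "phase_coset y = from_weyl Y"
      by blast
    with left show ?case
      by (intro bexI[of _ "tw a 1 \<otimes>\<^bsub>W\<^esub> Y"]) (simp_all add: from_weyl_mult_inU alg_hom_mult[OF phase_coset_hom] inU_def)
  next
    case (right P y)
    then obtain Y where "Y \<in> carrier T" "phase_coset y = from_weyl Y"
      by blast
    with right show ?case
      by (intro bexI[of _ "tw \<one>\<^bsub>U\<^esub> P \<otimes>\<^bsub>W\<^esub> Y"]) (simp_all add: from_weyl_mult_inS alg_hom_mult[OF phase_coset_hom] inS_def)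
  qed
  then show ?thesis
    using assms carrier_quot[OF assoc_algebra_F Rel_closed] by (auto simp: Ph_eq phase_coset_def)
qed

section \<open>The homomorphism from the phase space algebra to the twisted Weyl algebra\<close>

definition lift_weyl where "lift_weyl = pres_lift W (case_sum (\<lambda>a. tw a 1) (\<lambda>P. tw \<one>\<^bsub>U\<^esub> P))"

lemma tw_hom: "(\<lambda>a. tw a 1) \<in> algebra_hom U W" "(\<lambda>P. tw \<one>\<^bsub>U\<^esub> P) \<in> algebra_hom Sf W"
  using tw_lin(1)[of 1] tw_lin(2)[of "\<one>\<^bsub>U\<^esub>"]
  by (auto intro!: algebra_homI simp: W_mult_tw wm_unit wm_one) (simp_all add: linear_hom_def)

lemma lift_weyl_hom: "lift_weyl \<in> algebra_hom F W"
  and lift_weyl_jl: "a \<in> carrier U \<Longrightarrow> lift_weyl (jl a) = tw a 1"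
  and lift_weyl_jr: "lift_weyl (jr P) = tw \<one>\<^bsub>U\<^esub> P"
  unfolding lift_weyl_def
  using free_product_lift[OF assoc_algebra_U assoc_algebra_mvps assoc_algebra_W tw_hom] by simp_all

text \<open>Since x_i is primitive, moving P past it in the twisted Weyl algebra gives exactly two
  terms, and these are the ones subtracted in the relation.\<close>

lemma lift_weyl_rel: "lift_weyl (rel P i) = \<zero>\<^bsub>W\<^esub>"
proof -
  note C = alg_hom_lin[OF lift_weyl_hom]
  have vW: "vspace W"
    by (rule assoc_algebra_vspace[OF assoc_algebra_W])
  have e: "tw \<one>\<^bsub>U\<^esub> P \<otimes>\<^bsub>W\<^esub> tw (xh i) 1 = tw (xh i) P \<oplus>\<^bsub>T\<^esub> tw \<one>\<^bsub>U\<^esub> (\<psi> (xh i) P)"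
    by (simp add: W_mult_tw wm_def comult_gen tensor_lift_primitive[OF vspace_T bilin_wt]) (simp add: wt_def)
  have e': "tw (xh i) 1 \<otimes>\<^bsub>W\<^esub> tw \<one>\<^bsub>U\<^esub> P = tw (xh i) P"
    by (simp add: W_mult_tw wm_unit)
  have "lift_weyl (rel P i) = ((tw (xh i) P \<oplus>\<^bsub>T\<^esub> tw \<one>\<^bsub>U\<^esub> (\<psi> (xh i) P)) \<oplus>\<^bsub>T\<^esub> (-1) \<odot>\<^bsub>T\<^esub> tw (xh i) P)
      \<oplus>\<^bsub>T\<^esub> (-1) \<odot>\<^bsub>T\<^esub> tw \<one>\<^bsub>U\<^esub> (\<psi> (xh i) P)"
    by (simp add: rel_def lin_add[OF C] lin_smult[OF C] alg_hom_mult[OF lift_weyl_hom] lift_weyl_jl lift_weyl_jr e e')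
  also have "\<dots> = (tw (xh i) P \<oplus>\<^bsub>T\<^esub> (-1) \<odot>\<^bsub>T\<^esub> tw (xh i) P) \<oplus>\<^bsub>T\<^esub>
      (tw \<one>\<^bsub>U\<^esub> (\<psi> (xh i) P) \<oplus>\<^bsub>T\<^esub> (-1) \<odot>\<^bsub>T\<^esub> tw \<one>\<^bsub>U\<^esub> (\<psi> (xh i) P))"
    by (simp only: vs_assoc[OF vspace_T] vs_comm[OF vspace_T] vs_left_comm[OF vspace_T] vs_add[OF vspace_T]
        vs_smult[OF vspace_T] tw_closed \<iota>_closed alg_one[OF assoc_algebra_U])
  finally show ?thesis
    by simp
qed

definition to_weyl where "to_weyl z = the_elem (lift_weyl ` z)"

lemma to_weyl_hom: "to_weyl \<in> algebra_hom Ph W"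
  and to_weyl_coset: "y \<in> carrier F \<Longrightarrow> to_weyl (phase_coset y) = lift_weyl y"
proof -
  have r: "lift_weyl r = \<zero>\<^bsub>W\<^esub>" if "r \<in> Rel" for r
    using that lift_weyl_rel by (auto simp: Rel_eq)
  show "to_weyl \<in> algebra_hom Ph W"
    using quot_lift_hom[OF assoc_algebra_F Rel_closed assoc_algebra_W lift_weyl_hom r] unfolding Ph_eq to_weyl_def[abs_def] .
  show "y \<in> carrier F \<Longrightarrow> to_weyl (phase_coset y) = lift_weyl y"
    using quot_lift_coset[OF assoc_algebra_F Rel_closed assoc_algebra_W lift_weyl_hom r] unfolding phase_coset_def to_weyl_def .
qed

lemma to_from_weyl: "Y \<in> carrier T \<Longrightarrow> to_weyl (from_weyl Y) = Y"
proof (rule tensor_hom_eqI[OF vspace_U vspace_mvps vspace_T lin_comp[OF from_weyl_lin] lin_id])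
  show "to_weyl \<in> linear_hom Ph T"
    using alg_hom_lin[OF to_weyl_hom] by (simp add: linear_hom_def)
  show "to_weyl (from_weyl (tw a P)) = tw a P" if "a \<in> carrier U" for a P
    using that by (simp add: from_weyl_tw alg_hom_mult[OF to_weyl_hom], simp add: inU_def inS_def to_weyl_coset lift_weyl_jl lift_weyl_jr W_mult_tw wm_unit)
qed

lemma Ph_isomorphic_HD: "isomorphic_algebras Ph HD"
proof -
  have "bij_betw to_weyl (carrier Ph) (carrier HD)"
  proof (rule bij_betw_byWitness[where f' = from_weyl])
    \<comment> \<open>Every z has the form \<open>from_weyl Y\<close>, and \<open>to_weyl\<close>
      returns this Y; so the left inverse of a surjection is also its right inverse.\<close>
    show "\<forall>z\<in>carrier Ph. from_weyl (to_weyl z) = z"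
      using from_weyl_surj to_from_weyl by fastforce
    show "\<forall>Y\<in>carrier HD. to_weyl (from_weyl Y) = Y"
      using to_from_weyl by simp
    show "to_weyl ` carrier Ph \<subseteq> carrier HD"
      using lin_closed[OF alg_hom_lin[OF to_weyl_hom]] by auto
    show "from_weyl ` carrier HD \<subseteq> carrier Ph"
      using lin_closed[OF from_weyl_lin] by auto
  qed
  moreover have "to_weyl \<in> algebra_hom Ph HD"
    unfolding algebra_hom_HD by (rule to_weyl_hom)
  ultimately show ?thesis
    unfolding isomorphic_algebras_def using assoc_algebra_HD by auto
qed

end

theorem mainTheorem3:
  fixes scale :: "'k::field_char_0 \<Rightarrow> 'g::ab_group_add \<Rightarrow> 'g"
    and br :: "'g \<Rightarrow> 'g \<Rightarrow> 'g"
    and x :: "'n::finite \<Rightarrow> 'g"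
    and U :: "('k, ('g free_monoid \<Rightarrow>\<^sub>0 'k) set) hopf"
    and xh :: "'n \<Rightarrow> ('g free_monoid \<Rightarrow>\<^sub>0 'k) set"
    and \<phi> :: "('g free_monoid \<Rightarrow>\<^sub>0 'k) set \<Rightarrow> ('n, 'k) mvps \<Rightarrow> ('n, 'k) mvps"
    and \<phi>m :: "'n \<Rightarrow> 'n \<Rightarrow> ('n, 'k) mvps"
    and \<Delta> :: "('n, 'k) mvps \<Rightarrow> ('n + 'n, 'k) mvps"
    and pair :: "('g free_monoid \<Rightarrow>\<^sub>0 'k) set \<Rightarrow> ('n, 'k) mvps \<Rightarrow> 'k"
  assumes lie: "lie_algebra scale br"
    and basis: "is_basis scale x"
    and U: "U = enveloping_algebra scale br"
    and xh: "xh = (\<lambda>i. env_gen scale br (x i))"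
    and action: "left_hopf_action U mvps_algebra \<phi>"
    and \<phi>m: "\<And>i j. \<phi> (\<ominus>\<^bsub>U\<^esub> xh i) (mvps_var j) = \<phi>m i j"
    and \<phi>m_const: "\<And>i j. const_term (\<phi>m i j) = (if i = j then 1 else 0)"
    and \<Delta>: "\<Delta> = deformed_coproduct U \<phi>"
    and pair: "pair = deformed_pairing U \<phi>"
  shows "(\<exists>!D. leibniz_rule U \<phi> D) \<and>
    heisenberg_data U \<Delta> pair \<and>
    isomorphic_algebras (twisted_weyl_algebra U \<phi>) (heisenberg_double U \<Delta> pair) \<and>
    (\<forall>u\<in>carrier U. \<forall>P. ps_black_action U \<phi> P u =
       tensor_lift U (\<lambda>u1 u2. pair u2 P \<odot>\<^bsub>U\<^esub> u1) (comult U u)) \<and>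
    (\<forall>act. (\<forall>u\<in>carrier U. \<forall>P. act P u =
              tensor_lift U (\<lambda>u1 u2. pair u2 P \<odot>\<^bsub>U\<^esub> u1) (comult U u)) \<longrightarrow>
           (\<forall>u\<in>carrier U. \<forall>P. act P u = ps_black_action U \<phi> P u)) \<and>
    isomorphic_algebras (phase_space_algebra U xh \<phi>m) (heisenberg_double U \<Delta> pair)"
proof -
  interpret A: leading_delta_action scale br x \<phi>
    by unfold_locales (use lie basis action \<phi>m \<phi>m_const in \<open>simp_all add: U xh\<close>)
  have D: "\<Delta> = A.cop" and p: "pair = A.pr"
    by (simp_all add: \<Delta> pair U A.deformed_coproduct_eq A.deformed_pairing_eq)
  have m: "\<phi>m = A.phim"
    using \<phi>m by (simp add: fun_eq_iff A.phim_def U xh)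
  have black: "ps_black_action U \<phi> P v = tensor_lift U (\<lambda>u1 u2. pair u2 P \<odot>\<^bsub>U\<^esub> u1) (comult U v)"
    if "v \<in> carrier U" for v P
    using that unfolding U p by (simp add: A.ps_black_action_eq A.bact_eq)
  have "\<exists>!D. leibniz_rule U \<phi> D"
    unfolding U using A.leibniz_rule_cop A.leibniz_rule_unique by blast
  moreover have "heisenberg_data U \<Delta> pair"
    unfolding U D p by (rule A.heisenberg_data_pr)
  moreover have "isomorphic_algebras (twisted_weyl_algebra U \<phi>) (heisenberg_double U \<Delta> pair)"
    unfolding U D p by (rule A.W_isomorphic_HD)
  moreover have "isomorphic_algebras (phase_space_algebra U xh \<phi>m) (heisenberg_double U \<Delta> pair)"
    unfolding U xh D p m by (rule A.Ph_isomorphic_HD)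
  ultimately show ?thesis
    using black by simp
qed

end
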